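(* Let $d\ge1$, $2<p<\infty$ and $1\leqslant q<\infty$, and let $q'$ be the dual exponent ($\frac1q+\frac1{q'}=1$, $q'=\infty$ if $q=1$). Let $\mu$ be a measure of bounded variation on $\mathbb{R}^d$ such that $\hat{\mu}\in L_{p,q}(\mathbb{R}^d)$. Then for every set $A\subset\mathbb{R}^d$ with $\mathcal{H}_{\frac{2d}{p},\frac{q'}{2}}(A)<\infty$ we have $\mu(A)=0$.
   Context: Lorentz spaces: for a measure space $(X,\mu)$ and $p,q\in(0,\infty)$, $\|f\|^q_{L_{p,q}}=q\int_0^\infty (m_f(t)t^p)^{q/p}\frac{dt}{t}$, where $m_f(t)=\mu(\{x: |f(x)|\geqslant t\})$. Netrusov--Hausdorff capacity: let $\Delta_k=[2^{-k-1},2^{-k})$ for $k\in\mathbb{Z}$. For $F\subset\mathbb{R}^d$, $\alpha>0$, $\delta>0$ and $0<\beta<\infty$ set $\mathcal{H}_{\alpha,\beta}(F,\delta)=\inf\big\{\sum_{k}\big(\sum_{j:\,\operatorname{diam}B_j\in\Delta_k}(\operatorname{diam}B_j)^\alpha\big)^\beta : F\subset\bigcup_j B_j,\ \operatorname{diam}B_j<\delta\big\}$ (countable covers), for $\beta=\infty$ replace $\sum_k(\cdot)^\beta$ by $\sup_k(\cdot)$, and $\mathcal{H}_{\alpha,\beta}(F)=\lim_{\delta\to0}\mathcal{H}_{\alpha,\beta}(F,\delta)$. *)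

theory Defs
  imports "HOL-Analysis.Analysis"
begin

definition epowr :: "ennreal \<Rightarrow> real \<Rightarrow> ennreal" where
  "epowr x b = (if x = \<infinity> then \<infinity> else ennreal (enn2real x powr b))"

definition distrib_fun :: "('a::euclidean_space \<Rightarrow> complex) \<Rightarrow> real \<Rightarrow> ennreal" where
  "distrib_fun f t = emeasure lborel {x. t \<le> cmod (f x)}"

definition lorentz_norm_q :: "real \<Rightarrow> real \<Rightarrow> ('a::euclidean_space \<Rightarrow> complex) \<Rightarrow> ennreal" where
  "lorentz_norm_q p q f =
     ennreal q * (\<integral>\<^sup>+ t. indicator {0<..} t *
        epowr (distrib_fun f t * ennreal (t powr p)) (q / p) / ennreal t \<partial>lborel)"

definition in_lorentz :: "real \<Rightarrow> real \<Rightarrow> ('a::euclidean_space \<Rightarrow> complex) \<Rightarrow> bool" where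
  "in_lorentz p q f \<longleftrightarrow> f \<in> borel_measurable lborel \<and> lorentz_norm_q p q f < \<infinity>"

definition dyadic_Delta :: "int \<Rightarrow> real set" where
  "dyadic_Delta k = {2 powr (- real_of_int k - 1) ..< 2 powr (- real_of_int k)}"

definition ball_cover :: "'a::euclidean_space set \<Rightarrow> real \<Rightarrow> 'a set set \<Rightarrow> bool" where
  "ball_cover F \<delta> \<B> \<longleftrightarrow> countable \<B> \<and> F \<subseteq> \<Union>\<B> \<and>
     (\<forall>B\<in>\<B>. (\<exists>c r. r > 0 \<and> B = ball c r) \<and> diameter B < \<delta>)"

definition NH_cost :: "real \<Rightarrow> ereal \<Rightarrow> 'a::euclidean_space set set \<Rightarrow> ennreal" where
  "NH_cost \<alpha> \<beta> \<B> =
    (let S = (\<lambda>k. \<integral>\<^sup>+ B. ennreal (diameter B powr \<alpha>)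
                  \<partial>count_space {B\<in>\<B>. diameter B \<in> dyadic_Delta k})
     in if \<beta> = \<infinity> then (SUP k. S k)
        else (\<integral>\<^sup>+ k. epowr (S k) (real_of_ereal \<beta>) \<partial>count_space (UNIV :: int set)))"

definition NH_cap_delta :: "real \<Rightarrow> ereal \<Rightarrow> 'a::euclidean_space set \<Rightarrow> real \<Rightarrow> ennreal" where
  "NH_cap_delta \<alpha> \<beta> F \<delta> = (INF \<B>\<in>{\<B>. ball_cover F \<delta> \<B>}. NH_cost \<alpha> \<beta> \<B>)"

text \<open>H_{\<alpha>,\<beta>}(F) = lim_{\<delta>\<rightarrow>0} H(F,\<delta>); the function is nonincreasing in \<delta>,
  so the limit is the supremum over \<delta> > 0.\<close>
definition NH_cap :: "real \<Rightarrow> ereal \<Rightarrow> 'a::euclidean_space set \<Rightarrow> ennreal" where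
  "NH_cap \<alpha> \<beta> F = (SUP \<delta>\<in>{0<..}. NH_cap_delta \<alpha> \<beta> F \<delta>)"

text \<open>A complex measure of bounded variation on \<real>^d, represented as
  \<mu> = M1 - M2 + i (M3 - M4) with finite positive Borel measures.\<close>
definition cmeasure_val :: "'a::euclidean_space measure \<Rightarrow> 'a measure \<Rightarrow> 'a measure \<Rightarrow> 'a measure
    \<Rightarrow> 'a set \<Rightarrow> complex" where
  "cmeasure_val M1 M2 M3 M4 A =
     complex_of_real (measure M1 A - measure M2 A) + \<i> * complex_of_real (measure M3 A - measure M4 A)"

definition cmeasure_fourier :: "'a::euclidean_space measure \<Rightarrow> 'a measure \<Rightarrow> 'a measure \<Rightarrow> 'a measure
    \<Rightarrow> 'a \<Rightarrow> complex" where
  "cmeasure_fourier M1 M2 M3 M4 \<xi> =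
     (let e = (\<lambda>x. cis (- 2 * pi * (x \<bullet> \<xi>))) in
      integral\<^sup>L M1 e - integral\<^sup>L M2 e + \<i> * (integral\<^sup>L M3 e - integral\<^sup>L M4 e))"

definition dual_exp :: "real \<Rightarrow> ereal" where
  "dual_exp q = (if q = 1 then \<infinity> else ereal (q / (q - 1)))"

end

theory Submission
  imports Defs "HOL-Probability.Probability"
begin

text \<open>
  By inner regularity \<open>A\<close> may be taken compact. Replace the balls of a cheap finite cover of \<open>A\<close>
  by boundedly many dyadic cubes of comparable size and keep the maximal ones; let \<open>U\<close> be their
  disjoint union and \<open>f\<^sub>k\<close> the indicator of the part of \<open>U\<close> of level \<open>k\<close>, consisting of
  \<open>N\<^sub>k\<close> cubes. Up to a Gaussian smoothing, \<open>\<mu>(U)\<close> is the pairing of the Fourier transform of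
  \<open>\<Sum>\<^sub>k f\<^sub>k\<close> with that of \<open>\<mu>\<close>.

  The transform of \<open>f\<^sub>k\<close> is the transform of a cube times a trigonometric sum over \<open>N\<^sub>k\<close> lattice
  points, which is periodic and orthogonal on each period cell. This bounds its \<open>L\<^sub>r\<close> norms for
  all \<open>1 < r < 2\<close>, hence its integral over a set of measure about \<open>2\<^sup>i\<close> by
  \<open>(N\<^sub>k 2\<^bsup>-2kd/p\<^esup>)\<^bsup>1/2\<^esup> 2\<^bsup>i/p\<^esup> 2\<^bsup>-\<delta>|i-kd|\<^esup>\<close> for some \<open>\<delta> > 0\<close>. Slicing the transform of
  \<open>\<mu>\<close> by the dyadic sizes of its level sets and applying Hoelder's inequality with exponents
  \<open>q, q'\<close> bounds the pairing by a power of the cost of the cover times a tail of a convergent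
  series, since only levels \<open>k \<ge> K\<close> occur for covers of mesh below \<open>2\<^bsup>-K\<^esup>\<close>. The tail tends to
  \<open>0\<close>, whereas \<open>\<mu>(U)\<close> tends to \<open>\<mu>(A)\<close>.
\<close>

section \<open>Fourier transform of the unit cube\<close>

text \<open>The transform of a cube decays only like the product of 1/(1 + |xi_b|) over the
  coordinates, which lies in L_r for r > 1 but not for r = 1. Hence its integral over a set of
  measure u can be bounded by u^s only for s strictly inside (0, 1/2), up to constants and scaling.
  The hypothesis p > 2 places 1/p inside this interval with room on both sides, and using 1/p -
  \<delta> or 1/p + \<delta> according to the sign of i - kd gives the geometric decay. On a fixed
  diagonal n = i - kd the sum over k pairs a_k = sqrt(N_k 2^(-2kd/p)) with an l_q sequence, so what
  counts is the l_q' norm of a_k. The square root stems from orthogonality: N_k characters have L_2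
  norm sqrt(N_k) on a period cell. Therefore a_k^q' = (N_k 2^(-k\<alpha>))^(q'/2) with \<alpha> =
  2d/p, which explains both parameters of the capacity. The capacity is finite, not zero, so
  refining the cover keeps the cost bounded but does not make it small. Smallness has to come from
  the transform of the measure alone.\<close>

lemma
  fixes f :: "'a::euclidean_space \<Rightarrow> real \<Rightarrow> 'b::{real_normed_field,banach,second_countable_topology}"
  assumes f: "\<And>b. b \<in> Basis \<Longrightarrow> integrable lborel (f b)"
  shows lborel_integrable_prod: "integrable lborel (\<lambda>x::'a. \<Prod>b\<in>Basis. f b (x \<bullet> b))"
    and lborel_integral_prod:
      "(\<integral>x. (\<Prod>b\<in>Basis. f b (x \<bullet> b)) \<partial>(lborel :: 'a measure)) = (\<Prod>b\<in>Basis. integral\<^sup>L lborel (f b))"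
proof -
  interpret product_sigma_finite "\<lambda>_::'a. lborel :: real measure" ..
  have [measurable]: "\<And>b. b \<in> Basis \<Longrightarrow> f b \<in> borel_measurable borel"
    using f borel_measurable_integrable by fastforce
  have coord: "(\<Sum>b'\<in>Basis. x b' *\<^sub>R b') \<bullet> b = x b" if "b \<in> Basis" for x and b :: 'a
    using that by (simp add: inner_sum_left inner_Basis if_distrib[of "\<lambda>r. _ * r"] cong: if_cong)
  show "integrable lborel (\<lambda>x::'a. \<Prod>b\<in>Basis. f b (x \<bullet> b))"
    by (subst lborel_eq, subst integrable_distr_eq)
       (auto simp: coord intro!: product_integrable_prod f)
  show "(\<integral>x. (\<Prod>b\<in>Basis. f b (x \<bullet> b)) \<partial>(lborel :: 'a measure)) = (\<Prod>b\<in>Basis. integral\<^sup>L lborel (f b))"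
    by (subst lborel_eq, subst integral_distr)
       (auto simp: coord intro!: product_integral_prod f)
qed

lemma nn_integral_lborel_affine:
  fixes f :: "'a::euclidean_space \<Rightarrow> ennreal"
  assumes [measurable]: "f \<in> borel_measurable borel" and c: "c \<noteq> 0"
  shows "(\<integral>\<^sup>+x. f x \<partial>lborel) = ennreal (\<bar>c\<bar> ^ DIM('a)) * (\<integral>\<^sup>+x. f (t + c *\<^sub>R x) \<partial>lborel)"
  by (subst lborel_affine[OF c, of t])
     (simp add: nn_integral_density nn_integral_distr nn_integral_cmult)

lemma lborel_integrable_affine:
  fixes f :: "'a::euclidean_space \<Rightarrow> 'b::{banach, second_countable_topology}"
  assumes f: "integrable lborel f" and c: "c \<noteq> 0"
  shows "integrable lborel (\<lambda>x. f (t + c *\<^sub>R x))"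
proof -
  have [measurable]: "f \<in> borel_measurable borel"
    using f by auto
  have "ennreal (\<bar>c\<bar> ^ DIM('a)) * (\<integral>\<^sup>+x. norm (f (t + c *\<^sub>R x)) \<partial>lborel) < \<infinity>"
    using f nn_integral_lborel_affine[of "\<lambda>x. ennreal (norm (f x))" c t] c
    by (simp add: integrable_iff_bounded)
  then show ?thesis
    using c by (auto simp: integrable_iff_bounded ennreal_mult_less_top)
qed

lemma lborel_integral_affine:
  fixes f :: "'a::euclidean_space \<Rightarrow> 'b::{banach, second_countable_topology}"
  assumes f: "integrable lborel f" and c: "c \<noteq> 0"
  shows "(\<integral>x. f x \<partial>lborel) = (\<bar>c\<bar> ^ DIM('a)) *\<^sub>R (\<integral>x. f (t + c *\<^sub>R x) \<partial>lborel)"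
proof -
  have [measurable]: "f \<in> borel_measurable borel"
    using f by auto
  show ?thesis
    by (subst lborel_affine[OF c, of t])
       (simp add: integral_density integral_distr lborel_integrable_affine[OF f c])
qed

section \<open>The integer lattice and its half-open unit cells\<close>

text \<open>Cells are encoded as the fibres of this map: they partition the space with no shared
  boundaries, and inclusions between dyadic cubes become arithmetic of floors.\<close>

definition lattice_floor :: "'a::euclidean_space \<Rightarrow> 'a" where
  "lattice_floor x = (\<Sum>b\<in>Basis. of_int \<lfloor>x \<bullet> b\<rfloor> *\<^sub>R b)"

definition int_lattice :: "'a::euclidean_space set" where
  "int_lattice = {x. \<forall>b\<in>Basis. x \<bullet> b \<in> \<int>}"

lemma lattice_floor_inner [simp]: "b \<in> Basis \<Longrightarrow> lattice_floor x \<bullet> b = of_int \<lfloor>x \<bullet> b\<rfloor>"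
  by (simp add: lattice_floor_def)

lemma lattice_floor_in_lattice [simp]: "lattice_floor x \<in> int_lattice"
  by (simp add: int_lattice_def)

lemma lattice_floor_add:
  "n \<in> int_lattice \<Longrightarrow> lattice_floor (n + x) = n + lattice_floor x"
  by (auto simp: int_lattice_def euclidean_eq_iff[of "lattice_floor (n + x)"] inner_add_left elim!: Ints_cases)

lemma int_lattice_zero [simp]: "0 \<in> int_lattice"
  by (simp add: int_lattice_def)

lemma int_lattice_minus: "m \<in> int_lattice \<Longrightarrow> n \<in> int_lattice \<Longrightarrow> m - n \<in> int_lattice"
  by (simp add: int_lattice_def inner_diff_left)

lemma int_lattice_inner: "m \<in> int_lattice \<Longrightarrow> n \<in> int_lattice \<Longrightarrow> m \<bullet> n \<in> \<int>"
  by (subst euclidean_inner) (auto simp: int_lattice_def intro!: Ints_sum)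

lemma countable_int_lattice: "countable (int_lattice :: 'a::euclidean_space set)"
proof -
  have "(int_lattice :: 'a set) \<subseteq> (\<lambda>f. \<Sum>b\<in>Basis. f b *\<^sub>R b) ` (Basis \<rightarrow>\<^sub>E \<int>)"
  proof
    fix x :: 'a assume "x \<in> int_lattice"
    then show "x \<in> (\<lambda>f. \<Sum>b\<in>Basis. f b *\<^sub>R b) ` (Basis \<rightarrow>\<^sub>E \<int>)"
      by (intro image_eqI[of _ _ "restrict (\<lambda>b. x \<bullet> b) Basis"])
         (auto simp: int_lattice_def euclidean_representation)
  qed
  moreover have "countable (Basis \<rightarrow>\<^sub>E (\<int> :: real set) :: ('a \<Rightarrow> real) set)"
    by (intro countable_PiE) (auto simp: Ints_def)
  ultimately show ?thesis
    by (meson countable_image countable_subset)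
qed

lemma lattice_floor_measurable [measurable]: "lattice_floor \<in> borel_measurable borel"
  unfolding lattice_floor_def[abs_def] by measurable

lemma indicator_unit_cell:
  "indicator {x. lattice_floor x = 0} x = (\<Prod>b\<in>Basis. indicator {0..<1} (x \<bullet> b) :: real)"
proof -
  have "lattice_floor x = 0 \<longleftrightarrow> (\<forall>b\<in>Basis. x \<bullet> b \<in> {0..<1})"
    by (auto simp: euclidean_eq_iff[of "lattice_floor x"] floor_eq_iff)
  then show ?thesis
    by (auto simp: indicator_def)
qed

lemma cis_inner: "cis (c * (x \<bullet> y)) = (\<Prod>b\<in>Basis. cis (c * (x \<bullet> b) * (y \<bullet> b)))"
proof -
  have "cis (\<Sum>b\<in>A. h b) = (\<Prod>b\<in>A. cis (h b))" if "finite A" for A and h :: "'a \<Rightarrow> real"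
    using that by (induction A) (auto simp: cis_mult[symmetric])
  then show ?thesis
    by (subst euclidean_inner) (simp add: sum_distrib_left mult.assoc)
qed

lemma borel_measurable_cis [measurable (raw)]:
  "f \<in> borel_measurable M \<Longrightarrow> (\<lambda>x. cis (f x)) \<in> borel_measurable M"
  by (rule measurable_compose[where g=cis and N=borel])
     (auto intro!: borel_measurable_continuous_onI continuous_intros)

section \<open>Decay and zeros of the transforms of interval and cell\<close>

definition interval_fourier :: "real \<Rightarrow> complex" where
  "interval_fourier x = (\<integral>y. indicator {0..<1} y *\<^sub>R cis (2 * pi * y * x) \<partial>lborel)"

lemma interval_fourier_integrable:
  "integrable lborel (\<lambda>y. indicator {0..<1::real} y *\<^sub>R cis (2 * pi * y * x))"
  by (rule Bochner_Integration.integrable_bound[of _ "indicator {0..<1::real} :: real \<Rightarrow> real"])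
     (simp_all add: split: split_indicator)

lemma interval_fourier_0 [simp]: "interval_fourier 0 = 1"
  by (simp add: interval_fourier_def)

lemma interval_fourier_eq:
  assumes "x \<noteq> 0"
  shows "interval_fourier x = (cis (2 * pi * x) - 1) / (2 * pi * x * \<i>)"
proof -
  let ?F = "\<lambda>y::real. cis (2 * pi * y * x) / (2 * pi * x * \<i>)"
  have "(\<integral>y. indicator {0..1} y *\<^sub>R cis (2 * pi * y * x) \<partial>lborel) = ?F 1 - ?F 0"
  proof (rule integral_FTC_atLeastAtMost)
    show "(?F has_vector_derivative cis (2 * pi * y * x)) (at y within {0..1})" for y
      unfolding has_vector_derivative_complex_iff 
      using assms by (auto intro!: derivative_eq_intros simp: Re_divide Im_divide power2_eq_square field_simps)
    show "continuous_on {0..1} (\<lambda>y. cis (2 * pi * y * x))"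
      by (intro continuous_intros)
  qed simp
  moreover have "interval_fourier x = (\<integral>y. indicator {0..1} y *\<^sub>R cis (2 * pi * y * x) \<partial>lborel)"
    unfolding interval_fourier_def
    by (rule integral_cong_AE)
       (use AE_lborel_singleton[of "1::real"] in \<open>auto split: split_indicator elim!: eventually_mono\<close>)
  ultimately show ?thesis
    by (simp add: diff_divide_distrib)
qed

lemma interval_fourier_int: "x \<in> \<int> \<Longrightarrow> x \<noteq> 0 \<Longrightarrow> interval_fourier x = 0"
  by (auto simp: interval_fourier_eq elim!: Ints_cases)
     

text \<open>For |x| at most 1 the trivial bound 1 suffices, beyond that the closed formula gives the
  decay. The denominator 1 + |x| joins both ranges, so that no singularity at 0 has to be avoided
  later.\<close>

lemma norm_interval_fourier_le: "norm (interval_fourier x) \<le> 2 / (1 + \<bar>x\<bar>)"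
proof (cases "\<bar>x\<bar> \<le> 1")
  case True
  have "norm (interval_fourier x) \<le> (\<integral>y. norm (indicator {0..<1::real} y *\<^sub>R cis (2 * pi * y * x)) \<partial>lborel)"
    unfolding interval_fourier_def by (rule integral_norm_bound)
  also have "\<dots> = 1"
    by simp
  also have "1 \<le> 2 / (1 + \<bar>x\<bar>)"
    using True by (simp add: field_simps)
  finally show ?thesis .
next
  case False
  then have "norm (interval_fourier x) = norm (cis (2 * pi * x) - 1) / (2 * pi * \<bar>x\<bar>)"
    by (subst interval_fourier_eq) (auto simp: norm_divide norm_mult)
  also have "\<dots> \<le> 2 / (2 * pi * \<bar>x\<bar>)"
    by (intro divide_right_mono order_trans[OF norm_triangle_ineq4]) auto
  also have "\<dots> \<le> 2 / (1 + \<bar>x\<bar>)"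
  proof (intro divide_left_mono)
    have "1 * \<bar>x\<bar> \<le> pi * \<bar>x\<bar>"
      using pi_ge_two by (intro mult_right_mono) auto
    then show "1 + \<bar>x\<bar> \<le> 2 * pi * \<bar>x\<bar>"
      using False by linarith
  qed (use False in \<open>auto intro!: mult_pos_pos add_pos_nonneg\<close>)
  finally show ?thesis .
qed

definition cell_fourier :: "'a::euclidean_space \<Rightarrow> complex" where
  "cell_fourier \<xi> = (\<integral>y. indicator {y. lattice_floor y = 0} y *\<^sub>R cis (2 * pi * (y \<bullet> \<xi>)) \<partial>lborel)"

lemma cell_integrand_eq:
  "indicator {y. lattice_floor y = 0} y *\<^sub>R cis (2 * pi * (y \<bullet> \<xi>)) =
    (\<Prod>b\<in>Basis. indicator {0..<1} (y \<bullet> b) *\<^sub>R cis (2 * pi * (y \<bullet> b) * (\<xi> \<bullet> b)))"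
  by (subst cis_inner) (simp add: scaleR_conv_of_real prod.distrib indicator_unit_cell)

lemma cell_integrable:
  "integrable lborel (\<lambda>y. indicator {y. lattice_floor y = 0} y *\<^sub>R cis (2 * pi * (y \<bullet> \<xi>)))"
  unfolding cell_integrand_eq by (rule lborel_integrable_prod) (rule interval_fourier_integrable)

lemma cell_fourier_eq: "cell_fourier \<xi> = (\<Prod>b\<in>Basis. interval_fourier (\<xi> \<bullet> b))"
  unfolding cell_fourier_def cell_integrand_eq interval_fourier_def
  by (rule lborel_integral_prod) (rule interval_fourier_integrable)

text \<open>A majorant of the cube transform without its zeros. Its powers with exponent above 1 are
  integrable, while the weight itself is not.\<close>

definition cell_weight :: "'a::euclidean_space \<Rightarrow> real" where
  "cell_weight x = (\<Prod>b\<in>Basis. 2 / (1 + \<bar>x \<bullet> b\<bar>))"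

lemma norm_cell_fourier_le: "norm (cell_fourier \<xi>) \<le> cell_weight \<xi>"
  unfolding cell_fourier_eq cell_weight_def prod_norm[symmetric]
  by (intro prod_mono) (auto intro: norm_interval_fourier_le)

lemma cell_fourier_0 [simp]: "cell_fourier 0 = 1"
  by (simp add: cell_fourier_eq)

lemma cell_fourier_lattice: "n \<in> int_lattice \<Longrightarrow> n \<noteq> 0 \<Longrightarrow> cell_fourier n = 0"
  by (auto simp: cell_fourier_eq euclidean_eq_iff[of n] int_lattice_def intro: interval_fourier_int)

lemma cell_weight_pos: "0 < cell_weight x"
  unfolding cell_weight_def by (intro prod_pos) (auto intro!: divide_pos_pos add_pos_nonneg)

lemma cell_weight_measurable [measurable]: "cell_weight \<in> borel_measurable borel"
  unfolding cell_weight_def[abs_def] by measurable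

text \<open>Coordinates of two points of a cell differ by at most 1, which costs a factor 2 per
  coordinate. This allows the weight to be frozen on each cell, where the orthogonality of the
  trigonometric sums is available.\<close>

lemma cell_weight_same_cell:
  fixes x y :: "'a::euclidean_space"
  assumes "lattice_floor x = lattice_floor y"
  shows "cell_weight x \<le> 2 ^ DIM('a) * cell_weight y"
proof -
  have "2 / (1 + \<bar>x \<bullet> b\<bar>) \<le> 2 * (2 / (1 + \<bar>y \<bullet> b\<bar>))" if "b \<in> Basis" for b
  proof -
    have "\<lfloor>x \<bullet> b\<rfloor> = \<lfloor>y \<bullet> b\<rfloor>"
      using that arg_cong[OF assms, of "\<lambda>z. z \<bullet> b"] by simp
    then have "\<bar>x \<bullet> b - y \<bullet> b\<bar> \<le> 1"
      by linarith
    then have "1 + \<bar>y \<bullet> b\<bar> \<le> 2 * (1 + \<bar>x \<bullet> b\<bar>)"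
      by (auto simp: abs_if split: if_splits)
    moreover have "0 < 1 + \<bar>y \<bullet> b\<bar>" "0 < 1 + \<bar>x \<bullet> b\<bar>"
      by linarith+
    ultimately show ?thesis
      by (simp add: field_simps)
  qed
  then have "cell_weight x \<le> (\<Prod>b\<in>Basis. 2 * (2 / (1 + \<bar>y \<bullet> b\<bar>)))"
    unfolding cell_weight_def by (intro prod_mono) auto
  also have "\<dots> = 2 ^ DIM('a) * cell_weight y"
    unfolding cell_weight_def by (simp only: prod.distrib prod_constant)
  finally show ?thesis .
qed

section \<open>Trigonometric sums over lattice points\<close>

definition trig_sum :: "'a::euclidean_space set \<Rightarrow> 'a \<Rightarrow> complex" where
  "trig_sum S \<eta> = (\<Sum>n\<in>S. cis (2 * pi * (n \<bullet> \<eta>)))"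

lemma trig_sum_measurable [measurable]: "trig_sum S \<in> borel_measurable borel"
  unfolding trig_sum_def[abs_def] by measurable

lemma cis_2pi_Ints: "x \<in> \<int> \<Longrightarrow> cis (2 * pi * x) = 1"
  by (auto elim!: Ints_cases)

lemma trig_sum_periodic:
  assumes "S \<subseteq> int_lattice" "n \<in> int_lattice"
  shows "trig_sum S (n + \<eta>) = trig_sum S \<eta>"
  unfolding trig_sum_def
proof (rule sum.cong)
  fix m assume "m \<in> S"
  then have "cis (2 * pi * (m \<bullet> n)) = 1"
    using assms by (intro cis_2pi_Ints int_lattice_inner) auto
  then show "cis (2 * pi * (m \<bullet> (n + \<eta>))) = cis (2 * pi * (m \<bullet> \<eta>))"
    by (simp add: inner_add_right distrib_left cis_mult[symmetric])
qed simp

text \<open>Parseval on a period cell. In the expanded square the off-diagonal terms are values of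
  \<open>cell_fourier\<close> at nonzero lattice vectors, hence zero, and each diagonal term is 1.
  Periodicity transfers the result from the cell at 0 to the cell at \<open>n\<close>.\<close>

lemma nn_integral_trig_sum_cell:
  fixes S :: "'a::euclidean_space set"
  assumes S: "finite S" "S \<subseteq> int_lattice" and n: "n \<in> int_lattice"
  shows "(\<integral>\<^sup>+x. indicator {x. lattice_floor x = n} x * ennreal ((norm (trig_sum S x))\<^sup>2) \<partial>lborel) = card S"
proof -
  define f where "f x = indicator {x. lattice_floor x = 0} x *\<^sub>R complex_of_real ((norm (trig_sum S x))\<^sup>2)"
    for x :: 'a
  have f_eq: "f x = (\<Sum>m\<in>S. \<Sum>k\<in>S. indicator {x. lattice_floor x = 0} x *\<^sub>R cis (2 * pi * (x \<bullet> (m - k))))" for x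
    unfolding f_def complex_norm_square trig_sum_def cnj_sum sum_product scaleR_sum_right
    by (intro sum.cong refl arg_cong2[where f=scaleR])
       (simp add: cis_cnj cis_mult inner_commute[of x] inner_diff_left right_diff_distrib)
  have f_int: "integrable lborel f"
    unfolding f_eq[abs_def] by (intro Bochner_Integration.integrable_sum cell_integrable)
  have "(\<integral>x. f x \<partial>lborel) = (\<Sum>m\<in>S. \<Sum>k\<in>S. cell_fourier (m - k))"
    unfolding f_eq cell_fourier_def
    by (simp add: Bochner_Integration.integral_sum Bochner_Integration.integrable_sum cell_integrable)
  also have "\<dots> = (\<Sum>m\<in>S. \<Sum>k\<in>S. if m = k then 1 else 0)"
    using S by (intro sum.cong refl) (auto intro!: cell_fourier_lattice int_lattice_minus)
  finally have f_val: "(\<integral>x. f x \<partial>lborel) = of_nat (card S)"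
    using S by simp
  have "(\<integral>\<^sup>+x. indicator {x. lattice_floor x = n} x * ennreal ((norm (trig_sum S x))\<^sup>2) \<partial>lborel) =
        (\<integral>\<^sup>+x. indicator {x. lattice_floor x = 0} x * ennreal ((norm (trig_sum S x))\<^sup>2) \<partial>lborel)"
    by (subst nn_integral_lborel_affine[where c=1 and t=n])
       (auto simp: trig_sum_periodic[OF S(2) n] lattice_floor_add[OF n] indicator_def)
  also have "\<dots> = (\<integral>\<^sup>+x. ennreal (Re (f x)) \<partial>lborel)"
    by (intro nn_integral_cong) (simp add: f_def split: split_indicator)
  also have "\<dots> = ennreal (\<integral>x. Re (f x) \<partial>lborel)"
    by (intro nn_integral_eq_integral integrable_Re f_int) (auto simp: f_def)
  also have "(\<integral>x. Re (f x) \<partial>lborel) = card S"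
    using f_int f_val by simp
  finally show ?thesis
    by (simp add: ennreal_of_nat_eq_real_of_nat)
qed

lemma nn_integral_lattice_cells:
  fixes f :: "'a::euclidean_space \<Rightarrow> ennreal"
  assumes [measurable]: "f \<in> borel_measurable borel"
  shows "(\<integral>\<^sup>+x. f x \<partial>lborel) =
    (\<integral>\<^sup>+n. (\<integral>\<^sup>+x. indicator {x. lattice_floor x = n} x * f x \<partial>lborel) \<partial>count_space int_lattice)"
proof -
  have "f x = (\<integral>\<^sup>+n. indicator {x. lattice_floor x = n} x * f x \<partial>count_space int_lattice)" for x
    by (subst nn_integral_count_space'[where A="{lattice_floor x}"]) auto
  then have "(\<integral>\<^sup>+x. f x \<partial>lborel) =
      (\<integral>\<^sup>+x. (\<integral>\<^sup>+n. indicator {x. lattice_floor x = n} x * f x \<partial>count_space int_lattice) \<partial>lborel)"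
    by simp
  also have "\<dots> = (\<integral>\<^sup>+n. (\<integral>\<^sup>+x. indicator {x. lattice_floor x = n} x * f x \<partial>lborel) \<partial>count_space int_lattice)"
    by (intro nn_integral_count_space_nn_integral countable_int_lattice) simp
  finally show ?thesis .
qed

text \<open>For \<open>S = {0}\<close> the trigonometric sum is constantly 1, so the Parseval
  identity returns the volume of the cell.\<close>

lemma emeasure_lattice_cell:
  assumes "n \<in> int_lattice"
  shows "emeasure lborel {x. lattice_floor x = n} = 1"
  using nn_integral_trig_sum_cell[of "{0}" n] assms by (simp add: trig_sum_def)

section \<open>Weighted integrals of trigonometric sums\<close>

lemma nn_integral_inverse_power_finite:
  assumes \<theta>: "1 < \<theta>"
  shows "(\<integral>\<^sup>+x. ennreal ((2 / (1 + \<bar>x\<bar>)) powr \<theta>) \<partial>lborel) < \<infinity>"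
proof -
  define f :: "real \<Rightarrow> real" where "f x = (2 / (1 + \<bar>x\<bar>)) powr \<theta>" for x
  have [measurable]: "f \<in> borel_measurable borel"
    unfolding f_def[abs_def] by measurable
  define F :: "real \<Rightarrow> real" where "F x = - (2 powr \<theta> / (\<theta> - 1)) * (1 + x) powr (1 - \<theta>)" for x
  have half: "(\<integral>\<^sup>+x. ennreal (f x) * indicator {0..} x \<partial>lborel) = ennreal (0 - F 0)"
  proof (rule nn_integral_FTC_atLeast)
    show "DERIV F x :> f x" if "0 \<le> x" for x
    proof -
      have "DERIV F x :> - (2 powr \<theta> / (\<theta> - 1)) * ((1 - \<theta>) * (1 + x) powr (1 - \<theta> - 1))"
        unfolding F_def using that \<theta> by (auto intro!: derivative_eq_intros)
      also have "- (2 powr \<theta> / (\<theta> - 1)) * ((1 - \<theta>) * (1 + x) powr (1 - \<theta> - 1)) = f x"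
        using \<theta> that by (simp add: f_def powr_divide powr_minus_divide field_simps)
      finally show ?thesis .
    qed
    have "((\<lambda>x. (1 + x) powr (1 - \<theta>)) \<longlongrightarrow> 0) at_top"
      using \<theta> by real_asymp
    from tendsto_mult_left[OF this] show "(F \<longlongrightarrow> 0) at_top"
      unfolding F_def[abs_def] by (metis mult_zero_right)
  qed (auto simp: f_def)
  have "(\<integral>\<^sup>+x. ennreal (f x) \<partial>lborel) \<le>
      (\<integral>\<^sup>+x. ennreal (f x) * indicator {0..} x + ennreal (f (-x)) * indicator {0..} (- x) \<partial>lborel)"
    by (intro nn_integral_mono) (auto simp: f_def split: split_indicator)
  also have "\<dots> = (\<integral>\<^sup>+x. ennreal (f x) * indicator {0..} x \<partial>lborel) +
      (\<integral>\<^sup>+x. ennreal (f (-x)) * indicator {0..} (- x) \<partial>lborel)"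
    by (intro nn_integral_add) auto
  also have "(\<integral>\<^sup>+x. ennreal (f (-x)) * indicator {0..} (- x) \<partial>lborel) = (\<integral>\<^sup>+x. ennreal (f x) * indicator {0..} x \<partial>lborel)"
    by (subst (2) nn_integral_real_affine[where c="-1" and t=0]) auto
  finally show ?thesis
    unfolding f_def[symmetric] half
    by (rule le_less_trans) (simp add: less_top[symmetric])
qed

lemma nn_integral_cell_weight_finite:
  assumes "1 < \<theta>"
  shows "(\<integral>\<^sup>+x. ennreal (cell_weight (x :: 'a::euclidean_space) powr \<theta>) \<partial>lborel) < \<infinity>"
proof -
  have "ennreal (cell_weight x powr \<theta>) = (\<Prod>b\<in>Basis. ennreal ((2 / (1 + \<bar>x \<bullet> b\<bar>)) powr \<theta>))" for x :: 'a
    unfolding cell_weight_def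
    by (subst prod_powr_distrib) (auto simp: prod_ennreal intro!: divide_nonneg_nonneg)
  then have "(\<integral>\<^sup>+x. ennreal (cell_weight (x :: 'a) powr \<theta>) \<partial>lborel) =
      (\<Prod>b\<in>(Basis :: 'a set). \<integral>\<^sup>+x. ennreal ((2 / (1 + \<bar>x\<bar>)) powr \<theta>) \<partial>lborel)"
    by (simp only:) (subst nn_integral_lborel_prod, auto)
  also have "\<dots> < \<infinity>"
    using nn_integral_inverse_power_finite[OF assms]
    by (simp add: less_top[symmetric] ennreal_prod_eq_top power_eq_top_ennreal)
  finally show ?thesis .
qed

text \<open>Cell by cell, the weight is replaced by its value at the corner, Parseval is applied,
  and the corner value is turned back into the integral of the weight. Each replacement costs the
  comparison constant, hence its square.\<close>

lemma nn_integral_cell_weight_trig_sum: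
  fixes S :: "'a::euclidean_space set"
  assumes S: "finite S" "S \<subseteq> int_lattice" and "0 \<le> \<theta>"
  shows "(\<integral>\<^sup>+x. ennreal (cell_weight x powr \<theta>) * ennreal ((norm (trig_sum S x))\<^sup>2) \<partial>lborel) \<le>
    ennreal (((2 ^ DIM('a)) powr \<theta>)\<^sup>2) * (\<integral>\<^sup>+x. ennreal (cell_weight (x::'a) powr \<theta>) \<partial>lborel) * card S"
proof -
  define c :: real where "c = (2 ^ DIM('a)) powr \<theta>"
  have c: "0 \<le> c"
    by (simp add: c_def)
  define E where "E n = {x :: 'a. lattice_floor x = n}" for n
  have [measurable]: "E n \<in> sets borel" for n
    unfolding E_def by measurable
  have compare: "cell_weight x powr \<theta> \<le> c * cell_weight y powr \<theta>"
    if "lattice_floor x = lattice_floor y" for x y :: 'a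
  proof -
    have "cell_weight x powr \<theta> \<le> (2 ^ DIM('a) * cell_weight y) powr \<theta>"
      using \<open>0 \<le> \<theta>\<close> cell_weight_pos[of x] cell_weight_same_cell[OF that]
      by (intro powr_mono2) (auto intro: less_imp_le)
    also have "\<dots> = c * cell_weight y powr \<theta>"
      using cell_weight_pos[of y] by (simp add: c_def powr_mult)
    finally show ?thesis .
  qed
  have cell: "(\<integral>\<^sup>+x. indicator (E n) x * (ennreal (cell_weight x powr \<theta>) * ennreal ((norm (trig_sum S x))\<^sup>2)) \<partial>lborel) \<le>
      (\<integral>\<^sup>+x. indicator (E n) x * ennreal (cell_weight x powr \<theta>) \<partial>lborel) * ennreal (c\<^sup>2) * card S"
    (is "?L \<le> ?I * _ * _")
    if n: "n \<in> int_lattice" for n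
  proof -
    have fln: "lattice_floor n = n"
      using lattice_floor_add[OF n, of 0] by (simp add: lattice_floor_def)
    have "?L \<le> (\<integral>\<^sup>+x. ennreal (c * cell_weight n powr \<theta>) * (indicator (E n) x * ennreal ((norm (trig_sum S x))\<^sup>2)) \<partial>lborel)"
    proof (intro nn_integral_mono)
      fix x
      show "indicator (E n) x * (ennreal (cell_weight x powr \<theta>) * ennreal ((norm (trig_sum S x))\<^sup>2)) \<le>
        ennreal (c * cell_weight n powr \<theta>) * (indicator (E n) x * ennreal ((norm (trig_sum S x))\<^sup>2))"
        using compare[of x n] fln
        by (auto simp: E_def split: split_indicator intro!: mult_right_mono ennreal_leI)
    qed
    also have "\<dots> = ennreal (c * cell_weight n powr \<theta>) * card S"
      using nn_integral_trig_sum_cell[OF S n] by (simp add: nn_integral_cmult E_def)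
    also have "ennreal (c * cell_weight n powr \<theta>) = (\<integral>\<^sup>+x. ennreal (c * cell_weight n powr \<theta>) * indicator (E n) x \<partial>lborel)"
      using emeasure_lattice_cell[OF n] by (simp add: nn_integral_cmult_indicator E_def)
    also have "\<dots> \<le> (\<integral>\<^sup>+x. ennreal (c\<^sup>2) * (indicator (E n) x * ennreal (cell_weight x powr \<theta>)) \<partial>lborel)"
    proof (intro nn_integral_mono)
      fix x
      show "ennreal (c * cell_weight n powr \<theta>) * indicator (E n) x \<le>
          ennreal (c\<^sup>2) * (indicator (E n) x * ennreal (cell_weight x powr \<theta>))"
        using mult_left_mono[OF compare[of n x] c] fln c
        by (auto simp: E_def ennreal_mult[symmetric] power2_eq_square mult_ac split: split_indicator intro!: ennreal_leI)
    qed
    also have "\<dots> = ennreal (c\<^sup>2) * ?I"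
      by (intro nn_integral_cmult) measurable
    finally show ?thesis
      by (simp add: mult_ac mult_right_mono)
  qed
  have "(\<integral>\<^sup>+x. ennreal (cell_weight x powr \<theta>) * ennreal ((norm (trig_sum S x))\<^sup>2) \<partial>lborel) =
      (\<integral>\<^sup>+n. (\<integral>\<^sup>+x. indicator (E n) x * (ennreal (cell_weight x powr \<theta>) * ennreal ((norm (trig_sum S x))\<^sup>2)) \<partial>lborel) \<partial>count_space int_lattice)"
    unfolding E_def by (rule nn_integral_lattice_cells) measurable
  also have "\<dots> \<le> (\<integral>\<^sup>+n. (\<integral>\<^sup>+x. indicator (E n) x * ennreal (cell_weight x powr \<theta>) \<partial>lborel) * ennreal (c\<^sup>2) * card S \<partial>count_space int_lattice)"
    by (intro nn_integral_mono cell) simp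
  also have "\<dots> = (\<integral>\<^sup>+n. (\<integral>\<^sup>+x. indicator (E n) x * ennreal (cell_weight x powr \<theta>) \<partial>lborel) \<partial>count_space int_lattice) * ennreal (c\<^sup>2) * card S"
    by (simp add: nn_integral_multc)
  also have "(\<integral>\<^sup>+n. (\<integral>\<^sup>+x. indicator (E n) x * ennreal (cell_weight x powr \<theta>) \<partial>lborel) \<partial>count_space int_lattice) =
      (\<integral>\<^sup>+x. ennreal (cell_weight (x::'a) powr \<theta>) \<partial>lborel)"
    unfolding E_def by (rule nn_integral_lattice_cells[symmetric]) measurable
  finally show ?thesis
    by (simp add: c_def mult_ac)
qed

text \<open>The exponent 2 - \<theta> lies below 1, so integrability over the whole space fails and
  the measure of \<open>E\<close> must help. Where the weight is at most \<open>c\<close> the bound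
  is c^(2-\<theta>) times the measure; elsewhere the surplus power is traded for the integrable
  power \<theta>.\<close>

lemma set_integral_cell_weight_le:
  fixes E :: "'a::euclidean_space set"
  assumes [measurable]: "E \<in> sets borel" and u: "emeasure lborel E = ennreal u" "0 < u"
    and \<theta>: "1 < \<theta>" "\<theta> < 2"
  shows "(\<integral>\<^sup>+x. indicator E x * ennreal (cell_weight x powr (2 - \<theta>)) \<partial>lborel) \<le>
    ennreal (u powr (2 * (1 - 1 / \<theta>))) * (1 + (\<integral>\<^sup>+x. ennreal (cell_weight (x::'a) powr \<theta>) \<partial>lborel))"
proof -
  \<comment> \<open>The threshold with c^\<theta> u = 1, which makes c^(2-\<theta>) u and
    c^(2-2\<theta>) equal.\<close>
  define c where "c = u powr (- 1 / \<theta>)"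
  have c: "0 < c"
    using u by (simp add: c_def)
  have pt: "cell_weight x powr (2 - \<theta>) \<le> c powr (2 - \<theta>) + c powr (2 - 2 * \<theta>) * cell_weight x powr \<theta>" for x :: 'a
  proof (cases "cell_weight x \<le> c")
    case True
    then have "cell_weight x powr (2 - \<theta>) \<le> c powr (2 - \<theta>)"
      using \<theta> cell_weight_pos[of x] by (intro powr_mono2) auto
    moreover have "0 \<le> c powr (2 - 2 * \<theta>) * cell_weight x powr \<theta>"
      by simp
    ultimately show ?thesis
      by linarith
  next
    case False
    have "cell_weight x powr (2 - \<theta>) = cell_weight x powr (2 - 2 * \<theta>) * cell_weight x powr \<theta>"
      by (simp add: powr_add[symmetric])
    also have "\<dots> \<le> c powr (2 - 2 * \<theta>) * cell_weight x powr \<theta>"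
      using \<theta> c False by (intro mult_right_mono powr_mono2') auto
    also have "\<dots> \<le> c powr (2 - \<theta>) + \<dots>"
      by simp
    finally show ?thesis .
  qed
  have "(\<integral>\<^sup>+x. indicator E x * ennreal (cell_weight x powr (2 - \<theta>)) \<partial>lborel) \<le>
      (\<integral>\<^sup>+x. ennreal (c powr (2 - \<theta>)) * indicator E x + ennreal (c powr (2 - 2 * \<theta>)) * ennreal (cell_weight x powr \<theta>) \<partial>lborel)"
    by (intro nn_integral_mono)
       (auto split: split_indicator simp: ennreal_plus[symmetric] ennreal_mult[symmetric] 
         simp del: ennreal_plus intro!: ennreal_leI pt)
  also have "\<dots> = ennreal (c powr (2 - \<theta>)) * ennreal u +
      ennreal (c powr (2 - 2 * \<theta>)) * (\<integral>\<^sup>+x. ennreal (cell_weight (x::'a) powr \<theta>) \<partial>lborel)"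
    by (simp add: nn_integral_add nn_integral_cmult nn_integral_cmult_indicator u)
  also have "ennreal (c powr (2 - \<theta>)) * ennreal u = ennreal (u powr (2 * (1 - 1 / \<theta>)))"
  proof -
    have "c powr (2 - \<theta>) * u = u powr ((- 1 / \<theta>) * (2 - \<theta>) + 1)"
      using u by (subst powr_add) (simp add: c_def powr_powr)
    also have "(- 1 / \<theta>) * (2 - \<theta>) + 1 = 2 * (1 - 1 / \<theta>)"
      using \<theta> by (simp add: field_simps)
    finally show ?thesis
      using u by (simp add: ennreal_mult[symmetric])
  qed
  also have "c powr (2 - 2 * \<theta>) = u powr (2 * (1 - 1 / \<theta>))"
  proof -
    have "(- 1 / \<theta>) * (2 - 2 * \<theta>) = 2 * (1 - 1 / \<theta>)"
      using \<theta> by (simp add: field_simps)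
    then show ?thesis
      by (simp add: c_def powr_powr)
  qed
  finally show ?thesis
    by (simp add: distrib_left)
qed

lemma ennreal_power2_le_imp_le:
  fixes x y :: ennreal
  assumes "x\<^sup>2 \<le> y\<^sup>2"
  shows "x \<le> y"
  using assms by (cases x; cases y) (auto simp: ennreal_power power2_le_iff_abs_le top_unique power_eq_top_ennreal)

text \<open>Cauchy-Schwarz with the weight split into the powers (2-\<theta>)/2 and \<theta>/2: the
  first factor is integrated over \<open>E\<close>, and the second carries the trigonometric sum and
  is integrated over the whole space.\<close>

lemma ex_set_integral_cell_trig_bound:
  assumes s: "0 < s" "s < 1 / 2"
  shows "\<exists>C>0. \<forall>S E u. finite S \<longrightarrow> S \<subseteq> int_lattice \<longrightarrow> (E :: 'a::euclidean_space set) \<in> sets borel \<longrightarrow>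
    0 \<le> u \<longrightarrow> emeasure lborel E = ennreal u \<longrightarrow>
    (\<integral>\<^sup>+x. indicator E x * ennreal (cell_weight x * norm (trig_sum S x)) \<partial>lborel) \<le> ennreal (C * sqrt (card S) * u powr s)"
proof -
  \<comment> \<open>Solves 1 - 1/\<theta> = s; the range 0 < s < 1/2 is exactly 1 < \<theta> <
    2.\<close>
  define \<theta> where "\<theta> = 1 / (1 - s)"
  have \<theta>: "1 < \<theta>" "\<theta> < 2" and s_eq: "1 - 1 / \<theta> = s"
    using s by (auto simp: \<theta>_def field_simps)
  define I where "I = enn2real (\<integral>\<^sup>+x. ennreal (cell_weight (x::'a) powr \<theta>) \<partial>lborel)"
  have I: "(\<integral>\<^sup>+x. ennreal (cell_weight (x::'a) powr \<theta>) \<partial>lborel) = ennreal I" "0 \<le> I"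
    using nn_integral_cell_weight_finite[OF \<theta>(1), where 'a='a] by (auto simp: I_def)
  define K where "K = ((2 ^ DIM('a)) powr \<theta>)\<^sup>2 * I"
  have K: "0 \<le> K"
    using I by (simp add: K_def)
  \<comment> \<open>The added 1 secures \<open>0 < C\<close> without a lower bound on
    \<open>I\<close>.\<close>
  define C where "C = sqrt (K * (1 + I)) + 1"
  show ?thesis
  proof (intro exI[of _ C] conjI allI impI)
    show "0 < C"
      using K I by (auto simp: C_def intro!: add_nonneg_pos)
    fix S E :: "'a set" and u
    assume S: "finite S" "S \<subseteq> int_lattice" and [measurable]: "E \<in> sets borel"
      and u: "0 \<le> u" "emeasure lborel E = ennreal u"
    show "(\<integral>\<^sup>+x. indicator E x * ennreal (cell_weight x * norm (trig_sum S x)) \<partial>lborel) \<le>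
        ennreal (C * sqrt (card S) * u powr s)" (is "?L \<le> _")
    proof (cases "u = 0")
      case True
      then have "AE x in lborel. x \<notin> E"
        using u by (intro AE_not_in) (auto simp: null_sets_def)
      then have "?L = (\<integral>\<^sup>+x. 0 \<partial>(lborel :: 'a measure))"
        by (intro nn_integral_cong_AE) (auto elim!: eventually_mono)
      then show ?thesis
        by simp
    next
      case False
      then have "0 < u"
        using u by simp
      define f where "f x = indicator E x * ennreal (cell_weight x powr ((2 - \<theta>) / 2))" for x
      define g where "g x = ennreal (cell_weight x powr (\<theta> / 2) * norm (trig_sum S x))" for x
      have [measurable]: "f \<in> borel_measurable borel" "g \<in> borel_measurable borel"
        unfolding f_def[abs_def] g_def[abs_def] by measurable
      have sq: "ennreal (a powr (b / 2)) ^ 2 = ennreal (a powr b)" for a b :: real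
        by (simp add: power2_eq_square ennreal_mult[symmetric] powr_add[symmetric])
      have fg: "indicator E x * ennreal (cell_weight x * norm (trig_sum S x)) = f x * g x" for x
      proof -
        have "cell_weight x = cell_weight x powr ((2 - \<theta>) / 2) * cell_weight x powr (\<theta> / 2)"
          using cell_weight_pos[of x] by (simp add: powr_add[symmetric] field_simps)
        then have "ennreal (cell_weight x * norm (trig_sum S x)) =
            ennreal (cell_weight x powr ((2 - \<theta>) / 2)) * ennreal (cell_weight x powr (\<theta> / 2) * norm (trig_sum S x))"
          by (simp add: ennreal_mult[symmetric] mult.assoc[symmetric])
        then show ?thesis
          by (simp add: f_def g_def mult.assoc)
      qed
      have "?L\<^sup>2 \<le> (\<integral>\<^sup>+x. f x ^ 2 \<partial>lborel) * (\<integral>\<^sup>+x. g x ^ 2 \<partial>lborel)"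
        unfolding fg by (rule Cauchy_Schwarz_nn_integral) simp_all
      also have "(\<integral>\<^sup>+x. f x ^ 2 \<partial>lborel) = (\<integral>\<^sup>+x. indicator E x * ennreal (cell_weight x powr (2 - \<theta>)) \<partial>lborel)"
        by (intro nn_integral_cong) (simp add: f_def power_mult_distrib sq split: split_indicator)
      also have "\<dots> \<le> ennreal (u powr (2 * s) * (1 + I))"
        using set_integral_cell_weight_le[OF _ u(2) \<open>0 < u\<close> \<theta>] I
        by (simp add: s_eq ennreal_mult flip: ennreal_plus ennreal_1)
      also have "(\<integral>\<^sup>+x. g x ^ 2 \<partial>lborel) = (\<integral>\<^sup>+x. ennreal (cell_weight x powr \<theta>) * ennreal ((norm (trig_sum S x))\<^sup>2) \<partial>lborel)"
        by (intro nn_integral_cong) (simp add: g_def ennreal_mult power_mult_distrib sq ennreal_power)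
      also have "\<dots> \<le> ennreal (K * card S)"
        using nn_integral_cell_weight_trig_sum[OF S, of \<theta>] \<theta> I
        by (simp add: K_def ennreal_mult ennreal_of_nat_eq_real_of_nat)
      finally have "?L\<^sup>2 \<le> ennreal (u powr (2 * s) * (1 + I)) * ennreal (K * card S)"
        by (simp add: mult_mono)
      also have "\<dots> = ennreal ((sqrt (K * (1 + I)) * sqrt (card S) * u powr s)\<^sup>2)"
      proof -
        have "(u powr s)\<^sup>2 = u powr (2 * s)"
          by (simp add: power2_eq_square powr_add[symmetric])
        then show ?thesis
          using K I by (simp add: ennreal_mult[symmetric] power_mult_distrib mult_ac)
      qed
      also have "\<dots> \<le> (ennreal (C * sqrt (card S) * u powr s))\<^sup>2"
        using K I by (subst ennreal_power) (auto simp: C_def intro!: ennreal_leI power_mono mult_right_mono)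
      finally show ?thesis
        by (rule ennreal_power2_le_imp_le)
    qed
  qed
qed

section \<open>Fourier transforms of unions of cubes\<close>

text \<open>The sign of the phase is opposite to that in \<open>cmeasure_fourier\<close>, so that
  the two transforms are paired by a plain product, without conjugation or reflection.\<close>

definition set_fourier :: "'a::euclidean_space set \<Rightarrow> 'a \<Rightarrow> complex" where
  "set_fourier U \<xi> = (\<integral>y. indicator U y *\<^sub>R cis (2 * pi * (y \<bullet> \<xi>)) \<partial>lborel)"

text \<open>The cubes of side 1/r with corners n/r for n in \<open>S\<close>. For \<open>r\<close> a
  power of two these are the dyadic cubes of one generation.\<close>

definition cube_union :: "real \<Rightarrow> 'a::euclidean_space set \<Rightarrow> 'a set" where
  "cube_union r S = {x. lattice_floor (r *\<^sub>R x) \<in> S}"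

text \<open>Each cube is the unit cell shifted by its lattice point and scaled by 1/r. The shifts
  contribute the phases that add up to \<open>trig_sum\<close>, the scaling contributes the volume
  and the argument \<xi>/r.\<close>

lemma cube_union_fourier:
  fixes S :: "'a::euclidean_space set"
  assumes S: "finite S" "S \<subseteq> int_lattice" and r: "0 < r"
  shows "integrable lborel (\<lambda>y. indicator (cube_union r S) y *\<^sub>R cis (2 * pi * (y \<bullet> \<xi>)))" (is ?int)
    and "set_fourier (cube_union r S) \<xi> =
      inverse (r ^ DIM('a)) *\<^sub>R (trig_sum S (\<xi> /\<^sub>R r) * cell_fourier (\<xi> /\<^sub>R r))" (is ?val)
proof -
  define f :: "'a \<Rightarrow> complex"
    where "f z = indicator {y. lattice_floor y = 0} z *\<^sub>R cis (2 * pi * (z \<bullet> (\<xi> /\<^sub>R r)))" for z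
  define c where "c n = cis (2 * pi * (n \<bullet> (\<xi> /\<^sub>R r)))" for n
  have f: "integrable lborel f"
    unfolding f_def by (rule cell_integrable)
  have fn: "integrable lborel (\<lambda>y. f (- n + r *\<^sub>R y))" for n
    using r by (intro lborel_integrable_affine f) simp
  have val: "(\<integral>y. f (- n + r *\<^sub>R y) \<partial>lborel) = inverse (r ^ DIM('a)) *\<^sub>R cell_fourier (\<xi> /\<^sub>R r)" for n
    using lborel_integral_affine[OF f, of r "- n"] r by (simp add: cell_fourier_def f_def)
  have eq: "indicator (cube_union r S) y *\<^sub>R cis (2 * pi * (y \<bullet> \<xi>)) = (\<Sum>n\<in>S. c n * f (- n + r *\<^sub>R y))" for y
  proof -
    have cell: "lattice_floor (- n + r *\<^sub>R y) = 0 \<longleftrightarrow> lattice_floor (r *\<^sub>R y) = n" if "n \<in> S" for n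
    proof -
      have "lattice_floor (n + (- n + r *\<^sub>R y)) = n + lattice_floor (- n + r *\<^sub>R y)"
        using that S by (intro lattice_floor_add) auto
      then show ?thesis
        by auto
    qed
    have "c n * f (- n + r *\<^sub>R y) = (if n = lattice_floor (r *\<^sub>R y) then cis (2 * pi * (y \<bullet> \<xi>)) else 0)"
      if "n \<in> S" for n
    proof (cases "n = lattice_floor (r *\<^sub>R y)")
      case True
      have "2 * pi * (n \<bullet> (\<xi> /\<^sub>R r)) + 2 * pi * ((- n + r *\<^sub>R y) \<bullet> (\<xi> /\<^sub>R r)) = 2 * pi * (y \<bullet> \<xi>)"
        using r by (simp add: inner_add_left inner_diff_left field_simps)
      then have "c n * cis (2 * pi * ((- n + r *\<^sub>R y) \<bullet> (\<xi> /\<^sub>R r))) = cis (2 * pi * (y \<bullet> \<xi>))"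
        by (simp only: c_def cis_mult)
      moreover have "f (- n + r *\<^sub>R y) = cis (2 * pi * ((- n + r *\<^sub>R y) \<bullet> (\<xi> /\<^sub>R r)))"
        using cell[OF that] True by (simp add: f_def)
      ultimately show ?thesis
        using True by simp
    next
      case False
      then show ?thesis
        using cell[OF that] by (auto simp: f_def)
    qed
    then have "(\<Sum>n\<in>S. c n * f (- n + r *\<^sub>R y)) =
        (\<Sum>n\<in>S. if n = lattice_floor (r *\<^sub>R y) then cis (2 * pi * (y \<bullet> \<xi>)) else 0)"
      by (intro sum.cong) auto
    also have "\<dots> = indicator (cube_union r S) y *\<^sub>R cis (2 * pi * (y \<bullet> \<xi>))"
      using S by (auto simp: cube_union_def)
    finally show ?thesis ..
  qed
  show ?int
    unfolding eq by (intro Bochner_Integration.integrable_sum integrable_mult_right fn)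
  have "set_fourier (cube_union r S) \<xi> = (\<Sum>n\<in>S. c n * (inverse (r ^ DIM('a)) *\<^sub>R cell_fourier (\<xi> /\<^sub>R r)))"
    unfolding set_fourier_def eq
    by (simp only: Bochner_Integration.integral_sum[OF integrable_mult_right[OF fn]] integral_mult_right_zero val)
  then show ?val
    by (simp add: trig_sum_def c_def sum_distrib_right scaleR_sum_right)
qed

lemma set_fourier_cube_union_measurable:
  assumes "finite S" "S \<subseteq> int_lattice" "0 < r"
  shows "set_fourier (cube_union r S) \<in> borel_measurable borel"
proof -
  have [measurable]: "interval_fourier \<in> borel_measurable borel"
    unfolding interval_fourier_def[abs_def] by measurable
  show ?thesis
    unfolding cube_union_fourier(2)[OF assms, abs_def] cell_fourier_eq by measurable
qed

lemma norm_set_fourier_cube_union_le: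
  fixes S :: "'a::euclidean_space set"
  assumes "finite S" "S \<subseteq> int_lattice" "0 < r"
  shows "norm (set_fourier (cube_union r S) \<xi>) \<le>
    inverse (r ^ DIM('a)) * (cell_weight (\<xi> /\<^sub>R r) * norm (trig_sum S (\<xi> /\<^sub>R r)))"
proof -
  have "norm (set_fourier (cube_union r S) \<xi>) =
      inverse (r ^ DIM('a)) * (norm (cell_fourier (\<xi> /\<^sub>R r)) * norm (trig_sum S (\<xi> /\<^sub>R r)))"
    using assms(3) by (simp add: cube_union_fourier(2)[OF assms] norm_mult mult_ac)
  also have "\<dots> \<le> inverse (r ^ DIM('a)) * (cell_weight (\<xi> /\<^sub>R r) * norm (trig_sum S (\<xi> /\<^sub>R r)))"
    using assms(3) by (intro mult_left_mono mult_right_mono norm_cell_fourier_le) auto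
  finally show ?thesis .
qed

text \<open>Substituting \<xi> = r \<eta>, the Jacobian cancels the volume of a cube and
  \<open>E\<close> shrinks to a set of measure at most m / r^d. Only an upper bound \<open>m\<close>
  for the measure is needed, since the right side increases with it.\<close>

lemma ex_cube_union_fourier_bound:
  assumes s: "0 < s" "s < 1 / 2"
  shows "\<exists>C>0. \<forall>S E r m. finite S \<longrightarrow> S \<subseteq> int_lattice \<longrightarrow> (E :: 'a::euclidean_space set) \<in> sets borel \<longrightarrow>
    0 < r \<longrightarrow> 0 \<le> m \<longrightarrow> emeasure lborel E \<le> ennreal m \<longrightarrow>
    (\<integral>\<^sup>+\<xi>. indicator E \<xi> * ennreal (norm (set_fourier (cube_union r S) \<xi>)) \<partial>lborel) \<le>
      ennreal (C * sqrt (card S) * (m / r ^ DIM('a)) powr s)"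
proof -
  from ex_set_integral_cell_trig_bound[OF s, where 'a='a] obtain C where C: "0 < C"
    and bound: "\<And>S E u. finite S \<Longrightarrow> S \<subseteq> int_lattice \<Longrightarrow> (E :: 'a set) \<in> sets borel \<Longrightarrow>
      0 \<le> u \<Longrightarrow> emeasure lborel E = ennreal u \<Longrightarrow>
      (\<integral>\<^sup>+x. indicator E x * ennreal (cell_weight x * norm (trig_sum S x)) \<partial>lborel) \<le> ennreal (C * sqrt (card S) * u powr s)"
    by blast
  show ?thesis
  proof (intro exI[of _ C] conjI allI impI C)
    fix S E :: "'a set" and r m :: real
    assume S: "finite S" "S \<subseteq> int_lattice" and E[measurable]: "E \<in> sets borel" and r: "0 < r"
      and m: "0 \<le> m" "emeasure lborel E \<le> ennreal m"
    have rd: "0 < r ^ DIM('a)"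
      using r by simp
    define E' where "E' = (\<lambda>x. r *\<^sub>R x) -` E"
    have [measurable]: "E' \<in> sets borel"
      unfolding E'_def using measurable_sets[of "\<lambda>x. r *\<^sub>R x" borel borel E] by simp
    have E': "emeasure lborel E = ennreal (r ^ DIM('a)) * emeasure lborel E'"
    proof -
      have "emeasure lborel E = (\<integral>\<^sup>+x. indicator E x \<partial>lborel)"
        by simp
      also have "\<dots> = ennreal (r ^ DIM('a)) * (\<integral>\<^sup>+x. indicator E (r *\<^sub>R x) \<partial>lborel)"
        using r by (subst nn_integral_lborel_affine[where c=r and t=0]) auto
      also have "(\<integral>\<^sup>+x. indicator E (r *\<^sub>R x) \<partial>lborel) = (\<integral>\<^sup>+x. indicator E' x \<partial>lborel)"
        by (intro nn_integral_cong) (auto simp: E'_def split: split_indicator)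
      finally show ?thesis
        by simp
    qed
    have "ennreal (r ^ DIM('a)) * emeasure lborel E' < top"
      using m unfolding E'[symmetric] by (rule_tac le_less_trans) auto
    then have "emeasure lborel E' < top"
      using r by (auto simp: ennreal_mult_less_top)
    then obtain u where u: "0 \<le> u" "emeasure lborel E' = ennreal u"
      by (cases "emeasure lborel E'") auto
    have "r ^ DIM('a) * u \<le> m"
      using m E' u rd by (simp add: ennreal_mult[symmetric])
    then have um: "u \<le> m / r ^ DIM('a)"
      using rd by (simp add: field_simps)
    have [measurable]: "set_fourier (cube_union r S) \<in> borel_measurable borel"
      by (intro set_fourier_cube_union_measurable S r)
    have "(\<integral>\<^sup>+\<xi>. indicator E \<xi> * ennreal (norm (set_fourier (cube_union r S) \<xi>)) \<partial>lborel) =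
        ennreal (r ^ DIM('a)) * (\<integral>\<^sup>+\<eta>. indicator E (r *\<^sub>R \<eta>) * ennreal (norm (set_fourier (cube_union r S) (r *\<^sub>R \<eta>))) \<partial>lborel)"
      using r by (subst nn_integral_lborel_affine[where c=r and t=0]) auto
    also have "\<dots> = (\<integral>\<^sup>+\<eta>. ennreal (r ^ DIM('a)) * (indicator E (r *\<^sub>R \<eta>) * ennreal (norm (set_fourier (cube_union r S) (r *\<^sub>R \<eta>)))) \<partial>lborel)"
      by (intro nn_integral_cmult[symmetric]) measurable
    also have "\<dots> \<le> (\<integral>\<^sup>+\<eta>. indicator E' \<eta> * ennreal (cell_weight \<eta> * norm (trig_sum S \<eta>)) \<partial>lborel)"
    proof (intro nn_integral_mono)
      fix \<eta>
      have "r ^ DIM('a) * norm (set_fourier (cube_union r S) (r *\<^sub>R \<eta>)) \<le> cell_weight \<eta> * norm (trig_sum S \<eta>)"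
        using norm_set_fourier_cube_union_le[OF S r, of "r *\<^sub>R \<eta>"] r rd by (simp add: field_simps)
      then show "ennreal (r ^ DIM('a)) * (indicator E (r *\<^sub>R \<eta>) * ennreal (norm (set_fourier (cube_union r S) (r *\<^sub>R \<eta>)))) \<le>
          indicator E' \<eta> * ennreal (cell_weight \<eta> * norm (trig_sum S \<eta>))"
        using rd by (auto simp: E'_def ennreal_mult[symmetric] split: split_indicator intro!: ennreal_leI)
    qed
    also have "\<dots> \<le> ennreal (C * sqrt (card S) * u powr s)"
      by (intro bound S u) measurable
    also have "\<dots> \<le> ennreal (C * sqrt (card S) * (m / r ^ DIM('a)) powr s)"
      using C s u um by (intro ennreal_leI mult_left_mono powr_mono2) auto
    finally show "(\<integral>\<^sup>+\<xi>. indicator E \<xi> * ennreal (norm (set_fourier (cube_union r S) \<xi>)) \<partial>lborel) \<le>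
      ennreal (C * sqrt (card S) * (m / r ^ DIM('a)) powr s)" .
  qed
qed

text \<open>With e = i - kd the rescaled set has measure at most 2^(e+1). The exponents 1/p -
  \<delta> and 1/p + \<delta> both give 2^(e/p) up to a factor 2^(\<delta>|e|) or its inverse, and
  the sign of e decides which one gains. The part 2^(-kd/p) of 2^(e/p) is moved under the square
  root.\<close>

lemma ex_dyadic_fourier_bound:
  assumes p: "2 < p"
  shows "\<exists>C>0. \<exists>\<delta>>0. \<forall>(k::int) (i::int) S E. finite S \<longrightarrow> S \<subseteq> int_lattice \<longrightarrow> (E :: 'a::euclidean_space set) \<in> sets borel \<longrightarrow>
    emeasure lborel E \<le> ennreal (2 powr (real_of_int i + 1)) \<longrightarrow>
    (\<integral>\<^sup>+\<xi>. indicator E \<xi> * ennreal (norm (set_fourier (cube_union (2 powr real_of_int k) S) \<xi>)) \<partial>lborel) \<le>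
      ennreal (C * sqrt (card S * 2 powr (- real_of_int k * (2 * real DIM('a) / p))) * 2 powr (real_of_int i / p) *
        2 powr (- \<delta> * \<bar>real_of_int (i - k * int DIM('a))\<bar>))"
proof -
  \<comment> \<open>Half the distance of 1/p from the ends of (0, 1/2), so that both shifted
    exponents stay inside.\<close>
  define \<delta> where "\<delta> = min (1 / p) (1 / 2 - 1 / p) / 2"
  have "0 < min v (1 / 2 - v) / 2 \<and> min v (1 / 2 - v) / 2 < v \<and> min v (1 / 2 - v) / 2 < 1 / 2 - v"
    if "0 < v" "v < 1 / 2" for v :: real
    using that by (auto simp: min_def)
  from this[of "1 / p"] have "0 < \<delta> \<and> \<delta> < 1 / p \<and> \<delta> < 1 / 2 - 1 / p"
    using p by (simp add: \<delta>_def)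
  then have \<delta>: "0 < \<delta>" and s1: "0 < 1 / p - \<delta>" "1 / p - \<delta> < 1 / 2" and s2: "0 < 1 / p + \<delta>" "1 / p + \<delta> < 1 / 2"
    by auto
  from ex_cube_union_fourier_bound[OF s1, where 'a='a] obtain C1 where C1: "0 < C1"
    and b1: "\<And>S E r m. finite S \<Longrightarrow> S \<subseteq> int_lattice \<Longrightarrow> (E :: 'a::euclidean_space set) \<in> sets borel \<Longrightarrow>
      0 < r \<Longrightarrow> 0 \<le> m \<Longrightarrow> emeasure lborel E \<le> ennreal m \<Longrightarrow>
    (\<integral>\<^sup>+\<xi>. indicator E \<xi> * ennreal (norm (set_fourier (cube_union r S) \<xi>)) \<partial>lborel) \<le>
      ennreal (C1 * sqrt (card S) * (m / r ^ DIM('a)) powr (1 / p - \<delta>))"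
    by blast
  from ex_cube_union_fourier_bound[OF s2, where 'a='a] obtain C2 where C2: "0 < C2"
    and b2: "\<And>S E r m. finite S \<Longrightarrow> S \<subseteq> int_lattice \<Longrightarrow> (E :: 'a::euclidean_space set) \<in> sets borel \<Longrightarrow>
      0 < r \<Longrightarrow> 0 \<le> m \<Longrightarrow> emeasure lborel E \<le> ennreal m \<Longrightarrow>
    (\<integral>\<^sup>+\<xi>. indicator E \<xi> * ennreal (norm (set_fourier (cube_union r S) \<xi>)) \<partial>lborel) \<le>
      ennreal (C2 * sqrt (card S) * (m / r ^ DIM('a)) powr (1 / p + \<delta>))"
    by blast
  \<comment> \<open>The factor 2 absorbs \<open>2 powr s\<close> for s < 1/2, which is left over
    from the \<open>+ 1\<close> in the measure bound.\<close>
  define C where "C = 2 * max C1 C2"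
  have C: "0 < C"
    using C1 by (simp add: C_def)
  show ?thesis
  proof (rule exI[of _ C], rule conjI[OF C], rule exI[of _ \<delta>], rule conjI[OF \<delta>], intro allI impI)
    fix k i :: int and S E :: "'a set"
    assume S: "finite S" "S \<subseteq> int_lattice" "E \<in> sets borel"
      and E: "emeasure lborel E \<le> ennreal (2 powr (real_of_int i + 1))"
    define e where "e = real_of_int (i - k * int DIM('a))"
    have quot: "2 powr (real_of_int i + 1) / (2 powr real_of_int k) ^ DIM('a) = 2 powr (e + 1)"
      by (simp add: e_def powr_power powr_diff[symmetric] algebra_simps)
    have sq: "sqrt (card S * 2 powr (- real_of_int k * (2 * real DIM('a) / p))) =
        sqrt (card S) * 2 powr (- real_of_int k * (real DIM('a) / p))"
    proof -
      have "2 powr (- real_of_int k * (2 * real DIM('a) / p)) = (2 powr (- real_of_int k * (real DIM('a) / p)))\<^sup>2"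
        by (simp add: power2_eq_square powr_add[symmetric] mult_ac)
      then show ?thesis
        by (simp add: real_sqrt_mult)
    qed
    \<comment> \<open>The last premise covers both regimes at once: it holds for s = 1/p - \<delta>
      if \<open>e\<close> is nonnegative and for s = 1/p + \<delta> if \<open>e\<close> is
      negative.\<close>
    have key: "D * sqrt (card S) * (2 powr (e + 1)) powr s \<le> C * sqrt (card S * 2 powr (- real_of_int k * (2 * real DIM('a) / p))) * 2 powr (real_of_int i / p) *
        2 powr (- \<delta> * \<bar>e\<bar>)" if "0 < D" "D \<le> max C1 C2" "s < 1 / 2" "(s - 1 / p) * e = - \<delta> * \<bar>e\<bar>" for s D
    proof -
      have "D * 2 powr s \<le> max C1 C2 * 2 powr 1"
        using that by (intro mult_mono powr_mono) auto
      then have D: "D * 2 powr s \<le> C"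
        by (simp add: C_def)
      have ex: "(e + 1) * s = s + (- real_of_int k * (real DIM('a) / p)) + real_of_int i / p + (- \<delta> * \<bar>e\<bar>)"
      proof -
        have "(e + 1) * s = s + e / p + (s - 1 / p) * e"
          using p by (simp add: field_simps)
        also have "e / p = (- real_of_int k * (real DIM('a) / p)) + real_of_int i / p"
          by (simp add: e_def diff_divide_distrib)
        finally show ?thesis
          using that by simp
      qed
      have "D * sqrt (card S) * (2 powr (e + 1)) powr s =
          (D * 2 powr s) * (sqrt (card S) * 2 powr (- real_of_int k * (real DIM('a) / p)) * 2 powr (real_of_int i / p) * 2 powr (- \<delta> * \<bar>e\<bar>))"
        unfolding powr_powr ex by (simp only: powr_add mult_ac)
      also have "\<dots> \<le> C * (sqrt (card S) * 2 powr (- real_of_int k * (real DIM('a) / p)) * 2 powr (real_of_int i / p) * 2 powr (- \<delta> * \<bar>e\<bar>))"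
        by (intro mult_right_mono D) auto
      finally show ?thesis
        unfolding sq by (simp only: mult_ac)
    qed
    have "(\<integral>\<^sup>+\<xi>. indicator E \<xi> * ennreal (norm (set_fourier (cube_union (2 powr real_of_int k) S) \<xi>)) \<partial>lborel) \<le>
      ennreal (C * sqrt (card S * 2 powr (- real_of_int k * (2 * real DIM('a) / p))) * 2 powr (real_of_int i / p) *
        2 powr (- \<delta> * \<bar>e\<bar>))" (is "?L \<le> _")
    proof (cases "0 \<le> e")
      case True
      have "?L \<le> ennreal (C1 * sqrt (card S) * (2 powr (e + 1)) powr (1 / p - \<delta>))"
        using b1[OF S _ _ E, of "2 powr real_of_int k"] by (simp only: quot) simp
      also have "\<dots> \<le> ennreal (C * sqrt (card S * 2 powr (- real_of_int k * (2 * real DIM('a) / p))) * 2 powr (real_of_int i / p) *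
        2 powr (- \<delta> * \<bar>e\<bar>))"
        using True C1 s1 by (intro ennreal_leI key) auto
      finally show ?thesis .
    next
      case False
      have "?L \<le> ennreal (C2 * sqrt (card S) * (2 powr (e + 1)) powr (1 / p + \<delta>))"
        using b2[OF S _ _ E, of "2 powr real_of_int k"] by (simp only: quot) simp
      also have "\<dots> \<le> ennreal (C * sqrt (card S * 2 powr (- real_of_int k * (2 * real DIM('a) / p))) * 2 powr (real_of_int i / p) *
        2 powr (- \<delta> * \<bar>e\<bar>))"
        using False C2 s2 by (intro ennreal_leI key) auto
      finally show ?thesis .
    qed
    then show "(\<integral>\<^sup>+\<xi>. indicator E \<xi> * ennreal (norm (set_fourier (cube_union (2 powr real_of_int k) S) \<xi>)) \<partial>lborel) \<le>
      ennreal (C * sqrt (card S * 2 powr (- real_of_int k * (2 * real DIM('a) / p))) * 2 powr (real_of_int i / p) *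
        2 powr (- \<delta> * \<bar>real_of_int (i - k * int DIM('a))\<bar>))"
      by (simp only: e_def)
  qed
qed

section \<open>Dyadic level sets of Lorentz functions\<close>

text \<open>The largest exponent dominates: counted downwards from the maximum of \<open>I\<close>,
  the terms form part of a geometric series, and the top term is at most M^c.\<close>

lemma sum_powr_int_le:
  fixes I :: "int set"
  assumes I: "finite I" and c: "0 < c" and le: "\<And>i. i \<in> I \<Longrightarrow> 2 powr real_of_int i \<le> M"
  shows "(\<Sum>i\<in>I. 2 powr (real_of_int i * c)) \<le> M powr c / (1 - 2 powr (- c))"
proof (cases "I = {}")
  case True
  then show ?thesis
    using c powr_less_one[of 2 "- c"] by auto
next
  case False
  define x where "x = 2 powr (- c)"
  have x: "0 < x" "x < 1"
    using c by (auto simp: x_def powr_less_one)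
  define i0 where "i0 = Max I"
  have i0: "i0 \<in> I" "\<And>i. i \<in> I \<Longrightarrow> i \<le> i0"
    using I False by (auto simp: i0_def)
  define J where "J = (\<lambda>i. nat (i0 - i)) ` I"
  have inj: "inj_on (\<lambda>i. nat (i0 - i)) I"
  proof (rule inj_onI)
    fix x y assume "x \<in> I" "y \<in> I" "nat (i0 - x) = nat (i0 - y)"
    with i0(2)[of x] i0(2)[of y] show "x = y"
      by simp
  qed
  have "(\<Sum>i\<in>I. 2 powr (real_of_int i * c)) = (\<Sum>i\<in>I. 2 powr (real_of_int i0 * c) * x ^ nat (i0 - i))"
  proof (rule sum.cong)
    fix i assume "i \<in> I"
    then have "x ^ nat (i0 - i) = 2 powr (- c * (real_of_int i0 - real_of_int i))"
      using i0(2)[of i] by (simp add: x_def powr_power mult.commute)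
    then show "2 powr (real_of_int i * c) = 2 powr (real_of_int i0 * c) * x ^ nat (i0 - i)"
      by (simp add: powr_add[symmetric] algebra_simps)
  qed simp
  also have "\<dots> = 2 powr (real_of_int i0 * c) * (\<Sum>j\<in>J. x ^ j)"
    by (simp add: J_def sum.reindex[OF inj] sum_distrib_left)
  also have "\<dots> \<le> 2 powr (real_of_int i0 * c) * (\<Sum>j. x ^ j)"
    using x I by (intro mult_left_mono sum_le_suminf) (auto simp: J_def)
  also have "(\<Sum>j. x ^ j) = 1 / (1 - x)"
    using x by (intro suminf_geometric) auto
  also have "2 powr (real_of_int i0 * c) * (1 / (1 - x)) \<le> M powr c * (1 / (1 - x))"
    using x c le[OF i0(1)] by (intro mult_right_mono) (auto simp: powr_powr[symmetric] intro!: powr_mono2)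
  finally show ?thesis
    by (simp add: x_def)
qed

lemma nn_integral_count_space_int_le:
  fixes f :: "int \<Rightarrow> ennreal"
  assumes "\<And>I. finite I \<Longrightarrow> sum f I \<le> B"
  shows "(\<integral>\<^sup>+i. f i \<partial>count_space UNIV) \<le> B"
proof -
  have bij: "bij_betw int_decode UNIV (UNIV :: int set)"
    by (simp add: bij_int_decode)
  have "(\<integral>\<^sup>+i. f i \<partial>count_space UNIV) = (\<Sum>n. f (int_decode n))"
    by (simp add: nn_integral_bij_count_space[OF bij, symmetric] nn_integral_count_space_nat)
  also have "\<dots> \<le> B"
  proof (rule suminf_le_const[OF summableI])
    fix n
    have "(\<Sum>i<n. f (int_decode i)) = sum f (int_decode ` {..<n})"
      by (subst sum.reindex) (auto simp: inj_int_decode inj_on_def int_decode_eq)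
    then show "(\<Sum>i<n. f (int_decode i)) \<le> B"
      using assms by simp
  qed
  finally show ?thesis .
qed

lemma nn_integral_two_sided_geometric_finite:
  assumes "0 < \<delta>"
  shows "(\<integral>\<^sup>+n. ennreal (2 powr (- \<delta> * \<bar>real_of_int n\<bar>)) \<partial>count_space UNIV) < \<infinity>"
proof -
  define B where "B = 1 / (1 - 2 powr (- \<delta>))"
  have B: "(\<Sum>i\<in>I. 2 powr (real_of_int i * \<delta>)) \<le> B" if "finite I" "\<And>i. i \<in> I \<Longrightarrow> i \<le> 0" for I
    using sum_powr_int_le[OF that(1) assms, of 1] that(2)
    using powr_mono[of _ 0 "2::real"] by (auto simp: B_def)
  have "(\<Sum>n\<in>I. 2 powr (- \<delta> * \<bar>real_of_int n\<bar>)) \<le> B + B" if I: "finite I" for I :: "int set"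
  proof -
    have "(\<Sum>n\<in>I. 2 powr (- \<delta> * \<bar>real_of_int n\<bar>)) =
        (\<Sum>n\<in>{n\<in>I. n \<le> 0}. 2 powr (- \<delta> * \<bar>real_of_int n\<bar>)) + (\<Sum>n\<in>{n\<in>I. 0 < n}. 2 powr (- \<delta> * \<bar>real_of_int n\<bar>))"
      using I by (subst sum.union_disjoint[symmetric]) (auto intro!: sum.cong)
    also have "(\<Sum>n\<in>{n\<in>I. n \<le> 0}. 2 powr (- \<delta> * \<bar>real_of_int n\<bar>)) = (\<Sum>n\<in>{n\<in>I. n \<le> 0}. 2 powr (real_of_int n * \<delta>))"
      by (intro sum.cong) (auto simp: mult.commute)
    also have "\<dots> \<le> B"
      using I by (intro B) auto
    also have "(\<Sum>n\<in>{n\<in>I. 0 < n}. 2 powr (- \<delta> * \<bar>real_of_int n\<bar>)) = (\<Sum>n\<in>uminus ` {n\<in>I. 0 < n}. 2 powr (real_of_int n * \<delta>))"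
      by (subst sum.reindex) (auto intro!: sum.cong simp: mult.commute)
    also have "\<dots> \<le> B"
      using I by (intro B) auto
    finally show ?thesis
      by simp
  qed
  then have "(\<integral>\<^sup>+n. ennreal (2 powr (- \<delta> * \<bar>real_of_int n\<bar>)) \<partial>count_space UNIV) \<le> ennreal (B + B)"
    by (intro nn_integral_count_space_int_le) (simp add: ennreal_leI)
  then show ?thesis
    by (rule le_less_trans) simp
qed

section \<open>Discrete form of the Lorentz norm\<close>

text \<open>For a distribution function \<open>m\<close>, the set of heights t with 2^i at most
  \<open>m t\<close> is an interval starting at 0 whose length is, in essence, the decreasing
  rearrangement at 2^i. The lemma therefore says that the Lorentz norm controls the l_q norm of
  2^(i/p) times the rearrangement at 2^i.\<close>

lemma lorentz_level_sequence:
  fixes m :: "real \<Rightarrow> ennreal"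
  assumes p: "0 < p" and q: "1 \<le> q"
    and anti: "\<And>s t. 0 < s \<Longrightarrow> s \<le> t \<Longrightarrow> m t \<le> m s"
    and [measurable]: "m \<in> borel_measurable borel"
    and fin: "(\<integral>\<^sup>+t. indicator {0<..} t * epowr (m t * ennreal (t powr p)) (q / p) / ennreal t \<partial>lborel) < \<infinity>"
  obtains b :: "int \<Rightarrow> real" where "\<And>i. 0 \<le> b i" "(\<lambda>i. b i powr q) summable_on UNIV"
    "\<And>i. ennreal (2 powr (real_of_int i / p)) *
        emeasure lborel {t. 0 < t \<and> ennreal (2 powr real_of_int i) \<le> m t} \<le> ennreal (b i)"
proof -
  define D where "D i = {t. 0 < t \<and> ennreal (2 powr real_of_int i) \<le> m t}" for i :: int
  have [measurable]: "D i \<in> sets borel" for i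
    unfolding D_def by measurable
  define L where "L = (\<integral>\<^sup>+t. indicator {0<..} t * epowr (m t * ennreal (t powr p)) (q / p) / ennreal t \<partial>lborel)"
  define V where "V i = (\<integral>\<^sup>+t. indicator (D i) t * ennreal (t powr (q - 1)) \<partial>lborel)" for i
  define G where "G = 1 / (1 - 2 powr (- (q / p)))"
  have "2 powr (- (q / p)) < 1"
    using p q by (intro powr_less_one) auto
  then have G: "0 < G"
    by (simp add: G_def)
  \<comment> \<open>At height t the levels that count are those with 2^i at most \<open>m t\<close>,
    and their powers sum to at most G (m t)^(q/p). Multiplied by t^(q-1) this is the integrand of
    the Lorentz norm.\<close>
  have pt: "(\<Sum>i\<in>I. ennreal (2 powr (real_of_int i * (q / p))) * (indicator (D i) t * ennreal (t powr (q - 1)))) \<le>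
      ennreal G * (indicator {0<..} t * epowr (m t * ennreal (t powr p)) (q / p) / ennreal t)"
    if I: "finite I" for I t
  proof (cases "0 < t")
    case False
    then show ?thesis
      by (simp add: D_def)
  next
    case t: True
    show ?thesis
    proof (cases "m t")
      case (real M)
      define I' where "I' = {i\<in>I. 2 powr real_of_int i \<le> M}"
      have D: "t \<in> D i \<longleftrightarrow> 2 powr real_of_int i \<le> M" for i
        using t real by (simp add: D_def)
      have "(\<Sum>i\<in>I. ennreal (2 powr (real_of_int i * (q / p))) * (indicator (D i) t * ennreal (t powr (q - 1)))) =
          (\<Sum>i\<in>I'. ennreal (2 powr (real_of_int i * (q / p)) * t powr (q - 1)))"
        using I by (intro sum.mono_neutral_cong_right) (auto simp: I'_def D ennreal_mult split: split_indicator)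
      also have "\<dots> = ennreal ((\<Sum>i\<in>I'. 2 powr (real_of_int i * (q / p))) * t powr (q - 1))"
        by (simp add: sum_ennreal sum_distrib_right)
      also have "\<dots> \<le> ennreal (M powr (q / p) * G * t powr (q - 1))"
      proof (intro ennreal_leI mult_right_mono)
        have "(\<Sum>i\<in>I'. 2 powr (real_of_int i * (q / p))) \<le> M powr (q / p) / (1 - 2 powr (- (q / p)))"
          using I p q by (intro sum_powr_int_le) (auto simp: I'_def)
        then show "(\<Sum>i\<in>I'. 2 powr (real_of_int i * (q / p))) \<le> M powr (q / p) * G"
          by (simp only: G_def times_divide_eq_right mult_1_right)
      qed simp
      also have "M powr (q / p) * G * t powr (q - 1) = G * ((M * t powr p) powr (q / p) / t)"
        using t real p by (simp add: powr_mult powr_powr powr_diff)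
      also have "ennreal \<dots> = ennreal G * (indicator {0<..} t * epowr (m t * ennreal (t powr p)) (q / p) / ennreal t)"
      proof -
        have "epowr (m t * ennreal (t powr p)) (q / p) = ennreal ((M * t powr p) powr (q / p))"
          using real by (simp add: epowr_def ennreal_mult[symmetric] ennreal_mult_eq_top_iff)
        then show ?thesis
          using t G by (simp add: divide_ennreal ennreal_mult[symmetric])
      qed
      finally show ?thesis .
    next
      case top
      then have "indicator {0<..} t * epowr (m t * ennreal (t powr p)) (q / p) / ennreal t = top"
        using t by (simp add: epowr_def ennreal_top_mult ennreal_top_divide)
      then show ?thesis
        using G by (simp add: ennreal_mult_top)
    qed
  qed
  have bound: "(\<Sum>i\<in>I. ennreal (2 powr (real_of_int i * (q / p))) * V i) \<le> ennreal G * L" if I: "finite I" for I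
  proof -
    have "(\<Sum>i\<in>I. ennreal (2 powr (real_of_int i * (q / p))) * V i) =
        (\<integral>\<^sup>+t. (\<Sum>i\<in>I. ennreal (2 powr (real_of_int i * (q / p))) * (indicator (D i) t * ennreal (t powr (q - 1)))) \<partial>lborel)"
      by (simp add: V_def nn_integral_sum nn_integral_cmult)
    also have "\<dots> \<le> (\<integral>\<^sup>+t. ennreal G * (indicator {0<..} t * epowr (m t * ennreal (t powr p)) (q / p) / ennreal t) \<partial>lborel)"
      by (intro nn_integral_mono pt I)
    also have "\<dots> = ennreal G * L"
      unfolding L_def by (intro nn_integral_cmult) (simp add: epowr_def)
    finally show ?thesis .
  qed
  have GL: "ennreal G * L < top"
    using fin by (simp add: L_def ennreal_mult_less_top)
  have V_fin: "V i < top" for i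
  proof -
    have "ennreal (2 powr (real_of_int i * (q / p))) * V i < top"
      using bound[of "{i}"] GL by (simp add: le_less_trans)
    then show ?thesis
      by (auto simp: ennreal_mult_less_top)
  qed
  define v where "v i = enn2real (V i)" for i
  have v: "V i = ennreal (v i)" "0 \<le> v i" for i
    using V_fin[of i] by (auto simp: v_def)
  \<comment> \<open>The factor 2 undoes the halving of intervals in the bound on \<open>D i\<close>
    below.\<close>
  define b where "b i = 2 * 2 powr (real_of_int i / p) * v i powr (1 / q)" for i
  show thesis
  proof
    show "0 \<le> b i" for i
      by (simp add: b_def)
    have bq: "b i powr q = 2 powr q * (2 powr (real_of_int i * (q / p)) * v i)" for i
      using q v(2)[of i] by (simp add: b_def powr_mult powr_powr)
    have "(\<Sum>i\<in>I. b i powr q) \<le> 2 powr q * enn2real (ennreal G * L)" if "finite I" for I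
    proof -
      have "ennreal (\<Sum>i\<in>I. 2 powr (real_of_int i * (q / p)) * v i) \<le> ennreal G * L"
        using bound[OF that] v by (simp add: sum_ennreal[symmetric] ennreal_mult)
      also have "\<dots> = ennreal (enn2real (ennreal G * L))"
        using GL by simp
      finally have "(\<Sum>i\<in>I. 2 powr (real_of_int i * (q / p)) * v i) \<le> enn2real (ennreal G * L)"
        by (simp add: ennreal_le_iff)
      then show ?thesis
        by (simp add: bq sum_distrib_left[symmetric])
    qed
    then show "(\<lambda>i. b i powr q) summable_on UNIV"
      by (intro nonneg_bdd_above_summable_on) (auto intro!: bdd_aboveI2)
    fix i
    have "D i \<subseteq> {0..2 * v i powr (1 / q)}"
    proof
      fix x assume x: "x \<in> D i"
      then have x0: "0 < x"
        by (simp add: D_def)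
      \<comment> \<open>Since \<open>m\<close> is nonincreasing, \<open>D i\<close> contains the
        interval from x/2 to x along with x. There t^(q-1) is at least (x/2)^(q-1), which bounds
        \<open>V i\<close> from below without evaluating the integral of a power.\<close>
      have "ennreal ((x / 2) powr q) = (\<integral>\<^sup>+t. ennreal ((x / 2) powr (q - 1)) * indicator {x / 2..x} t \<partial>lborel)"
        using x0 by (simp add: nn_integral_cmult_indicator ennreal_mult[symmetric] powr_diff)
      also have "\<dots> \<le> V i"
        unfolding V_def
      proof (intro nn_integral_mono)
        fix t
        show "ennreal ((x / 2) powr (q - 1)) * indicator {x / 2..x} t \<le> indicator (D i) t * ennreal (t powr (q - 1))"
        proof (cases "t \<in> {x / 2..x}")
          case True
          then have "t \<in> D i"
            using x x0 anti[of t x] by (auto simp: D_def)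
          moreover have "(x / 2) powr (q - 1) \<le> t powr (q - 1)"
            using True x0 q by (intro powr_mono2) auto
          ultimately show ?thesis
            using True by (simp add: ennreal_leI)
        qed simp
      qed
      finally have "(x / 2) powr q \<le> v i"
        using v[of i] by simp
      then have "((x / 2) powr q) powr (1 / q) \<le> v i powr (1 / q)"
        using q by (intro powr_mono2) auto
      then show "x \<in> {0..2 * v i powr (1 / q)}"
        using q x0 by (simp add: powr_powr)
    qed
    then have "emeasure lborel (D i) \<le> emeasure lborel {0..2 * v i powr (1 / q)}"
      by (intro emeasure_mono) auto
    then have "emeasure lborel (D i) \<le> ennreal (2 * v i powr (1 / q))"
      by simp
    then have "ennreal (2 powr (real_of_int i / p)) * emeasure lborel (D i) \<le>
        ennreal (2 powr (real_of_int i / p)) * ennreal (2 * v i powr (1 / q))"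
      by (intro mult_left_mono) auto
    also have "\<dots> = ennreal (b i)"
      by (simp add: b_def ennreal_mult[symmetric] mult_ac)
    finally show "ennreal (2 powr (real_of_int i / p)) *
        emeasure lborel {t. 0 < t \<and> ennreal (2 powr real_of_int i) \<le> m t} \<le> ennreal (b i)"
      by (simp add: D_def)
  qed
qed

text \<open>Write \<open>g x\<close> as the length of \<open>{0<..g x}\<close> and exchange the
  integrals. Each height then contributes the integral of \<open>F\<close> over a level set, for
  which the cube estimates are made.\<close>

lemma nn_integral_layer_cake_mult:
  fixes F :: "'a::euclidean_space \<Rightarrow> ennreal" and g :: "'a \<Rightarrow> real"
  assumes [measurable]: "F \<in> borel_measurable borel" "g \<in> borel_measurable borel"
    and g: "\<And>x. 0 \<le> g x"
  shows "(\<integral>\<^sup>+x. F x * ennreal (g x) \<partial>lborel) =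
    (\<integral>\<^sup>+t. indicator {0<..} t * (\<integral>\<^sup>+x. indicator {x. t \<le> g x} x * F x \<partial>lborel) \<partial>lborel)"
proof -
  have "F x * ennreal (g x) = (\<integral>\<^sup>+t. F x * indicator {0<..g x} t \<partial>lborel)" for x
    using g by (simp add: nn_integral_cmult_indicator)
  moreover have "F x * indicator {0<..g x} t = indicator {0<..} t * (indicator {x. t \<le> g x} x * F x)" for x t
    by (auto split: split_indicator)
  ultimately have "(\<integral>\<^sup>+x. F x * ennreal (g x) \<partial>lborel) =
      (\<integral>\<^sup>+x. (\<integral>\<^sup>+t. indicator {0<..} t * (indicator {x. t \<le> g x} x * F x) \<partial>lborel) \<partial>lborel)"
    by simp
  also have "\<dots> = (\<integral>\<^sup>+t. (\<integral>\<^sup>+x. indicator {0<..} t * (indicator {x. t \<le> g x} x * F x) \<partial>lborel) \<partial>lborel)"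
    by (rule lborel_pair.Fubini'[symmetric]) measurable
  also have "\<dots> = (\<integral>\<^sup>+t. indicator {0<..} t * (\<integral>\<^sup>+x. indicator {x. t \<le> g x} x * F x \<partial>lborel) \<partial>lborel)"
    by (intro nn_integral_cong nn_integral_cmult) measurable
  finally show ?thesis .
qed

section \<open>Pairing with a Lorentz function\<close>

lemma infsum_tail_tendsto_0:
  fixes f :: "int \<Rightarrow> real"
  assumes f: "f summable_on UNIV" and nn: "\<And>i. 0 \<le> f i"
  shows "((\<lambda>J. infsum f {J..}) \<longlongrightarrow> 0) at_top"
proof (rule tendstoI)
  fix e :: real assume e: "0 < e"
  have "(f has_sum infsum f UNIV) UNIV"
    using f by (rule has_sum_infsum)
  then have "\<forall>\<^sub>F I in finite_subsets_at_top UNIV. dist (sum f I) (infsum f UNIV) < e"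
    using e unfolding has_sum_def by (rule tendstoD)
  then obtain I where I: "finite I" "dist (sum f I) (infsum f UNIV) < e"
    unfolding eventually_finite_subsets_at_top by blast
  obtain J0 where J0: "\<And>i. i \<in> I \<Longrightarrow> i < J0"
    using I(1) by (metis Max_ge gt_ex le_less_trans)
  have "dist (infsum f {J..}) 0 < e" if "J0 \<le> J" for J
  proof -
    have summ: "f summable_on {J..}"
      using f by (rule summable_on_subset_banach) simp
    have "sum f I + infsum f {J..} = infsum f (I \<union> {J..})"
      using I(1) J0 that summ by (subst infsum_Un_disjoint) (auto intro: summable_on_finite dest!: J0)
    also have "\<dots> \<le> infsum f UNIV"
      using f by (intro infsum_mono_neutral summable_on_subset_banach[OF f]) (auto simp: nn)
    finally have "infsum f {J..} < e"
      using I(2) by (auto simp: dist_real_def)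
    then show ?thesis
      using infsum_nonneg[of "{J..}" f] nn by (simp add: dist_real_def)
  qed
  then show "\<forall>\<^sub>F J in at_top. dist (infsum f {J..}) 0 < e"
    by (auto simp: eventually_at_top_linorder)
qed

lemma distrib_fun_measurable:
  fixes f :: "'a::euclidean_space \<Rightarrow> complex"
  assumes [measurable]: "f \<in> borel_measurable borel"
  shows "distrib_fun f \<in> borel_measurable borel"
proof -
  have "distrib_fun f t = (\<integral>\<^sup>+x. indicator {x. t \<le> cmod (f x)} x \<partial>lborel)" for t
    by (simp add: distrib_fun_def)
  then show ?thesis
    by (simp add: fun_eq_iff[symmetric] cong: measurable_cong) 
qed

text \<open>The sequence \<epsilon> is chosen before the cubes, so it depends on \<open>f\<close>
  and the exponents alone. The condition on \<open>H\<close> states duality abstractly: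
  \<open>H\<close> bounds the square roots as a functional on l_q. This treats q = 1 and q > 1
  together.\<close>

lemma lorentz_pairing_bound:
  fixes f :: "'a::euclidean_space \<Rightarrow> complex"
  assumes p: "2 < p" and q: "1 \<le> q" and f: "in_lorentz p q f"
  shows "\<exists>\<epsilon> :: nat \<Rightarrow> ennreal. \<epsilon> \<longlonglongrightarrow> 0 \<and> (\<forall>K Ks S H. finite Ks \<longrightarrow> (\<forall>k\<in>Ks. int K \<le> k) \<longrightarrow>
      (\<forall>k\<in>Ks. finite (S k) \<and> S k \<subseteq> int_lattice) \<longrightarrow> 0 \<le> H \<longrightarrow>
      (\<forall>c. (\<forall>k. 0 \<le> c k) \<longrightarrow>
        (\<Sum>k\<in>Ks. sqrt (card (S k) * 2 powr (- real_of_int k * (2 * real DIM('a) / p))) * c k) \<le>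
          H * (\<Sum>k\<in>Ks. c k powr q) powr (1 / q)) \<longrightarrow>
      (\<Sum>k\<in>Ks. \<integral>\<^sup>+\<xi>. ennreal (norm (set_fourier (cube_union (2 powr real_of_int k) (S k)) \<xi>)) *
        ennreal (norm (f \<xi>)) \<partial>lborel) \<le> ennreal H * \<epsilon> K)"
proof -
  define d where "d = int DIM('a)"
  have d: "0 < d"
    by (simp add: d_def)
  have f_meas[measurable]: "f \<in> borel_measurable borel"
    using f by (simp add: in_lorentz_def)
  define m where "m = distrib_fun f"
  have m_meas[measurable]: "m \<in> borel_measurable borel"
    unfolding m_def by (rule distrib_fun_measurable) measurable
  have m_anti: "m t \<le> m s" if "s \<le> t" for s t
    unfolding m_def distrib_fun_def using that by (intro emeasure_mono) auto
  define Lf where "Lf t = indicator {0<..} t * epowr (m t * ennreal (t powr p)) (q / p) / ennreal t" for t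
  have "ennreal q * (\<integral>\<^sup>+t. Lf t \<partial>lborel) < \<infinity>"
    using f by (simp add: in_lorentz_def lorentz_norm_q_def m_def Lf_def)
  then have fin: "(\<integral>\<^sup>+t. Lf t \<partial>lborel) < \<infinity>"
    using q by (auto simp: ennreal_mult_less_top)
  have [measurable]: "Lf \<in> borel_measurable borel"
    unfolding Lf_def epowr_def by measurable
  \<comment> \<open>Where \<open>m t\<close> is infinite so is the Lorentz integrand. Finiteness for
    almost every height is enough, because heights are only integrated over.\<close>
  have m_fin: "AE t in lborel. 0 < t \<longrightarrow> m t \<noteq> \<infinity>"
  proof -
    have "AE t in lborel. Lf t \<noteq> \<infinity>"
      using fin by (intro nn_integral_PInf_AE) auto
    then show ?thesis
      by eventually_elim (auto simp: Lf_def epowr_def ennreal_top_mult ennreal_top_divide)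
  qed
  obtain b where b: "\<And>i. 0 \<le> b i" and b_sum: "(\<lambda>i. b i powr q) summable_on (UNIV :: int set)"
    and b_le: "\<And>i. ennreal (2 powr (real_of_int i / p)) *
        emeasure lborel {t. 0 < t \<and> ennreal (2 powr real_of_int i) \<le> m t} \<le> ennreal (b i)"
    using lorentz_level_sequence[OF _ q m_anti m_meas fin[unfolded Lf_def]] p by auto
  define \<tau> where "\<tau> J = infsum (\<lambda>i. b i powr q) {J..}" for J
  have \<tau>_nn: "0 \<le> \<tau> J" for J
    unfolding \<tau>_def by (intro infsum_nonneg) simp
  have \<tau>_le: "\<tau> J \<le> infsum (\<lambda>i. b i powr q) UNIV" for J
    unfolding \<tau>_def by (intro infsum_mono_neutral summable_on_subset_banach[OF b_sum]) auto
  from ex_dyadic_fourier_bound[OF p, where 'a='a]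
  obtain C \<delta> where C: "0 < C" and \<delta>: "0 < \<delta>" and bound: "\<And>(k::int) (i::int) S E. finite S \<Longrightarrow> S \<subseteq> int_lattice \<Longrightarrow> (E :: 'a set) \<in> sets borel \<Longrightarrow>
    emeasure lborel E \<le> ennreal (2 powr (real_of_int i + 1)) \<Longrightarrow>
    (\<integral>\<^sup>+\<xi>. indicator E \<xi> * ennreal (norm (set_fourier (cube_union (2 powr real_of_int k) S) \<xi>)) \<partial>lborel) \<le>
      ennreal (C * sqrt (card S * 2 powr (- real_of_int k * (2 * real DIM('a) / p))) * 2 powr (real_of_int i / p) *
        2 powr (- \<delta> * \<bar>real_of_int (i - k * d)\<bar>))"
    unfolding d_def by blast
  define \<kappa> where "\<kappa> n = 2 powr (- \<delta> * \<bar>real_of_int n\<bar>)" for n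
  \<comment> \<open>Here \<open>n\<close> numbers the diagonals i - kd. Levels k at least
    \<open>K\<close> meet the diagonal \<open>n\<close> only at indices i at least n + Kd, so only a
    tail of the level sequence enters.\<close>
  define \<epsilon> where "\<epsilon> K = (\<integral>\<^sup>+n. ennreal (C * \<kappa> n * \<tau> (n + int K * d) powr (1 / q)) \<partial>count_space UNIV)" for K
  show ?thesis
  proof (intro exI[of _ \<epsilon>] conjI allI impI)
    define T where "T = infsum (\<lambda>i. b i powr q) UNIV powr (1 / q)"
    have "(\<lambda>K. \<integral>\<^sup>+n. ennreal (C * \<kappa> n * \<tau> (n + int K * d) powr (1 / q)) \<partial>count_space UNIV) \<longlonglongrightarrow>
        (\<integral>\<^sup>+n. 0 \<partial>count_space (UNIV :: int set))"
    proof (rule nn_integral_dominated_convergence[where w="\<lambda>n. ennreal (C * T) * ennreal (\<kappa> n)"])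
      show "(\<integral>\<^sup>+n. ennreal (C * T) * ennreal (\<kappa> n) \<partial>count_space UNIV) < \<infinity>"
        using nn_integral_two_sided_geometric_finite[OF \<delta>]
        by (simp add: nn_integral_cmult \<kappa>_def ennreal_mult_less_top)
      show "AE n in count_space UNIV. ennreal (C * \<kappa> n * \<tau> (n + int K * d) powr (1 / q)) \<le> ennreal (C * T) * ennreal (\<kappa> n)" for K
      proof (rule AE_I2)
        fix n
        have "\<tau> (n + int K * d) powr (1 / q) \<le> T"
          unfolding T_def using q \<tau>_nn \<tau>_le by (intro powr_mono2) auto
        then have "C * \<kappa> n * \<tau> (n + int K * d) powr (1 / q) \<le> C * \<kappa> n * T"
          using C by (intro mult_left_mono) (auto simp: \<kappa>_def)
        then show "ennreal (C * \<kappa> n * \<tau> (n + int K * d) powr (1 / q)) \<le> ennreal (C * T) * ennreal (\<kappa> n)"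
          using C by (simp add: ennreal_mult[symmetric] T_def \<kappa>_def ennreal_leI mult_ac)
      qed
      show "AE n in count_space UNIV. (\<lambda>K. ennreal (C * \<kappa> n * \<tau> (n + int K * d) powr (1 / q))) \<longlonglongrightarrow> 0"
      proof (rule AE_I2)
        fix n
        have "filterlim (\<lambda>K. n + int K * d) at_top sequentially"
          unfolding filterlim_at_top
        proof
          fix Z
          have "Z \<le> n + int K * d" if "nat \<bar>Z - n\<bar> \<le> K" for K
          proof -
            have "int K * 1 \<le> int K * d"
              using d by (intro mult_left_mono) auto
            then show ?thesis
              using that by linarith
          qed
          then show "\<forall>\<^sub>F K in sequentially. Z \<le> n + int K * d"
            unfolding eventually_sequentially by blast
        qed
        then have "(\<lambda>K. \<tau> (n + int K * d)) \<longlonglongrightarrow> 0"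
          unfolding \<tau>_def by (rule filterlim_compose[OF infsum_tail_tendsto_0[OF b_sum powr_ge_zero]])
        then have "(\<lambda>K. \<tau> (n + int K * d) powr (1 / q)) \<longlonglongrightarrow> 0 powr (1 / q)"
          using q \<tau>_nn by (intro tendsto_powr2) auto
        then have "(\<lambda>K. C * \<kappa> n * \<tau> (n + int K * d) powr (1 / q)) \<longlonglongrightarrow> C * \<kappa> n * 0"
          by (intro tendsto_mult tendsto_const) simp
        then show "(\<lambda>K. ennreal (C * \<kappa> n * \<tau> (n + int K * d) powr (1 / q))) \<longlonglongrightarrow> 0"
          by (metis ennreal_0 mult_zero_right tendsto_ennrealI)
      qed
    qed auto
    then show "\<epsilon> \<longlonglongrightarrow> 0"
      by (simp add: \<epsilon>_def[abs_def])
  next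
    fix K :: nat and Ks :: "int set" and S :: "int \<Rightarrow> 'a set" and H :: real
    assume Ks: "finite Ks" "\<forall>k\<in>Ks. int K \<le> k"
      and S: "\<forall>k\<in>Ks. finite (S k) \<and> S k \<subseteq> int_lattice" and H: "0 \<le> H"
      and dual: "\<forall>c. (\<forall>k. 0 \<le> c k) \<longrightarrow>
        (\<Sum>k\<in>Ks. sqrt (card (S k) * 2 powr (- real_of_int k * (2 * real DIM('a) / p))) * c k) \<le>
          H * (\<Sum>k\<in>Ks. c k powr q) powr (1 / q)"
    define a where "a k = sqrt (card (S k) * 2 powr (- real_of_int k * (2 * real DIM('a) / p)))" for k
    have a: "0 \<le> a k" for k
      by (simp add: a_def)
    define F where "F k \<xi> = ennreal (norm (set_fourier (cube_union (2 powr real_of_int k) (S k)) \<xi>))" for k \<xi>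
    have level: "(\<integral>\<^sup>+\<xi>. F k \<xi> * ennreal (norm (f \<xi>)) \<partial>lborel) \<le>
        (\<integral>\<^sup>+n. ennreal (C * \<kappa> n * (a k * b (n + k * d))) \<partial>count_space UNIV)" if k: "k \<in> Ks" for k
    proof -
      note Sk = bspec[OF S k, THEN conjunct1] bspec[OF S k, THEN conjunct2]
      have [measurable]: "F k \<in> borel_measurable borel"
        unfolding F_def using set_fourier_cube_union_measurable[OF Sk, of "2 powr real_of_int k"] by simp
      define D where "D i = {t. 0 < t \<and> ennreal (2 powr real_of_int i) \<le> m t}" for i :: int
      have [measurable]: "D i \<in> sets borel" for i
        unfolding D_def by measurable
      define A where "A i = C * a k * 2 powr (real_of_int i / p) * \<kappa> (i - k * d)" for i
      have "(\<integral>\<^sup>+\<xi>. F k \<xi> * ennreal (norm (f \<xi>)) \<partial>lborel) =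
          (\<integral>\<^sup>+t. indicator {0<..} t * (\<integral>\<^sup>+\<xi>. indicator {\<xi>. t \<le> norm (f \<xi>)} \<xi> * F k \<xi> \<partial>lborel) \<partial>lborel)"
        by (rule nn_integral_layer_cake_mult) auto
      also have "\<dots> \<le> (\<integral>\<^sup>+t. (\<integral>\<^sup>+i. ennreal (A i) * indicator (D i) t \<partial>count_space UNIV) \<partial>lborel)"
      proof (rule nn_integral_mono_AE, use m_fin in eventually_elim)
        fix t assume mt: "0 < t \<longrightarrow> m t \<noteq> \<infinity>"
        show "indicator {0<..} t * (\<integral>\<^sup>+\<xi>. indicator {\<xi>. t \<le> norm (f \<xi>)} \<xi> * F k \<xi> \<partial>lborel) \<le>
            (\<integral>\<^sup>+i. ennreal (A i) * indicator (D i) t \<partial>count_space UNIV)"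
        proof (cases "0 < t \<and> 0 < m t")
          case True
          then obtain M where M: "m t = ennreal M" "0 < M"
            using mt by (cases "m t") auto
          \<comment> \<open>The level set at height t has measure between 2^i and 2^(i+1). Thus
            \<open>t\<close> lies in \<open>D i\<close>, and this single term of the sum over all
            levels already dominates.\<close>
          define i where "i = \<lfloor>log 2 M\<rfloor>"
          have "2 powr real_of_int i \<le> 2 powr (log 2 M)" "2 powr (log 2 M) \<le> 2 powr (real_of_int i + 1)"
            unfolding i_def by (intro powr_mono; linarith)+
          then have i: "2 powr real_of_int i \<le> M" "M \<le> 2 powr (real_of_int i + 1)"
            using M by auto
          have "(\<integral>\<^sup>+\<xi>. indicator {\<xi>. t \<le> norm (f \<xi>)} \<xi> * F k \<xi> \<partial>lborel) \<le> ennreal (A i)"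
            unfolding F_def A_def \<kappa>_def a_def
            using bound[OF Sk, of "{\<xi>. t \<le> norm (f \<xi>)}" i k] M i
            by (simp add: m_def distrib_fun_def ennreal_leI)
          also have "ennreal (A i) = (\<integral>\<^sup>+j. ennreal (A i) * indicator {i} j \<partial>count_space UNIV)"
            by (simp add: nn_integral_cmult_indicator)
          also have "\<dots> \<le> (\<integral>\<^sup>+i. ennreal (A i) * indicator (D i) t \<partial>count_space UNIV)"
            using True M i by (intro nn_integral_mono) (auto simp: D_def ennreal_leI split: split_indicator)
          finally show ?thesis
            using True by simp
        next
          case False
          have "indicator {0<..} t * (\<integral>\<^sup>+\<xi>. indicator {\<xi>. t \<le> norm (f \<xi>)} \<xi> * F k \<xi> \<partial>lborel) = 0"
          proof (cases "0 < t")
            case True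
            then have "emeasure lborel {\<xi>. t \<le> norm (f \<xi>)} = 0"
              using False by (simp add: m_def distrib_fun_def)
            then have "AE \<xi> in lborel. \<xi> \<notin> {\<xi>. t \<le> norm (f \<xi>)}"
              by (intro AE_not_in) (auto simp: null_sets_def)
            then have "(\<integral>\<^sup>+\<xi>. indicator {\<xi>. t \<le> norm (f \<xi>)} \<xi> * F k \<xi> \<partial>lborel) = (\<integral>\<^sup>+\<xi>. 0 \<partial>(lborel :: 'a measure))"
              by (intro nn_integral_cong_AE) (auto elim!: eventually_mono)
            then show ?thesis
              by simp
          qed simp
          then show ?thesis
            by (rule ord_eq_le_trans) simp
        qed
      qed
      also have "\<dots> = (\<integral>\<^sup>+i. (\<integral>\<^sup>+t. ennreal (A i) * indicator (D i) t \<partial>lborel) \<partial>count_space UNIV)"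
        by (intro nn_integral_count_space_nn_integral) auto
      also have "\<dots> \<le> (\<integral>\<^sup>+i. ennreal (C * \<kappa> (i - k * d) * (a k * b i)) \<partial>count_space UNIV)"
      proof (intro nn_integral_mono)
        fix i
        have A: "ennreal (A i) = ennreal (C * \<kappa> (i - k * d) * a k) * ennreal (2 powr (real_of_int i / p))"
          using C a by (simp add: A_def ennreal_mult[symmetric] \<kappa>_def mult_ac)
        have "(\<integral>\<^sup>+t. ennreal (A i) * indicator (D i) t \<partial>lborel) =
            ennreal (C * \<kappa> (i - k * d) * a k) * (ennreal (2 powr (real_of_int i / p)) * emeasure lborel (D i))"
        proof -
          have "(\<integral>\<^sup>+t. ennreal (A i) * indicator (D i) t \<partial>lborel) = ennreal (A i) * emeasure lborel (D i)"
            by (simp add: nn_integral_cmult_indicator)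
          then show ?thesis
            by (simp only: A mult.assoc)
        qed
        also have "\<dots> \<le> ennreal (C * \<kappa> (i - k * d) * a k) * ennreal (b i)"
          using b_le[of i] by (intro mult_left_mono) (auto simp: D_def)
        also have "\<dots> = ennreal (C * \<kappa> (i - k * d) * (a k * b i))"
          using C a b by (simp add: ennreal_mult[symmetric] \<kappa>_def mult_ac)
        finally show "(\<integral>\<^sup>+t. ennreal (A i) * indicator (D i) t \<partial>lborel) \<le> ennreal (C * \<kappa> (i - k * d) * (a k * b i))" .
      qed
      \<comment> \<open>Reindexing by the diagonal makes the weight \<kappa> independent of k, so
        that the sum over k can be taken first for each fixed \<open>n\<close>.\<close>
      also have "\<dots> = (\<integral>\<^sup>+n. ennreal (C * \<kappa> n * (a k * b (n + k * d))) \<partial>count_space UNIV)"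
      proof -
        have "bij_betw (\<lambda>n. n + k * d) UNIV UNIV"
          by (rule bij_betw_byWitness[where f'="\<lambda>n. n - k * d"]) auto
        from nn_integral_bij_count_space[OF this, of "\<lambda>i. ennreal (C * \<kappa> (i - k * d) * (a k * b i))"]
        show ?thesis
          by simp
      qed
      finally show ?thesis .
    qed
    have "(\<Sum>k\<in>Ks. \<integral>\<^sup>+\<xi>. F k \<xi> * ennreal (norm (f \<xi>)) \<partial>lborel) \<le>
        (\<Sum>k\<in>Ks. \<integral>\<^sup>+n. ennreal (C * \<kappa> n * (a k * b (n + k * d))) \<partial>count_space UNIV)"
      by (intro sum_mono level)
    also have "\<dots> = (\<integral>\<^sup>+n. (\<Sum>k\<in>Ks. ennreal (C * \<kappa> n * (a k * b (n + k * d)))) \<partial>count_space UNIV)"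
      by (rule nn_integral_sum[symmetric]) simp
    also have "\<dots> \<le> (\<integral>\<^sup>+n. ennreal H * ennreal (C * \<kappa> n * \<tau> (n + int K * d) powr (1 / q)) \<partial>count_space UNIV)"
    proof (intro nn_integral_mono)
      fix n
      have inj: "inj_on (\<lambda>k. n + k * d) Ks"
        using d by (auto simp: inj_on_def)
      have sum_b: "(\<Sum>k\<in>Ks. b (n + k * d) powr q) \<le> \<tau> (n + int K * d)"
      proof -
        have "(\<Sum>k\<in>Ks. b (n + k * d) powr q) = (\<Sum>i\<in>(\<lambda>k. n + k * d) ` Ks. b i powr q)"
          by (simp add: sum.reindex[OF inj])
        also have "\<dots> \<le> \<tau> (n + int K * d)"
          unfolding \<tau>_def
          using Ks d by (intro finite_sum_le_infsum summable_on_subset_banach[OF b_sum]) (auto simp: mult_right_mono)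
        finally show ?thesis .
      qed
      \<comment> \<open>The duality hypothesis, applied to the level sequence read along the
        diagonal \<open>n\<close>.\<close>
      have "(\<Sum>k\<in>Ks. a k * b (n + k * d)) \<le> H * (\<Sum>k\<in>Ks. b (n + k * d) powr q) powr (1 / q)"
        unfolding a_def by (rule dual[rule_format]) (rule b)
      also have "\<dots> \<le> H * \<tau> (n + int K * d) powr (1 / q)"
        using H q sum_b by (intro mult_left_mono powr_mono2) (auto intro: sum_nonneg)
      finally have "C * \<kappa> n * (\<Sum>k\<in>Ks. a k * b (n + k * d)) \<le> C * \<kappa> n * (H * \<tau> (n + int K * d) powr (1 / q))"
        using C by (intro mult_left_mono) (auto simp: \<kappa>_def)
      moreover have "(\<Sum>k\<in>Ks. ennreal (C * \<kappa> n * (a k * b (n + k * d)))) = ennreal (C * \<kappa> n * (\<Sum>k\<in>Ks. a k * b (n + k * d)))"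
        using C a b by (subst sum_ennreal) (auto simp: \<kappa>_def sum_distrib_left)
      ultimately show "(\<Sum>k\<in>Ks. ennreal (C * \<kappa> n * (a k * b (n + k * d)))) \<le>
          ennreal H * ennreal (C * \<kappa> n * \<tau> (n + int K * d) powr (1 / q))"
        using H C by (simp add: ennreal_mult[symmetric] \<kappa>_def ennreal_leI mult_ac)
    qed
    also have "\<dots> = ennreal H * \<epsilon> K"
      unfolding \<epsilon>_def by (simp add: nn_integral_cmult)
    finally show "(\<Sum>k\<in>Ks. \<integral>\<^sup>+\<xi>. ennreal (norm (set_fourier (cube_union (2 powr real_of_int k) (S k)) \<xi>)) *
        ennreal (norm (f \<xi>)) \<partial>lborel) \<le> ennreal H * \<epsilon> K"
      by (simp add: F_def)
  qed
qed

section \<open>Gaussian smoothing\<close>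

definition gauss_freq :: "'a::euclidean_space \<Rightarrow> real" where
  "gauss_freq \<xi> = (\<Prod>b\<in>Basis. std_normal_density (\<xi> \<bullet> b))"

text \<open>The Fourier transform of \<open>gauss_freq\<close>, left unnormalised. Its total mass is
  carried along as a constant \<open>c\<close> of which only positivity matters.\<close>

definition gauss_kernel :: "'a::euclidean_space \<Rightarrow> real" where
  "gauss_kernel y = (\<Prod>b\<in>Basis. exp (- ((2 * pi * (y \<bullet> b))\<^sup>2) / 2))"

lemma gauss_measurable [measurable]:
  "gauss_freq \<in> borel_measurable borel" "gauss_kernel \<in> borel_measurable borel"
  unfolding gauss_freq_def[abs_def] gauss_kernel_def[abs_def] by measurable

lemma gauss_freq_nonneg: "0 \<le> gauss_freq \<xi>"
  unfolding gauss_freq_def by (intro prod_nonneg) auto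

lemma gauss_kernel_nonneg: "0 \<le> gauss_kernel y"
  unfolding gauss_kernel_def by (intro prod_nonneg) auto

lemma gauss_freq_minus [simp]: "gauss_freq (- \<xi>) = gauss_freq \<xi>"
  by (simp add: gauss_freq_def std_normal_density_def)

lemma gauss_freq_le_1: "gauss_freq \<xi> \<le> 1"
proof -
  have "std_normal_density x \<le> 1" for x
  proof -
    have "1 \<le> sqrt (2 * pi)"
      using pi_ge_two by simp
    then have "1 / sqrt (2 * pi) * exp (- x\<^sup>2 / 2) \<le> 1 * 1"
      by (intro mult_mono) auto
    then show ?thesis
      by (simp add: std_normal_density_def)
  qed
  then show ?thesis
    unfolding gauss_freq_def by (intro prod_le_1) auto
qed

lemma integrable_gauss_freq: "integrable lborel (gauss_freq :: 'a::euclidean_space \<Rightarrow> real)"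
  unfolding gauss_freq_def by (rule lborel_integrable_prod) simp

text \<open>Coordinatewise this is the characteristic function of the standard normal distribution,
  evaluated at 2 pi times the coordinate of y.\<close>

lemma gauss_fourier:
  fixes y :: "'a::euclidean_space"
  shows "(\<integral>\<xi>. complex_of_real (gauss_freq \<xi>) * cis (2 * pi * (y \<bullet> \<xi>)) \<partial>lborel) = gauss_kernel y"
proof -
  define f where "f b t = complex_of_real (std_normal_density t) * cis (2 * pi * (y \<bullet> b) * t)" for b t
  have f_val: "integral\<^sup>L lborel (f b) = exp (- ((2 * pi * (y \<bullet> b))\<^sup>2) / 2)" for b
  proof -
    have "char std_normal_distribution (2 * pi * (y \<bullet> b)) = integral\<^sup>L lborel (f b)"
      unfolding char_def f_def
      by (subst integral_density) (auto simp: cis_conv_exp scaleR_conv_of_real mult_ac)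
    then show ?thesis
      by (simp add: char_std_normal_distribution)
  qed
  have [measurable]: "f b \<in> borel_measurable borel" for b
    unfolding f_def[abs_def] by measurable
  have f_int: "integrable lborel (f b)" for b
    by (rule Bochner_Integration.integrable_bound[of _ std_normal_density])
       (auto simp: f_def norm_mult)
  have "complex_of_real (gauss_freq \<xi>) * cis (2 * pi * (y \<bullet> \<xi>)) = (\<Prod>b\<in>Basis. f b (\<xi> \<bullet> b))" for \<xi>
    by (subst cis_inner) (simp add: gauss_freq_def f_def prod.distrib)
  then show ?thesis
    using lborel_integral_prod[of f] f_int f_val by (simp add: gauss_kernel_def)
qed

lemma
  shows integrable_gauss_kernel: "integrable lborel (gauss_kernel :: 'a::euclidean_space \<Rightarrow> real)"
    and integral_gauss_kernel_pos: "0 < (\<integral>y. gauss_kernel (y :: 'a) \<partial>lborel)"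
proof -
  define h where "h t = exp (- ((2 * pi * t)\<^sup>2) / 2)" for t
  have h: "h t = sqrt (2 * pi) * std_normal_density (0 + 2 * pi * t)" for t
    by (simp add: h_def std_normal_density_def)
  have h_int: "integrable lborel h"
    unfolding h[abs_def] by (intro integrable_mult_right lborel_integrable_real_affine) auto
  have "(\<integral>x. std_normal_density x \<partial>lborel) = \<bar>2 * pi\<bar> *\<^sub>R (\<integral>x. std_normal_density (0 + 2 * pi * x) \<partial>lborel)"
    by (rule lborel_integral_real_affine) simp
  then have "(\<integral>x. std_normal_density (0 + 2 * pi * x) \<partial>lborel) = 1 / (2 * pi)"
    by (simp add: field_simps)
  then have h_pos: "0 < (\<integral>t. h t \<partial>lborel)"
    unfolding h by (simp add: zero_less_mult_iff)
  have eq: "gauss_kernel = (\<lambda>y::'a. \<Prod>b\<in>Basis. h (y \<bullet> b))"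
    by (simp add: gauss_kernel_def h_def fun_eq_iff)
  show "integrable lborel (gauss_kernel :: 'a \<Rightarrow> real)"
    unfolding eq by (intro lborel_integrable_prod h_int)
  show "0 < (\<integral>y. gauss_kernel (y :: 'a) \<partial>lborel)"
    unfolding eq by (subst lborel_integral_prod) (auto intro!: h_int zero_less_power h_pos)
qed

section \<open>Convolution of an indicator with a shrinking Gaussian\<close>

text \<open>The convolution after substitution: the scale sits in the indicator instead of the
  kernel, so \<open>gauss_kernel\<close> itself dominates the integrand for every
  \<epsilon>.\<close>

definition smoothed :: "'a::euclidean_space set \<Rightarrow> real \<Rightarrow> 'a \<Rightarrow> real" where
  "smoothed U \<epsilon> x = (\<integral>y. indicator U (x - \<epsilon> *\<^sub>R y) * gauss_kernel y \<partial>lborel)"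

lemma smoothed_measurable [measurable]:
  assumes [measurable]: "U \<in> sets borel"
  shows "smoothed U \<epsilon> \<in> borel_measurable borel"
  unfolding smoothed_def[abs_def] by measurable

lemma smoothed_integrable:
  assumes [measurable]: "U \<in> sets borel"
  shows "integrable lborel (\<lambda>y. indicator U (x - \<epsilon> *\<^sub>R y) * gauss_kernel y)"
  by (rule Bochner_Integration.integrable_bound[OF integrable_gauss_kernel])
     (auto split: split_indicator)

lemma smoothed_bounds:
  fixes U :: "'a::euclidean_space set"
  assumes [measurable]: "U \<in> sets borel"
  shows "0 \<le> smoothed U \<epsilon> x" "smoothed U \<epsilon> x \<le> (\<integral>y. gauss_kernel (y :: 'a) \<partial>lborel)"
proof -
  show "0 \<le> smoothed U \<epsilon> x"
    unfolding smoothed_def by (intro integral_nonneg_AE AE_I2) (auto simp: gauss_kernel_nonneg)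
  show "smoothed U \<epsilon> x \<le> (\<integral>y. gauss_kernel (y :: 'a) \<partial>lborel)"
    unfolding smoothed_def
    by (intro integral_mono smoothed_integrable integrable_gauss_kernel assms)
       (auto simp: gauss_kernel_nonneg split: split_indicator)
qed

text \<open>Off the frontier the indicator is constant near \<open>x\<close>, and for each y the
  point x - e_n y eventually enters that neighbourhood.\<close>

lemma smoothed_tendsto:
  fixes U :: "'a::euclidean_space set"
  assumes [measurable]: "U \<in> sets borel" and x: "x \<notin> frontier U" and e: "e \<longlonglongrightarrow> 0"
  shows "(\<lambda>n. smoothed U (e n) x) \<longlonglongrightarrow> indicator U x * (\<integral>y. gauss_kernel (y :: 'a) \<partial>lborel)"
proof -
  have "(\<lambda>n. \<integral>y. indicator U (x - e n *\<^sub>R y) * gauss_kernel y \<partial>lborel) \<longlonglongrightarrow>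
      (\<integral>y. indicator U x * gauss_kernel (y :: 'a) \<partial>lborel)"
  proof (rule integral_dominated_convergence[where w=gauss_kernel])
    show "AE y in lborel. (\<lambda>n. indicator U (x - e n *\<^sub>R y) * gauss_kernel y) \<longlonglongrightarrow> indicator U x * gauss_kernel y"
    proof (rule AE_I2)
      fix y :: 'a
      have lim: "(\<lambda>n. x - e n *\<^sub>R y) \<longlonglongrightarrow> x"
        using tendsto_diff[OF tendsto_const tendsto_scaleR[OF e tendsto_const], of x y] by simp
      have "\<forall>\<^sub>F n in sequentially. (indicator U (x - e n *\<^sub>R y) :: real) = indicator U x"
      proof (cases "x \<in> U")
        case True
        then have "x \<in> interior U"
          using x closure_subset[of U] by (auto simp: frontier_def)
        then have "\<forall>\<^sub>F n in sequentially. x - e n *\<^sub>R y \<in> interior U"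
          using lim by (intro topological_tendstoD) auto
        then show ?thesis
          using True interior_subset[of U] by (auto elim!: eventually_mono simp: indicator_def)
      next
        case False
        then have "x \<in> - closure U"
          using x interior_subset[of U] by (auto simp: frontier_def)
        then have "\<forall>\<^sub>F n in sequentially. x - e n *\<^sub>R y \<in> - closure U"
          using lim by (intro topological_tendstoD) auto
        then show ?thesis
          using False closure_subset[of U] by (auto elim!: eventually_mono simp: indicator_def)
      qed
      then show "(\<lambda>n. indicator U (x - e n *\<^sub>R y) * gauss_kernel y) \<longlonglongrightarrow> indicator U x * gauss_kernel y"
        by (intro tendsto_eventually) (auto elim!: eventually_mono)
    qed
    show "AE y in lborel. norm (indicator U (x - e n *\<^sub>R y) * gauss_kernel y) \<le> gauss_kernel y" for n
      by (auto simp: gauss_kernel_nonneg split: split_indicator)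
  qed (auto simp: integrable_gauss_kernel)
  then show ?thesis
    by (simp add: smoothed_def)
qed

section \<open>Fourier representation of the smoothed integrals\<close>

text \<open>Justifies both exchanges of integrals below, where the integrand is dominated by a
  product of one function of each variable, the frequency variable always carrying the Gaussian
  cut-off.\<close>

lemma integrable_pair_dominated:
  fixes h :: "'a \<times> 'b \<Rightarrow> complex" and u :: "'a \<Rightarrow> real" and v :: "'b \<Rightarrow> real"
  assumes "sigma_finite_measure M" "sigma_finite_measure N"
    and h[measurable]: "h \<in> borel_measurable (M \<Otimes>\<^sub>M N)"
    and u: "integrable M u" and v: "integrable N v"
    and le: "\<And>x y. x \<in> space M \<Longrightarrow> y \<in> space N \<Longrightarrow> norm (h (x, y)) \<le> u x * v y"
  shows "integrable (M \<Otimes>\<^sub>M N) h"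
proof -
  interpret M: sigma_finite_measure M by fact
  interpret N: sigma_finite_measure N by fact
  interpret pair_sigma_finite M N ..
  have [measurable]: "u \<in> borel_measurable M" "v \<in> borel_measurable N"
    using u v by auto
  have "integrable (M \<Otimes>\<^sub>M N) (\<lambda>(x, y). u x * v y)"
  proof (rule Fubini_integrable)
    show "integrable M (\<lambda>x. \<integral>y. norm (case (x, y) of (x, y) \<Rightarrow> u x * v y) \<partial>N)"
      using u v by (simp add: abs_mult)
    show "AE x in M. integrable N (\<lambda>y. case (x, y) of (x, y) \<Rightarrow> u x * v y)"
      using v by simp
  qed simp
  then show ?thesis
    by (rule Bochner_Integration.integrable_bound)
       (auto simp: space_pair_measure intro!: AE_I2 order_trans[OF le])
qed

lemma set_fourier_measurable [measurable]:
  assumes [measurable]: "U \<in> sets borel"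
  shows "set_fourier U \<in> borel_measurable borel"
  unfolding set_fourier_def[abs_def] by measurable

lemma norm_set_fourier_le:
  fixes U :: "'a::euclidean_space set"
  assumes [measurable]: "U \<in> sets borel" and fin: "emeasure lborel U < \<infinity>"
  shows "norm (set_fourier U \<xi>) \<le> measure lborel U"
proof -
  have "norm (set_fourier U \<xi>) \<le> (\<integral>y. norm (indicator U y *\<^sub>R cis (2 * pi * (y \<bullet> \<xi>))) \<partial>lborel)"
    unfolding set_fourier_def by (rule integral_norm_bound)
  also have "\<dots> = measure lborel U"
    by simp
  finally show ?thesis .
qed

lemma integrable_gauss_freq_scaled:
  "\<epsilon> \<noteq> 0 \<Longrightarrow> integrable lborel (\<lambda>\<xi>::'a::euclidean_space. gauss_freq (\<epsilon> *\<^sub>R \<xi>))"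
  using lborel_integrable_affine[OF integrable_gauss_freq, of \<epsilon> 0] by simp

text \<open>Fourier inversion by hand: the rescaled kernel is itself an absolutely convergent
  Fourier integral, so inserting it and exchanging the integrals produces
  \<open>set_fourier U\<close>.\<close>

lemma smoothed_fourier:
  fixes U :: "'a::euclidean_space set"
  assumes [measurable]: "U \<in> sets borel" and fin: "emeasure lborel U < \<infinity>" and \<epsilon>: "0 < \<epsilon>"
  shows "complex_of_real (smoothed U \<epsilon> x) =
    (\<integral>\<zeta>. gauss_freq (\<epsilon> *\<^sub>R \<zeta>) *\<^sub>R (set_fourier U \<zeta> * cis (- 2 * pi * (x \<bullet> \<zeta>))) \<partial>lborel)"
proof -
  have kernel: "complex_of_real (gauss_kernel ((x - z) /\<^sub>R \<epsilon>)) =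
      of_real (\<epsilon> ^ DIM('a)) * (\<integral>\<zeta>. gauss_freq (\<epsilon> *\<^sub>R \<zeta>) *\<^sub>R cis (2 * pi * ((z - x) \<bullet> \<zeta>)) \<partial>lborel)" for z
  proof -
    define f where "f \<xi> = complex_of_real (gauss_freq \<xi>) * cis (2 * pi * (((x - z) /\<^sub>R \<epsilon>) \<bullet> \<xi>))" for \<xi> :: 'a
    have [measurable]: "f \<in> borel_measurable borel"
      unfolding f_def[abs_def] by measurable
    have f: "integrable lborel f"
      by (rule Bochner_Integration.integrable_bound[OF integrable_gauss_freq])
         (auto simp: f_def norm_mult gauss_freq_nonneg)
    have "complex_of_real (gauss_kernel ((x - z) /\<^sub>R \<epsilon>)) = (\<integral>\<xi>. f \<xi> \<partial>lborel)"
      unfolding f_def by (rule gauss_fourier[symmetric])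
    \<comment> \<open>The substitution \<xi> = -\<epsilon> \<zeta> removes the scale from the phase
      and turns x - z into z - x; \<open>gauss_freq\<close> is even, so it keeps its form.\<close>
    also have "\<dots> = (\<epsilon> ^ DIM('a)) *\<^sub>R (\<integral>\<zeta>. f (0 + (- \<epsilon>) *\<^sub>R \<zeta>) \<partial>lborel)"
      using \<epsilon> lborel_integral_affine[OF f, of "- \<epsilon>" 0] by simp
    also have "(\<lambda>\<zeta>. f (0 + (- \<epsilon>) *\<^sub>R \<zeta>)) = (\<lambda>\<zeta>. gauss_freq (\<epsilon> *\<^sub>R \<zeta>) *\<^sub>R cis (2 * pi * ((z - x) \<bullet> \<zeta>)))"
    proof
      fix \<zeta>
      have "((x - z) /\<^sub>R \<epsilon>) \<bullet> (0 + (- \<epsilon>) *\<^sub>R \<zeta>) = (z - x) \<bullet> \<zeta>"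
        using \<epsilon> by (simp add: inner_diff_left field_simps)
      then show "f (0 + (- \<epsilon>) *\<^sub>R \<zeta>) = gauss_freq (\<epsilon> *\<^sub>R \<zeta>) *\<^sub>R cis (2 * pi * ((z - x) \<bullet> \<zeta>))"
        unfolding f_def by (simp only:) (simp add: scaleR_conv_of_real)
    qed
    finally show ?thesis
      by (simp add: scaleR_conv_of_real)
  qed
  have "smoothed U \<epsilon> x = (\<integral>y. indicator U (x - \<epsilon> *\<^sub>R y) * gauss_kernel y \<partial>lborel)"
    by (simp add: smoothed_def)
  also have "\<dots> = inverse (\<epsilon> ^ DIM('a)) * (\<integral>z. indicator U z * gauss_kernel ((x - z) /\<^sub>R \<epsilon>) \<partial>lborel)"
  proof -
    have "integrable lborel (\<lambda>y. indicator U (x - \<epsilon> *\<^sub>R y) * gauss_kernel y)"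
      by (rule smoothed_integrable) simp
    from lborel_integral_affine[OF this, of "- inverse \<epsilon>" "x /\<^sub>R \<epsilon>"] \<epsilon>
    show ?thesis
      by (simp add: scaleR_diff_right scaleR_add_right power_inverse)
  qed
  finally have "complex_of_real (smoothed U \<epsilon> x) = of_real (inverse (\<epsilon> ^ DIM('a))) *
      (\<integral>z. indicator U z * complex_of_real (gauss_kernel ((x - z) /\<^sub>R \<epsilon>)) \<partial>lborel)"
    by (simp add: integral_complex_of_real[symmetric] of_real_indicator del: integral_complex_of_real)
  also have "\<dots> = (\<integral>z. indicator U z * (\<integral>\<zeta>. gauss_freq (\<epsilon> *\<^sub>R \<zeta>) *\<^sub>R cis (2 * pi * ((z - x) \<bullet> \<zeta>)) \<partial>lborel) \<partial>lborel)"
    unfolding kernel using \<epsilon> by (simp add: mult.left_commute[of "indicator U _" "complex_of_real \<epsilon> ^ DIM('a)"])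
  also have "\<dots> = (\<integral>z. (\<integral>\<zeta>. indicator U z * (gauss_freq (\<epsilon> *\<^sub>R \<zeta>) *\<^sub>R cis (2 * pi * ((z - x) \<bullet> \<zeta>))) \<partial>lborel) \<partial>lborel)"
    by (simp only: integral_mult_right_zero)
  also have "\<dots> = (\<integral>\<zeta>. (\<integral>z. indicator U z * (gauss_freq (\<epsilon> *\<^sub>R \<zeta>) *\<^sub>R cis (2 * pi * ((z - x) \<bullet> \<zeta>))) \<partial>lborel) \<partial>lborel)"
  proof (rule lborel_pair.Fubini_integral[symmetric])
    show "integrable (lborel \<Otimes>\<^sub>M lborel) (\<lambda>(z, \<zeta>). indicator U z * (gauss_freq (\<epsilon> *\<^sub>R \<zeta>) *\<^sub>R cis (2 * pi * ((z - x) \<bullet> \<zeta>))))"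
    proof (rule integrable_pair_dominated[where u="indicator U" and v="\<lambda>\<zeta>. gauss_freq (\<epsilon> *\<^sub>R \<zeta>)"])
      show "integrable lborel (indicator U :: 'a \<Rightarrow> real)"
        using fin by simp
    qed (use \<epsilon> in \<open>auto simp: norm_mult gauss_freq_nonneg integrable_gauss_freq_scaled lborel.sigma_finite_measure_axioms split: split_indicator\<close>)
  qed
  also have "\<dots> = (\<integral>\<zeta>. gauss_freq (\<epsilon> *\<^sub>R \<zeta>) *\<^sub>R (set_fourier U \<zeta> * cis (- 2 * pi * (x \<bullet> \<zeta>))) \<partial>lborel)"
  proof (rule Bochner_Integration.integral_cong)
    fix \<zeta> :: 'a
    have "indicator U z * (gauss_freq (\<epsilon> *\<^sub>R \<zeta>) *\<^sub>R cis (2 * pi * ((z - x) \<bullet> \<zeta>))) =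
        (gauss_freq (\<epsilon> *\<^sub>R \<zeta>) *\<^sub>R cis (- 2 * pi * (x \<bullet> \<zeta>))) * (indicator U z *\<^sub>R cis (2 * pi * (z \<bullet> \<zeta>)))" for z
    proof -
      have "cis (2 * pi * ((z - x) \<bullet> \<zeta>)) = cis (- 2 * pi * (x \<bullet> \<zeta>)) * cis (2 * pi * (z \<bullet> \<zeta>))"
        by (simp add: cis_mult inner_diff_left right_diff_distrib)
      then show ?thesis
        by (simp split: split_indicator)
    qed
    then show "(\<integral>z. indicator U z * (gauss_freq (\<epsilon> *\<^sub>R \<zeta>) *\<^sub>R cis (2 * pi * ((z - x) \<bullet> \<zeta>))) \<partial>lborel) =
        gauss_freq (\<epsilon> *\<^sub>R \<zeta>) *\<^sub>R (set_fourier U \<zeta> * cis (- 2 * pi * (x \<bullet> \<zeta>)))"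
      by (simp only: integral_mult_right_zero set_fourier_def[symmetric]) (simp add: mult.commute)
  qed simp
  finally show ?thesis .
qed

text \<open>The second exchange of integrals. Here the cut-off is indispensable: the transform of
  \<open>U\<close> is bounded by the volume of \<open>U\<close>, but need not be integrable.\<close>

lemma integral_smoothed_fourier:
  fixes U :: "'a::euclidean_space set"
  assumes [measurable]: "U \<in> sets borel" and fin: "emeasure lborel U < \<infinity>" and \<epsilon>: "0 < \<epsilon>"
    and M: "finite_measure M" and sets[measurable_cong]: "sets M = sets borel"
  shows "integrable lborel (\<lambda>\<zeta>. gauss_freq (\<epsilon> *\<^sub>R \<zeta>) *\<^sub>R (set_fourier U \<zeta> * (\<integral>x. cis (- 2 * pi * (x \<bullet> \<zeta>)) \<partial>M)))" (is ?int)
    and "complex_of_real (\<integral>x. smoothed U \<epsilon> x \<partial>M) =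
      (\<integral>\<zeta>. gauss_freq (\<epsilon> *\<^sub>R \<zeta>) *\<^sub>R (set_fourier U \<zeta> * (\<integral>x. cis (- 2 * pi * (x \<bullet> \<zeta>)) \<partial>M)) \<partial>lborel)" (is ?val)
proof -
  interpret finite_measure M by fact
  interpret pair_sigma_finite M "lborel :: 'a measure" ..
  have sf: "sigma_finite_measure M" ..
  define h where "h = (\<lambda>(x, \<zeta>). gauss_freq (\<epsilon> *\<^sub>R \<zeta>) *\<^sub>R (set_fourier U \<zeta> * cis (- 2 * pi * (x \<bullet> \<zeta>))))"
  have h: "integrable (M \<Otimes>\<^sub>M lborel) h"
  proof (rule integrable_pair_dominated[where u="\<lambda>_. 1" and v="\<lambda>\<zeta>. gauss_freq (\<epsilon> *\<^sub>R \<zeta>) * measure lborel U"])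
    show "integrable lborel (\<lambda>\<zeta>::'a. gauss_freq (\<epsilon> *\<^sub>R \<zeta>) * measure lborel U)"
      using \<epsilon> by (intro integrable_mult_left integrable_gauss_freq_scaled) simp
    show "norm (h (x, \<zeta>)) \<le> 1 * (gauss_freq (\<epsilon> *\<^sub>R \<zeta>) * measure lborel U)" for x \<zeta>
      using norm_set_fourier_le[OF _ fin, of \<zeta>]
      by (auto simp: h_def norm_mult gauss_freq_nonneg intro!: mult_left_mono)
  qed (auto simp: h_def sf lborel.sigma_finite_measure_axioms)
  have inner: "(\<integral>x. h (x, \<zeta>) \<partial>M) = gauss_freq (\<epsilon> *\<^sub>R \<zeta>) *\<^sub>R (set_fourier U \<zeta> * (\<integral>x. cis (- 2 * pi * (x \<bullet> \<zeta>)) \<partial>M))" for \<zeta>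
    by (simp add: h_def)
  show ?int
    using integrable_snd[of "\<lambda>x \<zeta>. h (x, \<zeta>)"] h by (simp add: inner)
  have "complex_of_real (\<integral>x. smoothed U \<epsilon> x \<partial>M) = (\<integral>x. (\<integral>\<zeta>. h (x, \<zeta>) \<partial>lborel) \<partial>M)"
    using fin \<epsilon> by (simp add: integral_complex_of_real[symmetric] smoothed_fourier h_def del: integral_complex_of_real)
  also have "\<dots> = (\<integral>\<zeta>. (\<integral>x. h (x, \<zeta>) \<partial>M) \<partial>lborel)"
    using Fubini_integral[of "\<lambda>x \<zeta>. h (x, \<zeta>)"] h by simp
  finally show ?val
    by (simp add: inner)
qed

section \<open>Removing the smoothing\<close>

text \<open>Nothing is known about the measure of the frontier of \<open>U\<close>, but the frontier
  lies in V - A. On A and outside V the smoothed function converges to c times the indicator of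
  \<open>A\<close>; on V - A it stays between 0 and c, which costs at most c times the measure of V
  - A.\<close>

lemma smoothed_measure_error:
  fixes M :: "'a::euclidean_space measure"
  assumes M: "finite_measure M" and sets[measurable_cong]: "sets M = sets borel"
    and [measurable]: "A \<in> sets borel" "U \<in> sets borel"
    and V: "closed V" and AU: "A \<subseteq> interior U" and UV: "U \<subseteq> V"
    and e: "e \<longlonglongrightarrow> 0" and c: "c = (\<integral>y. gauss_kernel (y :: 'a) \<partial>lborel)"
  obtains r where "r \<longlonglongrightarrow> 0"
    "\<And>n. \<bar>(\<integral>x. smoothed U (e n) x \<partial>M) - c * measure M A\<bar> \<le> r n + c * measure M (V - A)"
proof -
  interpret finite_measure M by fact
  have [measurable]: "V \<in> sets borel"
    using V by simp
  have c0: "0 \<le> c"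
    using integral_gauss_kernel_pos[where 'a='a] c by simp
  have bounds: "0 \<le> smoothed U (e n) x" "smoothed U (e n) x \<le> c" for n x
    using smoothed_bounds[of U] c by auto
  have diff: "\<bar>smoothed U (e n) x - c * indicator A x\<bar> \<le> c" for n x
    using bounds[of n x] by (auto split: split_indicator)
  define h where "h n x = indicator (A \<union> - V) x * \<bar>smoothed U (e n) x - c * indicator A x\<bar>" for n x
  have [measurable]: "h n \<in> borel_measurable borel" for n
    unfolding h_def[abs_def] by measurable
  have h_le: "norm (h n x) \<le> c" for n x
    using diff[of n x] c0 by (auto simp: h_def split: split_indicator)
  have h_int: "integrable M (h n)" for n
    using h_le by (intro integrable_const_bound[of _ c]) auto
  have s_int: "integrable M (smoothed U (e n))" for n
    using bounds by (intro integrable_const_bound[of _ c]) auto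
  define r where "r n = (\<integral>x. h n x \<partial>M)" for n
  show thesis
  proof
    have "(\<lambda>n. \<integral>x. h n x \<partial>M) \<longlonglongrightarrow> (\<integral>x. 0 \<partial>M)"
    proof (rule integral_dominated_convergence[where w="\<lambda>_. c"])
      show "AE x in M. (\<lambda>n. h n x) \<longlonglongrightarrow> 0"
      proof (rule AE_I2)
        fix x
        show "(\<lambda>n. h n x) \<longlonglongrightarrow> 0"
        proof (cases "x \<in> A \<union> - V")
          case True
          have "closure U \<subseteq> V"
            using UV V by (simp add: closure_minimal)
          then have "x \<notin> frontier U"
            using True AU by (auto simp: frontier_def)
          then have "(\<lambda>n. smoothed U (e n) x) \<longlonglongrightarrow> indicator U x * c"
            unfolding c using e by (intro smoothed_tendsto) auto
          moreover have "indicator U x * c = c * indicator A x"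
            using True AU UV interior_subset[of U] by (auto split: split_indicator)
          ultimately have "(\<lambda>n. smoothed U (e n) x - c * indicator A x) \<longlonglongrightarrow> 0"
            by (simp add: LIM_zero)
          then have "(\<lambda>n. \<bar>smoothed U (e n) x - c * indicator A x\<bar>) \<longlonglongrightarrow> 0"
            by (rule tendsto_rabs_zero)
          then show ?thesis
            using True by (simp add: h_def)
        qed (simp add: h_def)
      qed
    qed (use h_le in auto)
    then show "r \<longlonglongrightarrow> 0"
      by (simp add: r_def[abs_def])
  next
    fix n
    have iA: "integrable M (\<lambda>x. c * indicator A x)"
      using c0 by (intro integrable_const_bound[of _ c]) (auto split: split_indicator)
    have iVA: "integrable M (\<lambda>x. c * indicator (V - A) x)"
      using c0 by (intro integrable_const_bound[of _ c]) (auto split: split_indicator)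
    have "(\<integral>x. smoothed U (e n) x \<partial>M) - c * measure M A = (\<integral>x. smoothed U (e n) x - c * indicator A x \<partial>M)"
      using s_int iA by simp
    also have "\<bar>\<dots>\<bar> \<le> (\<integral>x. \<bar>smoothed U (e n) x - c * indicator A x\<bar> \<partial>M)"
      by (rule integral_abs_bound)
    also have "\<dots> \<le> (\<integral>x. h n x + c * indicator (V - A) x \<partial>M)"
    proof (rule integral_mono)
      show "\<bar>smoothed U (e n) x - c * indicator A x\<bar> \<le> h n x + c * indicator (V - A) x" for x
        using diff[of n x] by (auto simp: h_def split: split_indicator)
    qed (use h_int s_int iA iVA in auto)
    also have "\<dots> = r n + c * measure M (V - A)"
      using h_int iVA by (simp add: r_def)
    finally show "\<bar>(\<integral>x. smoothed U (e n) x \<partial>M) - c * measure M A\<bar> \<le> r n + c * measure M (V - A)" .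
  qed
qed

text \<open>The cut-off \<open>gauss_freq\<close> is at most 1, so the smoothed pairings are bounded
  by the unsmoothed one uniformly in the scale. Only the spatial side has to pass to the limit, and
  its error is measured separately for each of the four positive measures.\<close>

lemma cmeasure_val_le_fourier:
  fixes M1 M2 M3 M4 :: "'a::euclidean_space measure"
  assumes fin: "finite_measure M1" "finite_measure M2" "finite_measure M3" "finite_measure M4"
    and sets: "sets M1 = sets borel" "sets M2 = sets borel" "sets M3 = sets borel" "sets M4 = sets borel"
    and A: "A \<in> sets borel" and U: "U \<in> sets borel" "emeasure lborel U < \<infinity>"
    and V: "closed V" and AU: "A \<subseteq> interior U" and UV: "U \<subseteq> V"
    and c: "c = (\<integral>y. gauss_kernel (y :: 'a) \<partial>lborel)"
  shows "ennreal (c * norm (cmeasure_val M1 M2 M3 M4 A)) \<le>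
    (\<integral>\<^sup>+\<xi>. ennreal (norm (set_fourier U \<xi>)) * ennreal (norm (cmeasure_fourier M1 M2 M3 M4 \<xi>)) \<partial>lborel) +
    ennreal (c * (measure M1 (V - A) + measure M2 (V - A) + measure M3 (V - A) + measure M4 (V - A)))"
    (is "_ \<le> ?B + _")
proof -
  have c0: "0 < c"
    using integral_gauss_kernel_pos[where 'a='a] c by simp
  define e where "e n = inverse (real (Suc n))" for n
  have e: "e \<longlonglongrightarrow> 0" and e0: "\<And>n. 0 < e n"
    unfolding e_def using LIMSEQ_inverse_real_of_nat by auto
  define \<Phi> where "\<Phi> M n = (\<integral>x. smoothed U (e n) x \<partial>M)" for M n
  define I where "I n = complex_of_real (\<Phi> M1 n - \<Phi> M2 n) + \<i> * complex_of_real (\<Phi> M3 n - \<Phi> M4 n)" for n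
  define J where "J M n \<zeta> = gauss_freq (e n *\<^sub>R \<zeta>) *\<^sub>R (set_fourier U \<zeta> * (\<integral>x. cis (- 2 * pi * (x \<bullet> \<zeta>)) \<partial>M))"
    for M :: "'a measure" and n and \<zeta> :: 'a
  have J: "integrable lborel (J M n)" "complex_of_real (\<Phi> M n) = (\<integral>\<zeta>. J M n \<zeta> \<partial>lborel)"
    if "finite_measure M" "sets M = sets borel" for M n
    unfolding J_def \<Phi>_def using integral_smoothed_fourier[OF U e0 that] by auto
  note J1 = J[OF fin(1) sets(1)] and J2 = J[OF fin(2) sets(2)] and J3 = J[OF fin(3) sets(3)] and J4 = J[OF fin(4) sets(4)]
  have I_le: "ennreal (norm (I n)) \<le> ?B" for n
  proof -
    have "I n = (\<integral>\<zeta>. J M1 n \<zeta> - J M2 n \<zeta> + \<i> * (J M3 n \<zeta> - J M4 n \<zeta>) \<partial>lborel)"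
      using J1(1) J2(1) J3(1) J4(1) by (simp add: I_def J1(2) J2(2) J3(2) J4(2))
    then have "ennreal (norm (I n)) \<le> (\<integral>\<^sup>+\<zeta>. norm (J M1 n \<zeta> - J M2 n \<zeta> + \<i> * (J M3 n \<zeta> - J M4 n \<zeta>)) \<partial>lborel)"
      using J1(1) J2(1) J3(1) J4(1) by (simp only:) (intro integral_norm_bound_ennreal, auto)
    also have "\<dots> \<le> ?B"
    proof (intro nn_integral_mono)
      fix \<zeta> :: 'a
      have "J M1 n \<zeta> - J M2 n \<zeta> + \<i> * (J M3 n \<zeta> - J M4 n \<zeta>) =
          gauss_freq (e n *\<^sub>R \<zeta>) *\<^sub>R (set_fourier U \<zeta> * cmeasure_fourier M1 M2 M3 M4 \<zeta>)"
        by (simp add: J_def cmeasure_fourier_def Let_def algebra_simps)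
      then have "norm (J M1 n \<zeta> - J M2 n \<zeta> + \<i> * (J M3 n \<zeta> - J M4 n \<zeta>)) =
          gauss_freq (e n *\<^sub>R \<zeta>) * (norm (set_fourier U \<zeta>) * norm (cmeasure_fourier M1 M2 M3 M4 \<zeta>))"
        by (simp add: norm_mult gauss_freq_nonneg)
      also have "\<dots> \<le> 1 * (norm (set_fourier U \<zeta>) * norm (cmeasure_fourier M1 M2 M3 M4 \<zeta>))"
        by (intro mult_right_mono gauss_freq_le_1) simp
      finally show "ennreal (norm (J M1 n \<zeta> - J M2 n \<zeta> + \<i> * (J M3 n \<zeta> - J M4 n \<zeta>))) \<le>
          ennreal (norm (set_fourier U \<zeta>)) * ennreal (norm (cmeasure_fourier M1 M2 M3 M4 \<zeta>))"
        by (simp add: ennreal_mult[symmetric] ennreal_leI)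
    qed
    finally show ?thesis .
  qed
  obtain r1 where r1: "r1 \<longlonglongrightarrow> 0" "\<And>n. \<bar>\<Phi> M1 n - c * measure M1 A\<bar> \<le> r1 n + c * measure M1 (V - A)"
    unfolding \<Phi>_def using smoothed_measure_error[OF fin(1) sets(1) A U(1) V AU UV e c] by blast
  obtain r2 where r2: "r2 \<longlonglongrightarrow> 0" "\<And>n. \<bar>\<Phi> M2 n - c * measure M2 A\<bar> \<le> r2 n + c * measure M2 (V - A)"
    unfolding \<Phi>_def using smoothed_measure_error[OF fin(2) sets(2) A U(1) V AU UV e c] by blast
  obtain r3 where r3: "r3 \<longlonglongrightarrow> 0" "\<And>n. \<bar>\<Phi> M3 n - c * measure M3 A\<bar> \<le> r3 n + c * measure M3 (V - A)"
    unfolding \<Phi>_def using smoothed_measure_error[OF fin(3) sets(3) A U(1) V AU UV e c] by blast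
  obtain r4 where r4: "r4 \<longlonglongrightarrow> 0" "\<And>n. \<bar>\<Phi> M4 n - c * measure M4 A\<bar> \<le> r4 n + c * measure M4 (V - A)"
    unfolding \<Phi>_def using smoothed_measure_error[OF fin(4) sets(4) A U(1) V AU UV e c] by blast
  define D where "D = c * (measure M1 (V - A) + measure M2 (V - A) + measure M3 (V - A) + measure M4 (V - A))"
  have D0: "0 \<le> D"
    using c0 by (simp add: D_def)
  show ?thesis
  \<comment> \<open>An infinite pairing makes the claim trivial; a finite one allows a limit in the
    reals.\<close>
  proof (cases ?B)
    case (real B)
    have "c * norm (cmeasure_val M1 M2 M3 M4 A) \<le> B + D + (r1 n + r2 n + r3 n + r4 n)" for n
    proof -
      have "of_real c * cmeasure_val M1 M2 M3 M4 A - I n =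
          complex_of_real ((c * measure M1 A - \<Phi> M1 n) - (c * measure M2 A - \<Phi> M2 n)) +
          \<i> * complex_of_real ((c * measure M3 A - \<Phi> M3 n) - (c * measure M4 A - \<Phi> M4 n))"
        by (simp add: cmeasure_val_def I_def algebra_simps)
      also have "norm \<dots> \<le> \<bar>(c * measure M1 A - \<Phi> M1 n) - (c * measure M2 A - \<Phi> M2 n)\<bar> +
          \<bar>(c * measure M3 A - \<Phi> M3 n) - (c * measure M4 A - \<Phi> M4 n)\<bar>"
        by (rule order_trans[OF norm_triangle_ineq]) (simp only: norm_mult norm_of_real norm_ii mult_1_left real_norm_def order_refl)
      also have "\<dots> \<le> (r1 n + r2 n + r3 n + r4 n) + D"
        using r1(2)[of n] r2(2)[of n] r3(2)[of n] r4(2)[of n] unfolding D_def distrib_left by linarith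
      finally have "norm (of_real c * cmeasure_val M1 M2 M3 M4 A - I n) \<le> (r1 n + r2 n + r3 n + r4 n) + D" .
      moreover have "norm (I n) \<le> B"
        using I_le[of n] real by simp
      moreover have "norm (of_real c * cmeasure_val M1 M2 M3 M4 A) = c * norm (cmeasure_val M1 M2 M3 M4 A)"
        using c0 by (simp add: norm_mult)
      ultimately show ?thesis
        using norm_triangle_sub[of "of_real c * cmeasure_val M1 M2 M3 M4 A" "I n"] by linarith
    qed
    moreover have "(\<lambda>n. B + D + (r1 n + r2 n + r3 n + r4 n)) \<longlonglongrightarrow> B + D + (0 + 0 + 0 + 0)"
      by (intro tendsto_intros r1 r2 r3 r4)
    ultimately have "c * norm (cmeasure_val M1 M2 M3 M4 A) \<le> B + D + (0 + 0 + 0 + 0)"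
      by (intro LIMSEQ_le_const) auto
    then show ?thesis
      using real D0 by (simp add: D_def[symmetric] flip: ennreal_plus)
  qed (auto simp: top_unique)
qed

section \<open>Dyadic covers\<close>

text \<open>Rests on floor(t/N) = floor(floor(t)/N) for positive integers N. The corner of a fine
  cube thus determines the corner of the coarser dyadic cube around it, so membership in a coarser
  cube can be tested on the lattice point alone.\<close>

lemma lattice_floor_nested:
  fixes x :: "'a::euclidean_space"
  assumes "k' \<le> k"
  shows "lattice_floor (2 powr real_of_int k' *\<^sub>R x) =
    lattice_floor (2 powr real_of_int (k' - k) *\<^sub>R lattice_floor (2 powr real_of_int k *\<^sub>R x))"
proof -
  define N :: int where "N = 2 ^ nat (k - k')"
  have N: "0 < N"
    by (simp add: N_def)
  have "real_of_int N = 2 powr (real_of_int k - real_of_int k')"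
    using assms by (simp add: N_def powr_realpow[symmetric])
  then have pow: "2 powr real_of_int (k' - k) = 1 / real_of_int N"
      "2 powr real_of_int k' = 2 powr real_of_int k / real_of_int N"
    by (simp_all add: powr_diff)
  have "\<lfloor>2 powr real_of_int k' * t\<rfloor> = \<lfloor>2 powr real_of_int (k' - k) * real_of_int \<lfloor>2 powr real_of_int k * t\<rfloor>\<rfloor>" for t
  proof -
    have "\<lfloor>2 powr real_of_int k' * t\<rfloor> = \<lfloor>(2 powr real_of_int k * t) / real_of_int N\<rfloor>"
      by (simp add: pow)
    also have "\<dots> = \<lfloor>2 powr real_of_int k * t\<rfloor> div N"
      using N by (intro floor_divide_real_eq_div) simp
    also have "\<dots> = \<lfloor>real_of_int \<lfloor>2 powr real_of_int k * t\<rfloor> / real_of_int N\<rfloor>"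
      by (rule floor_divide_of_int_eq[symmetric])
    finally show ?thesis
      unfolding pow by simp
  qed
  then show ?thesis
    by (simp add: euclidean_eq_iff[of "lattice_floor (2 powr real_of_int k' *\<^sub>R x)"])
qed

lemma cube_union_measurable [measurable]:
  "finite S \<Longrightarrow> cube_union r S \<in> sets borel"
proof -
  assume "finite S"
  then have "(\<lambda>x. lattice_floor (r *\<^sub>R x)) -` S \<inter> space borel \<in> sets borel"
    by (intro measurable_sets[where A=borel]) (auto intro: borel_closed finite_imp_closed)
  then show ?thesis
    by (simp add: cube_union_def vimage_def)
qed

lemma dyadic_disjointify:
  fixes Q :: "int \<Rightarrow> 'a::euclidean_space set"
  assumes Ks: "finite Ks"
  obtains S where "\<And>k. S k \<subseteq> Q k"
    "\<And>x. indicator (\<Union>k\<in>Ks. cube_union (2 powr real_of_int k) (Q k)) x =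
      (\<Sum>k\<in>Ks. indicator (cube_union (2 powr real_of_int k) (S k)) x :: real)"
proof
  \<comment> \<open>\<open>S k\<close> keeps the cubes of level \<open>k\<close> that lie in no larger cube of the family.\<close>
  define S where "S k = {n \<in> Q k. \<forall>k'\<in>Ks. k' < k \<longrightarrow> lattice_floor (2 powr real_of_int (k' - k) *\<^sub>R n) \<notin> Q k'}" for k
  show "S k \<subseteq> Q k" for k
    by (auto simp: S_def)
  fix x :: 'a
  define P where "P k \<longleftrightarrow> x \<in> cube_union (2 powr real_of_int k) (Q k)" for k
  have S: "x \<in> cube_union (2 powr real_of_int k) (S k) \<longleftrightarrow> P k \<and> (\<forall>k'\<in>Ks. k' < k \<longrightarrow> \<not> P k')" for k
    using lattice_floor_nested[of _ k x, symmetric] by (auto simp: S_def cube_union_def P_def)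
  show "indicator (\<Union>k\<in>Ks. cube_union (2 powr real_of_int k) (Q k)) x =
      (\<Sum>k\<in>Ks. indicator (cube_union (2 powr real_of_int k) (S k)) x :: real)"
  proof (cases "\<exists>k\<in>Ks. P k")
    case True
    \<comment> \<open>The coarsest level at which x is covered; its cube is the only one containing
      x that is kept.\<close>
    define k0 where "k0 = Min {k\<in>Ks. P k}"
    have "k0 \<in> {k\<in>Ks. P k}"
      unfolding k0_def using True Ks by (intro Min_in) auto
    moreover have "\<And>k. k \<in> Ks \<Longrightarrow> P k \<Longrightarrow> k0 \<le> k"
      unfolding k0_def using Ks by (intro Min_le) auto
    ultimately have "(indicator (cube_union (2 powr real_of_int k) (S k)) x :: real) = (if k = k0 then 1 else 0)"
      if "k \<in> Ks" for k
      using that by (force simp: indicator_def S)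
    then have "(\<Sum>k\<in>Ks. indicator (cube_union (2 powr real_of_int k) (S k)) x :: real) = (\<Sum>k\<in>Ks. if k = k0 then 1 else 0)"
      by (intro sum.cong) auto
    also have "\<dots> = 1"
      using Ks \<open>k0 \<in> {k\<in>Ks. P k}\<close> by simp
    finally show ?thesis
      using True by (auto simp: P_def)
  next
    case False
    then have "(\<Sum>k\<in>Ks. indicator (cube_union (2 powr real_of_int k) (S k)) x :: real) = 0"
      by (intro sum.neutral) (simp add: indicator_def S)
    then show ?thesis
      using False by (auto simp: P_def)
  qed
qed

text \<open>A ball of diameter below 1 projects to each axis into an interval shorter than 1, which
  meets at most two consecutive integer intervals. The function \<open>g\<close> records which of
  the two in each coordinate.\<close>

lemma lattice_floor_ball:
  fixes c :: "'a::euclidean_space"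
  assumes r: "2 * r < 1"
  shows "finite (lattice_floor ` ball c r)" "card (lattice_floor ` ball c r) \<le> 2 ^ DIM('a)"
proof -
  define m where "m b = \<lfloor>c \<bullet> b - r\<rfloor>" for b
  define X where "X = (\<lambda>g. \<Sum>b\<in>Basis. real_of_int (m b + g b) *\<^sub>R b) ` (Basis \<rightarrow>\<^sub>E {0, 1 :: int})"
  have sub: "lattice_floor ` ball c r \<subseteq> X"
  proof
    fix n assume "n \<in> lattice_floor ` ball c r"
    then obtain y where y: "y \<in> ball c r" "n = lattice_floor y"
      by auto
    define g where "g = restrict (\<lambda>b. \<lfloor>y \<bullet> b\<rfloor> - m b) Basis"
    have "\<lfloor>y \<bullet> b\<rfloor> - m b \<in> {0, 1}" if b: "b \<in> Basis" for b
    proof -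
      have "\<bar>(y - c) \<bullet> b\<bar> \<le> norm (y - c)"
        using b by (rule Basis_le_norm)
      also have "\<dots> < r"
        using y by (simp add: dist_norm norm_minus_commute)
      finally have "\<bar>y \<bullet> b - c \<bullet> b\<bar> < r"
        by (simp add: inner_diff_left)
      then have "c \<bullet> b - r < y \<bullet> b" "y \<bullet> b < c \<bullet> b - r + 1"
        using r by linarith+
      then show ?thesis
        unfolding m_def by (simp; linarith)
    qed
    then have "g \<in> Basis \<rightarrow>\<^sub>E {0, 1}"
      by (auto simp: g_def)
    moreover have "n = (\<Sum>b\<in>Basis. real_of_int (m b + g b) *\<^sub>R b)"
      unfolding y lattice_floor_def by (intro sum.cong) (auto simp: g_def)
    ultimately show "n \<in> X"
      by (auto simp: X_def)
  qed
  have fin: "finite (Basis \<rightarrow>\<^sub>E {0, 1 :: int} :: ('a \<Rightarrow> int) set)"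
    by (intro finite_PiE) auto
  then show "finite (lattice_floor ` ball c r)"
    using finite_subset[OF sub] by (simp add: X_def)
  have "card (lattice_floor ` ball c r) \<le> card X"
    using fin sub by (intro card_mono) (auto simp: X_def)
  also have "\<dots> \<le> card (Basis \<rightarrow>\<^sub>E {0, 1 :: int} :: ('a \<Rightarrow> int) set)"
    unfolding X_def by (rule card_image_le[OF fin])
  also have "\<dots> = 2 ^ DIM('a)"
    by (simp add: card_PiE numeral_2_eq_2)
  finally show "card (lattice_floor ` ball c r) \<le> 2 ^ DIM('a)" .
qed

lemma dist_same_cube:
  fixes x y :: "'a::euclidean_space"
  assumes "0 < r" "lattice_floor (r *\<^sub>R x) = lattice_floor (r *\<^sub>R y)"
  shows "dist x y \<le> real DIM('a) / r"
proof -
  have "norm (r *\<^sub>R x - r *\<^sub>R y) \<le> (\<Sum>b\<in>Basis. \<bar>(r *\<^sub>R x - r *\<^sub>R y) \<bullet> b\<bar>)"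
    by (rule norm_le_l1)
  also have "\<dots> \<le> (\<Sum>b\<in>(Basis :: 'a set). 1)"
  proof (rule sum_mono)
    fix b :: 'a assume "b \<in> Basis"
    then have "\<lfloor>(r *\<^sub>R x) \<bullet> b\<rfloor> = \<lfloor>(r *\<^sub>R y) \<bullet> b\<rfloor>"
      using arg_cong[OF assms(2), of "\<lambda>z. z \<bullet> b"] by simp
    then show "\<bar>(r *\<^sub>R x - r *\<^sub>R y) \<bullet> b\<bar> \<le> 1"
      unfolding inner_diff_left by linarith
  qed
  also have "norm (r *\<^sub>R x - r *\<^sub>R y) = r * dist x y"
    using assms(1) by (simp add: dist_norm scaleR_diff_right[symmetric])
  finally show ?thesis
    using assms(1) by (simp add: field_simps)
qed

section \<open>Covers of bounded cost and their dual norms\<close>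

lemma Holder_inequality_sum:
  fixes a c :: "'i \<Rightarrow> real"
  assumes I: "finite I" and q: "1 < q" "1 < q'" "1 / q' + 1 / q = 1"
    and a: "\<And>i. i \<in> I \<Longrightarrow> 0 \<le> a i" and c: "\<And>i. i \<in> I \<Longrightarrow> 0 \<le> c i"
  shows "(\<Sum>i\<in>I. a i * c i) \<le> (\<Sum>i\<in>I. a i powr q') powr (1 / q') * (\<Sum>i\<in>I. c i powr q) powr (1 / q)"
proof -
  define X where "X = (\<Sum>i\<in>I. a i powr q')"
  define Y where "Y = (\<Sum>i\<in>I. c i powr q)"
  have XY: "0 \<le> X" "0 \<le> Y"
    by (auto simp: X_def Y_def intro: sum_nonneg)
  show ?thesis
  proof (cases "X = 0 \<or> Y = 0")
    case True
    then have "(\<forall>i\<in>I. a i powr q' = 0) \<or> (\<forall>i\<in>I. c i powr q = 0)"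
      unfolding X_def Y_def using I by (subst (asm) (1 2) sum_nonneg_eq_0_iff) auto
    then have "(\<Sum>i\<in>I. a i * c i) = 0"
      by (intro sum.neutral) auto
    then show ?thesis
      by simp
  next
    case False
    then have pos: "0 < X" "0 < Y"
      using XY by auto
    define x where "x = X powr (1 / q')"
    define y where "y = Y powr (1 / q)"
    have xy: "0 < x" "0 < y" "x powr q' = X" "y powr q = Y"
      using pos q by (auto simp: x_def y_def powr_powr)
    have "(\<Sum>i\<in>I. a i / x * (c i / y)) \<le> (\<Sum>i\<in>I. (a i / x) powr q' / q' + (c i / y) powr q / q)"
      using a c xy q by (intro sum_mono Youngs_inequality) auto
    also have "\<dots> = (\<Sum>i\<in>I. a i powr q' / X / q' + c i powr q / Y / q)"
      using a c xy by (intro sum.cong refl) (simp add: powr_divide)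
    also have "\<dots> = (\<Sum>i\<in>I. a i powr q') / X / q' + (\<Sum>i\<in>I. c i powr q) / Y / q"
      by (simp only: sum.distrib sum_divide_distrib)
    also have "\<dots> = 1"
      using pos q by (simp add: X_def[symmetric] Y_def[symmetric])
    also have "(\<Sum>i\<in>I. a i / x * (c i / y)) = (\<Sum>i\<in>I. a i * c i) / (x * y)"
      by (simp add: sum_divide_distrib)
    finally have "(\<Sum>i\<in>I. a i * c i) \<le> x * y"
      using xy by (simp add: field_simps)
    then show ?thesis
      by (simp add: x_def y_def X_def Y_def)
  qed
qed

lemma mem_dyadic_Delta:
  assumes "0 < D"
  shows "D \<in> dyadic_Delta (- \<lfloor>log 2 D\<rfloor> - 1)"
proof -
  have "2 powr real_of_int \<lfloor>log 2 D\<rfloor> \<le> 2 powr log 2 D"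
    by (intro powr_mono) auto
  moreover have "2 powr log 2 D < 2 powr (real_of_int \<lfloor>log 2 D\<rfloor> + 1)"
    by (intro powr_less_mono) linarith+
  ultimately show ?thesis
    using assms by (simp add: dyadic_Delta_def add.commute)
qed

lemma nn_integral_count_space_subset_le:
  assumes "X \<subseteq> Y"
  shows "(\<integral>\<^sup>+x. f x \<partial>count_space X) \<le> (\<integral>\<^sup>+x. f x \<partial>count_space Y)"
proof -
  have "(\<integral>\<^sup>+x. f x \<partial>count_space X) = (\<integral>\<^sup>+x. f x * indicator X x \<partial>count_space UNIV)"
    by (rule nn_integral_count_space_indicator) simp
  also have "\<dots> \<le> (\<integral>\<^sup>+x. f x * indicator Y x \<partial>count_space UNIV)"
    using assms by (intro nn_integral_mono) (auto split: split_indicator)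
  also have "\<dots> = (\<integral>\<^sup>+x. f x \<partial>count_space Y)"
    by (rule nn_integral_count_space_indicator[symmetric]) simp
  finally show ?thesis .
qed

lemma epowr_mono: "0 \<le> b \<Longrightarrow> x \<le> y \<Longrightarrow> epowr x b \<le> epowr y b"
  by (cases x; cases y) (auto simp: epowr_def top_unique intro!: ennreal_leI powr_mono2)

text \<open>Balls are open, so compactness leaves a finite cover, and discarding balls only lowers
  the cost. The bound on the cost is the same for every \<delta>.\<close>

lemma NH_cap_finite_subcover:
  fixes A :: "'a::euclidean_space set"
  assumes A: "compact A" and cap: "NH_cap \<alpha> \<beta> A < \<infinity>" and \<delta>: "0 < \<delta>" and \<beta>: "0 \<le> \<beta>"
  obtains \<F> where "finite \<F>" "A \<subseteq> \<Union>\<F>"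
    "\<forall>B\<in>\<F>. (\<exists>c r. r > 0 \<and> B = ball c r) \<and> diameter B < \<delta> \<and> B \<inter> A \<noteq> {}"
    "\<beta> = \<infinity> \<longrightarrow> (\<forall>k. (\<Sum>B | B \<in> \<F> \<and> diameter B \<in> dyadic_Delta k. diameter B powr \<alpha>) \<le> enn2real (NH_cap \<alpha> \<beta> A) + 1)"
    "\<beta> \<noteq> \<infinity> \<longrightarrow> (\<forall>Ks. finite Ks \<longrightarrow>
      (\<Sum>k\<in>Ks. (\<Sum>B | B \<in> \<F> \<and> diameter B \<in> dyadic_Delta k. diameter B powr \<alpha>) powr real_of_ereal \<beta>) \<le> enn2real (NH_cap \<alpha> \<beta> A) + 1)"
proof -
  \<comment> \<open>The slack 1 puts \<open>H\<close> strictly above the infimum, so a cover of cost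
    below \<open>H\<close> exists.\<close>
  define H where "H = enn2real (NH_cap \<alpha> \<beta> A) + 1"
  have "NH_cap_delta \<alpha> \<beta> A \<delta> \<le> NH_cap \<alpha> \<beta> A"
    unfolding NH_cap_def using \<delta> by (intro SUP_upper) auto
  also have "\<dots> < ennreal H"
    using cap by (cases "NH_cap \<alpha> \<beta> A") (auto simp: H_def ennreal_less_iff)
  finally obtain \<B> where \<B>: "ball_cover A \<delta> \<B>" and cost: "NH_cost \<alpha> \<beta> \<B> < ennreal H"
    unfolding NH_cap_delta_def INF_less_iff by auto
  have H: "0 \<le> H"
    by (simp add: H_def)
  obtain \<F>0 where \<F>0: "\<F>0 \<subseteq> \<B>" "finite \<F>0" "A \<subseteq> \<Union>\<F>0"
  proof (rule compactE[OF A, of \<B>])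
    show "A \<subseteq> \<Union>\<B>" "\<And>B. B \<in> \<B> \<Longrightarrow> open B"
      using \<B> by (auto simp: ball_cover_def)
  qed
  \<comment> \<open>Dropping the balls that miss \<open>A\<close> keeps the union within distance
    \<delta> of \<open>A\<close>.\<close>
  define \<F> where "\<F> = {B\<in>\<F>0. B \<inter> A \<noteq> {}}"
  have fin: "finite \<F>"
    using \<F>0 by (simp add: \<F>_def)
  define s where "s k = (\<Sum>B | B \<in> \<F> \<and> diameter B \<in> dyadic_Delta k. diameter B powr \<alpha>)" for k
  have s0: "0 \<le> s k" for k
    by (auto simp: s_def intro: sum_nonneg)
  define S where "S k = (\<integral>\<^sup>+B. ennreal (diameter B powr \<alpha>) \<partial>count_space {B\<in>\<B>. diameter B \<in> dyadic_Delta k})" for k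
  have sS: "ennreal (s k) \<le> S k" for k
  proof -
    have "ennreal (s k) = (\<integral>\<^sup>+B. ennreal (diameter B powr \<alpha>) \<partial>count_space {B\<in>\<F>. diameter B \<in> dyadic_Delta k})"
      using fin by (simp add: s_def nn_integral_count_space_finite sum_ennreal)
    also have "\<dots> \<le> S k"
      unfolding S_def using \<F>0 by (intro nn_integral_count_space_subset_le) (auto simp: \<F>_def)
    finally show ?thesis .
  qed
  show thesis
  proof (rule that[OF fin])
    show "A \<subseteq> \<Union>\<F>"
      using \<F>0 by (fastforce simp: \<F>_def)
    show "\<forall>B\<in>\<F>. (\<exists>c r. r > 0 \<and> B = ball c r) \<and> diameter B < \<delta> \<and> B \<inter> A \<noteq> {}"
      using \<F>0 \<B> by (auto simp: \<F>_def ball_cover_def)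
    have "(\<Sum>B | B \<in> \<F> \<and> diameter B \<in> dyadic_Delta k. diameter B powr \<alpha>) \<le> enn2real (NH_cap \<alpha> \<beta> A) + 1"
      if "\<beta> = \<infinity>" for k
    proof -
      have "ennreal (s k) \<le> (SUP k. S k)"
        using sS by (rule order_trans) (rule SUP_upper, simp)
      also have "\<dots> = NH_cost \<alpha> \<beta> \<B>"
        using that by (simp add: NH_cost_def S_def Let_def)
      finally have "ennreal (s k) \<le> ennreal H"
        using cost by simp
      then have "s k \<le> H"
        using H by (simp only: ennreal_le_iff)
      then show ?thesis
        by (simp only: s_def H_def)
    qed
    then show "\<beta> = \<infinity> \<longrightarrow> (\<forall>k. (\<Sum>B | B \<in> \<F> \<and> diameter B \<in> dyadic_Delta k. diameter B powr \<alpha>) \<le> enn2real (NH_cap \<alpha> \<beta> A) + 1)"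
      by blast
    have "(\<Sum>k\<in>Ks. (\<Sum>B | B \<in> \<F> \<and> diameter B \<in> dyadic_Delta k. diameter B powr \<alpha>) powr real_of_ereal \<beta>) \<le> enn2real (NH_cap \<alpha> \<beta> A) + 1"
      if "\<beta> \<noteq> \<infinity>" "finite Ks" for Ks
    proof -
      have "ennreal (\<Sum>k\<in>Ks. s k powr real_of_ereal \<beta>) = (\<Sum>k\<in>Ks. epowr (ennreal (s k)) (real_of_ereal \<beta>))"
        using s0 by (simp add: epowr_def sum_ennreal)
      also have "\<dots> \<le> (\<Sum>k\<in>Ks. epowr (S k) (real_of_ereal \<beta>))"
        using sS \<beta> by (intro sum_mono epowr_mono) (auto simp: real_of_ereal_pos)
      also have "\<dots> = (\<integral>\<^sup>+k. epowr (S k) (real_of_ereal \<beta>) \<partial>count_space Ks)"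
        using that by (simp add: nn_integral_count_space_finite)
      also have "\<dots> \<le> (\<integral>\<^sup>+k. epowr (S k) (real_of_ereal \<beta>) \<partial>count_space UNIV)"
        by (intro nn_integral_count_space_subset_le) simp
      also have "\<dots> = NH_cost \<alpha> \<beta> \<B>"
        using that by (simp add: NH_cost_def S_def Let_def)
      finally have "ennreal (\<Sum>k\<in>Ks. s k powr real_of_ereal \<beta>) \<le> ennreal H"
        using cost by simp
      then have "(\<Sum>k\<in>Ks. s k powr real_of_ereal \<beta>) \<le> H"
        using H by (simp only: ennreal_le_iff)
      then show ?thesis
        by (simp only: s_def H_def)
    qed
    then show "\<beta> \<noteq> \<infinity> \<longrightarrow> (\<forall>Ks. finite Ks \<longrightarrow>
      (\<Sum>k\<in>Ks. (\<Sum>B | B \<in> \<F> \<and> diameter B \<in> dyadic_Delta k. diameter B powr \<alpha>) powr real_of_ereal \<beta>) \<le> enn2real (NH_cap \<alpha> \<beta> A) + 1)"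
      by blast
  qed
qed

text \<open>Supplies the duality condition of \<open>lorentz_pairing_bound\<close> from the cost of
  a cover. Since the square of a_i is at most C s_i, the power q' of a_i becomes the power q'/2 of
  s_i. For q = 1 the dual norm is a supremum.\<close>

lemma sum_mult_le_dual:
  fixes a c s :: "'i \<Rightarrow> real"
  assumes I: "finite I" and q: "1 \<le> q" and C: "0 \<le> C" and H: "0 \<le> H"
    and a: "\<And>i. i \<in> I \<Longrightarrow> 0 \<le> a i" "\<And>i. i \<in> I \<Longrightarrow> (a i)\<^sup>2 \<le> C * s i" and c: "\<And>i. 0 \<le> c i"
    and s: "\<And>i. i \<in> I \<Longrightarrow> 0 \<le> s i"
    and s1: "q = 1 \<Longrightarrow> (\<And>i. i \<in> I \<Longrightarrow> s i \<le> H)"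
    and s2: "q \<noteq> 1 \<Longrightarrow> (\<Sum>i\<in>I. s i powr (q / (q - 1) / 2)) \<le> H"
  shows "(\<Sum>i\<in>I. a i * c i) \<le>
    (if q = 1 then sqrt (C * H) else (C powr (q / (q - 1) / 2) * H) powr (1 / (q / (q - 1)))) *
      (\<Sum>i\<in>I. c i powr q) powr (1 / q)"
proof (cases "q = 1")
  case True
  have "a i \<le> sqrt (C * H)" if "i \<in> I" for i
  proof (rule real_le_rsqrt)
    have "C * s i \<le> C * H"
      using s1[OF True that] C by (intro mult_left_mono) auto
    then show "(a i)\<^sup>2 \<le> C * H"
      using a(2)[OF that] by linarith
  qed
  then have "(\<Sum>i\<in>I. a i * c i) \<le> (\<Sum>i\<in>I. sqrt (C * H) * c i)"
    using c by (intro sum_mono mult_right_mono) auto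
  then show ?thesis
    using True c by (simp add: sum_distrib_left[symmetric] sum_nonneg)
next
  case False
  define q' where "q' = q / (q - 1)"
  have q': "1 < q" "1 < q'" "1 / q' + 1 / q = 1"
    using q False by (auto simp: q'_def field_simps)
  have pw: "a i powr q' \<le> C powr (q' / 2) * s i powr (q' / 2)" if "i \<in> I" for i
  proof -
    have "a i powr q' = ((a i)\<^sup>2) powr (q' / 2)"
      using a(1)[OF that] by (cases "a i = 0") (simp_all add: powr_powr flip: powr_numeral)
    also have "\<dots> \<le> (C * s i) powr (q' / 2)"
      using a(2)[OF that] q' by (intro powr_mono2) auto
    also have "\<dots> = C powr (q' / 2) * s i powr (q' / 2)"
      using C s[OF that] by (simp add: powr_mult)
    finally show ?thesis .
  qed
  have "(\<Sum>i\<in>I. a i powr q') \<le> (\<Sum>i\<in>I. C powr (q' / 2) * s i powr (q' / 2))"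
    by (intro sum_mono pw)
  also have "\<dots> \<le> C powr (q' / 2) * H"
    unfolding sum_distrib_left[symmetric] using s2[OF False] by (intro mult_left_mono) (auto simp: q'_def)
  finally have sum_le: "(\<Sum>i\<in>I. a i powr q') \<le> C powr (q' / 2) * H" .
  have "(\<Sum>i\<in>I. a i * c i) \<le> (\<Sum>i\<in>I. a i powr q') powr (1 / q') * (\<Sum>i\<in>I. c i powr q) powr (1 / q)"
    using I q' a c by (intro Holder_inequality_sum) auto
  also have "\<dots> \<le> (C powr (q' / 2) * H) powr (1 / q') * (\<Sum>i\<in>I. c i powr q) powr (1 / q)"
    using q' sum_le by (intro mult_right_mono powr_mono2) (auto intro: sum_nonneg)
  finally show ?thesis
    using False by (simp add: q'_def)
qed

section \<open>From balls to disjoint dyadic cubes\<close>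

text \<open>A ball with diameter in \<open>dyadic_Delta k\<close> is smaller than the cubes of level
  k, so it meets at most 2^d of them. The factor 2^\<alpha> compensates for diameters as small as
  2^(-k-1), and passing to maximal cubes only decreases the counts.\<close>

lemma dyadic_cover:
  fixes A :: "'a::euclidean_space set"
  assumes fin: "finite \<F>" and cov: "A \<subseteq> \<Union>\<F>" and \<alpha>: "0 \<le> \<alpha>"
    and balls0: "\<forall>B\<in>\<F>. (\<exists>c r. r > 0 \<and> B = ball c r) \<and> diameter B < 2 powr (- real K) \<and> B \<inter> A \<noteq> {}"
  obtains Ks S U where "finite Ks" "\<forall>k\<in>Ks. int K \<le> k"
    "\<forall>k. finite (S k) \<and> S k \<subseteq> int_lattice"
    "\<forall>k. card (S k) * 2 powr (- real_of_int k * \<alpha>) \<le>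
      2 ^ DIM('a) * 2 powr \<alpha> * (\<Sum>B | B \<in> \<F> \<and> diameter B \<in> dyadic_Delta k. diameter B powr \<alpha>)"
    "\<forall>x. indicator U x = (\<Sum>k\<in>Ks. indicator (cube_union (2 powr real_of_int k) (S k)) x :: real)"
    "U \<in> sets borel" "A \<subseteq> interior U"
    "\<forall>x\<in>U. infdist x A \<le> (real DIM('a) + 1) * 2 powr (- real K)"
proof -
  note balls = bspec[OF balls0]
  define \<F>' where "\<F>' k = {B. B \<in> \<F> \<and> diameter B \<in> dyadic_Delta k}" for k
  have fin': "finite (\<F>' k)" for k
    using fin by (simp add: \<F>'_def)
  \<comment> \<open>The index of the dyadic class that contains the diameter, as in
    \<open>mem_dyadic_Delta\<close>.\<close>
  define lev where "lev B = - \<lfloor>log 2 (diameter B)\<rfloor> - 1" for B :: "'a set"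
  define Ks where "Ks = lev ` \<F>"
  define Q where "Q k = (\<Union>B\<in>\<F>' k. (\<lambda>x. lattice_floor (2 powr real_of_int k *\<^sub>R x)) ` B)" for k
  have Q1: "finite ((\<lambda>x. lattice_floor (2 powr real_of_int k *\<^sub>R x)) ` B) \<and>
      card ((\<lambda>x. lattice_floor (2 powr real_of_int k *\<^sub>R x)) ` B) \<le> 2 ^ DIM('a)" if B: "B \<in> \<F>' k" for k B
  proof -
    obtain c r where cr: "r > 0" "B = ball c r"
      using B balls[of B] by (auto simp: \<F>'_def)
    define t where "t = 2 powr real_of_int k"
    have t: "0 < t"
      by (simp add: t_def)
    have "2 * r < 2 powr (- real_of_int k)"
      using B cr by (auto simp: \<F>'_def dyadic_Delta_def)
    then have "2 * (t * r) < t * 2 powr (- real_of_int k)"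
      using t by simp
    also have "\<dots> = 1"
      by (simp add: t_def powr_add[symmetric])
    finally have small: "2 * (t * r) < 1" .
    have sub: "(\<lambda>x. lattice_floor (t *\<^sub>R x)) ` B \<subseteq> lattice_floor ` ball (t *\<^sub>R c) (t * r)"
    proof safe
      fix x assume "x \<in> B"
      then have "t *\<^sub>R x \<in> ball (t *\<^sub>R c) (t * r)"
        using t cr by (simp add: dist_norm scaleR_diff_right[symmetric])
      then show "lattice_floor (t *\<^sub>R x) \<in> lattice_floor ` ball (t *\<^sub>R c) (t * r)"
        by blast
    qed
    note fb = lattice_floor_ball[OF small, of "t *\<^sub>R c"]
    show ?thesis
      unfolding t_def[symmetric] using finite_subset[OF sub fb(1)] card_mono[OF fb(1) sub] fb(2) by linarith
  qed
  have Q_fin: "finite (Q k)" for k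
    unfolding Q_def using fin' Q1 by blast
  have Q_card: "card (Q k) \<le> 2 ^ DIM('a) * card (\<F>' k)" for k
  proof -
    have "card (Q k) \<le> (\<Sum>B\<in>\<F>' k. card ((\<lambda>x. lattice_floor (2 powr real_of_int k *\<^sub>R x)) ` B))"
      unfolding Q_def by (rule card_UN_le[OF fin'])
    also have "\<dots> \<le> (\<Sum>B\<in>\<F>' k. 2 ^ DIM('a))"
      using Q1 by (intro sum_mono) auto
    finally show ?thesis
      by (simp add: mult.commute)
  qed
  have Q_lat: "Q k \<subseteq> int_lattice" for k
    by (auto simp: Q_def)
  have Ks_fin: "finite Ks"
    using fin by (simp add: Ks_def)
  define U where "U = (\<Union>k\<in>Ks. cube_union (2 powr real_of_int k) (Q k))"
  obtain S where S: "\<And>k. S k \<subseteq> Q k"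
    and ind: "\<And>x. indicator U x = (\<Sum>k\<in>Ks. indicator (cube_union (2 powr real_of_int k) (S k)) x :: real)"
    unfolding U_def using dyadic_disjointify[OF Ks_fin, of Q] by blast
  have lev: "diameter B \<in> dyadic_Delta (lev B)" "int K \<le> lev B" if B: "B \<in> \<F>" for B
  proof -
    obtain c r where cr: "r > 0" "B = ball c r"
      using balls[OF B] by auto
    show 1: "diameter B \<in> dyadic_Delta (lev B)"
      unfolding lev_def using cr by (intro mem_dyadic_Delta) simp
    \<comment> \<open>Only the lower end of the dyadic class is available here, giving lev B + 1 >
      K; integrality then yields lev B at least K.\<close>
    have "2 powr (- real_of_int (lev B) - 1) < 2 powr (- real K)"
      by (rule le_less_trans[of _ "diameter B"]) (use 1 balls[OF B] in \<open>simp_all add: dyadic_Delta_def\<close>)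
    then have "- real_of_int (lev B) - 1 < - real K"
      by (simp add: powr_less_cancel_iff)
    then show "int K \<le> lev B"
      by linarith
  qed
  show thesis
  proof (rule that[of Ks S U])
    show "finite Ks"
      by fact
    show K_le: "\<forall>k\<in>Ks. int K \<le> k"
      using lev by (auto simp: Ks_def)
    show "\<forall>k. finite (S k) \<and> S k \<subseteq> int_lattice"
      using S Q_fin Q_lat finite_subset by blast
    have "card (S k) * 2 powr (- real_of_int k * \<alpha>) \<le>
      2 ^ DIM('a) * 2 powr \<alpha> * (\<Sum>B | B \<in> \<F> \<and> diameter B \<in> dyadic_Delta k. diameter B powr \<alpha>)" for k
    proof -
      have "card (S k) \<le> 2 ^ DIM('a) * card (\<F>' k)"
        using card_mono[OF Q_fin S, of k] Q_card[of k] by linarith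
      from of_nat_mono[OF this, where 'a=real]
      have le: "real (card (S k)) \<le> 2 ^ DIM('a) * real (card (\<F>' k))"
        by simp
      have "real (card (\<F>' k)) * (2 powr (- real_of_int k - 1)) powr \<alpha> = (\<Sum>B\<in>\<F>' k. (2 powr (- real_of_int k - 1)) powr \<alpha>)"
        by simp
      also have "\<dots> \<le> (\<Sum>B\<in>\<F>' k. diameter B powr \<alpha>)"
        using \<alpha> by (intro sum_mono powr_mono2) (auto simp: \<F>'_def dyadic_Delta_def)
      finally have sum: "real (card (\<F>' k)) * (2 powr (- real_of_int k - 1)) powr \<alpha> \<le> (\<Sum>B\<in>\<F>' k. diameter B powr \<alpha>)" .
      have pw: "2 powr (- real_of_int k * \<alpha>) = 2 powr \<alpha> * (2 powr (- real_of_int k - 1)) powr \<alpha>"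
        by (simp add: powr_powr powr_add[symmetric] algebra_simps)
      have "card (S k) * 2 powr (- real_of_int k * \<alpha>) \<le> 2 ^ DIM('a) * real (card (\<F>' k)) * 2 powr (- real_of_int k * \<alpha>)"
        using le by (intro mult_right_mono) auto
      also have "\<dots> = 2 ^ DIM('a) * 2 powr \<alpha> * (real (card (\<F>' k)) * (2 powr (- real_of_int k - 1)) powr \<alpha>)"
        unfolding pw by (simp only: mult_ac)
      also have "\<dots> \<le> 2 ^ DIM('a) * 2 powr \<alpha> * (\<Sum>B\<in>\<F>' k. diameter B powr \<alpha>)"
        using sum by (intro mult_left_mono) auto
      finally show ?thesis
        by (simp add: \<F>'_def)
    qed
    then show "\<forall>k. card (S k) * 2 powr (- real_of_int k * \<alpha>) \<le>
      2 ^ DIM('a) * 2 powr \<alpha> * (\<Sum>B | B \<in> \<F> \<and> diameter B \<in> dyadic_Delta k. diameter B powr \<alpha>)"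
      by blast
    show "\<forall>x. indicator U x = (\<Sum>k\<in>Ks. indicator (cube_union (2 powr real_of_int k) (S k)) x :: real)"
      using ind by blast
    show "U \<in> sets borel"
      unfolding U_def using Ks_fin Q_fin by (intro sets.finite_UN) (auto intro: cube_union_measurable)
    have "\<Union>\<F> \<subseteq> U"
    proof
      fix x assume "x \<in> \<Union>\<F>"
      then obtain B where "B \<in> \<F>" "x \<in> B"
        by auto
      then show "x \<in> U"
        using lev(1)[of B] by (auto simp: U_def Ks_def cube_union_def Q_def \<F>'_def)
    qed
    moreover have "open (\<Union>\<F>)"
      using balls by (intro open_Union) auto
    ultimately show "A \<subseteq> interior U"
      using cov interior_maximal by blast
    show "\<forall>x\<in>U. infdist x A \<le> (real DIM('a) + 1) * 2 powr (- real K)"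
    proof
      \<comment> \<open>The cube around x also contains a point y of some ball B, and B contains a
        point z of \<open>A\<close>. The cube contributes d 2^(-k) to the distance, the ball its
        diameter.\<close>
      fix x assume "x \<in> U"
      then obtain k B y where k: "k \<in> Ks" and B: "B \<in> \<F>" "y \<in> B"
        and xy: "lattice_floor (2 powr real_of_int k *\<^sub>R x) = lattice_floor (2 powr real_of_int k *\<^sub>R y)"
        by (auto simp: U_def cube_union_def Q_def \<F>'_def)
      obtain z where z: "z \<in> B" "z \<in> A"
        using balls[OF B(1)] by auto
      have "dist x y \<le> real DIM('a) / 2 powr real_of_int k"
        using xy by (intro dist_same_cube) auto
      also have "\<dots> = real DIM('a) * 2 powr (- real_of_int k)"
        by (simp add: powr_minus divide_inverse)
      also have "\<dots> \<le> real DIM('a) * 2 powr (- real K)"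
        using bspec[OF K_le k] by (intro mult_left_mono powr_mono) auto
      finally have 1: "dist x y \<le> real DIM('a) * 2 powr (- real K)" .
      have "bounded B"
        using balls[OF B(1)] by auto
      then have "dist y z \<le> diameter B"
        using B z by (intro diameter_bounded_bound) auto
      then have 2: "dist y z \<le> 2 powr (- real K)"
        using balls[OF B(1)] by linarith
      have "infdist x A \<le> dist x z"
        by (rule infdist_le[OF z(2)])
      also have "\<dots> \<le> dist x y + dist y z"
        by (rule dist_triangle)
      finally show "infdist x A \<le> (real DIM('a) + 1) * 2 powr (- real K)"
        using 1 2 by (simp add: distrib_right)
    qed
  qed
qed

section \<open>Vanishing on sets of finite capacity\<close>

text \<open>The closed neighbourhoods shrink to \<open>A\<close> because \<open>A\<close> is closed,
  so continuity from above applies to the differences. The empty set is excluded because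
  \<open>infdist\<close> to it is 0 everywhere.\<close>

lemma measure_neighbourhood_tendsto_0:
  fixes A :: "'a::euclidean_space set"
  assumes M: "finite_measure M" and sets: "sets M = sets borel" and A: "closed A" "A \<noteq> {}"
    and \<rho>: "\<rho> \<longlonglongrightarrow> 0" "decseq \<rho>"
  shows "(\<lambda>n. measure M ({x. infdist x A \<le> \<rho> n} - A)) \<longlonglongrightarrow> 0"
proof -
  interpret finite_measure M by fact
  define W where "W n = {x. infdist x A \<le> \<rho> n} - A" for n
  have cl: "closed {x. infdist x A \<le> r}" for r
    by (intro closed_Collect_le continuous_intros)
  have "W n \<in> sets M" for n
    using A by (simp add: W_def sets borel_closed cl sets.Diff)
  moreover have "decseq W"
    using \<rho>(2) by (fastforce simp: W_def decseq_def intro: order_trans)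
  ultimately have "(\<lambda>n. measure M (W n)) \<longlonglongrightarrow> measure M (\<Inter>n. W n)"
    by (intro finite_Lim_measure_decseq) auto
  also have "(\<Inter>n. W n) = {}"
  proof (rule ccontr)
    assume "(\<Inter>n. W n) \<noteq> {}"
    then obtain x where x: "\<And>n. infdist x A \<le> \<rho> n" "x \<notin> A"
      by (auto simp: W_def)
    then have "infdist x A \<le> 0"
      using \<rho>(1) by (intro LIMSEQ_le_const) auto
    then have "infdist x A = 0"
      using infdist_nonneg[of x A] by linarith
    then show False
      using A x(2) in_closed_iff_infdist_zero by blast
  qed
  finally show ?thesis
    by (simp add: W_def)
qed

lemma cmeasure_val_compact_eq_0:
  fixes M1 M2 M3 M4 :: "'a::euclidean_space measure"
  assumes p: "2 < p" and q: "1 \<le> q"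
    and sets: "sets M1 = sets borel" "sets M2 = sets borel" "sets M3 = sets borel" "sets M4 = sets borel"
    and fin: "finite_measure M1" "finite_measure M2" "finite_measure M3" "finite_measure M4"
    and lor: "in_lorentz p q (cmeasure_fourier M1 M2 M3 M4)"
    and A: "compact A"
    and cap: "NH_cap (2 * real DIM('a) / p) (dual_exp q / 2) A < \<infinity>"
  shows "cmeasure_val M1 M2 M3 M4 A = 0"
proof (cases "A = {}")
  \<comment> \<open>Treated separately because the neighbourhoods used below are defined by
    \<open>infdist\<close>.\<close>
  case True
  then show ?thesis
    by (simp add: cmeasure_val_def)
next
  case False
  define \<alpha> where "\<alpha> = 2 * real DIM('a) / p"
  have \<alpha>: "0 \<le> \<alpha>"
    using p by (simp add: \<alpha>_def)
  define \<beta> where "\<beta> = dual_exp q / 2"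
  have \<beta>_top: "\<beta> = \<infinity> \<longleftrightarrow> q = 1" and \<beta>_real: "q \<noteq> 1 \<Longrightarrow> real_of_ereal \<beta> = q / (q - 1) / 2" and \<beta>0: "0 \<le> \<beta>"
    using q by (auto simp: \<beta>_def dual_exp_def)
  define H0 where "H0 = enn2real (NH_cap \<alpha> \<beta> A) + 1"
  define C0 :: real where "C0 = 2 ^ DIM('a) * 2 powr \<alpha>"
  have C0: "0 \<le> C0" and H0: "0 \<le> H0"
    by (auto simp: C0_def H0_def)
  \<comment> \<open>The constant of \<open>sum_mult_le_dual\<close>. It depends on the capacity of
    \<open>A\<close> but not on the mesh, so multiplying it by \<epsilon> still gives a null
    sequence.\<close>
  define H where "H = (if q = 1 then sqrt (C0 * H0) else (C0 powr (q / (q - 1) / 2) * H0) powr (1 / (q / (q - 1))))"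
  have H: "0 \<le> H"
    using C0 H0 by (simp add: H_def)
  let ?f = "cmeasure_fourier M1 M2 M3 M4"
  obtain \<epsilon> where \<epsilon>: "\<epsilon> \<longlonglongrightarrow> 0"
    and pairing: "\<forall>K Ks S H. finite Ks \<longrightarrow> (\<forall>k\<in>Ks. int K \<le> k) \<longrightarrow>
      (\<forall>k\<in>Ks. finite (S k) \<and> S k \<subseteq> int_lattice) \<longrightarrow> 0 \<le> H \<longrightarrow>
      (\<forall>c. (\<forall>k. 0 \<le> c k) \<longrightarrow>
        (\<Sum>k\<in>Ks. sqrt (card (S k) * 2 powr (- real_of_int k * (2 * real DIM('a) / p))) * c k) \<le>
          H * (\<Sum>k\<in>Ks. c k powr q) powr (1 / q)) \<longrightarrow>
      (\<Sum>k\<in>Ks. \<integral>\<^sup>+\<xi>. ennreal (norm (set_fourier (cube_union (2 powr real_of_int k) (S k)) \<xi>)) *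
        ennreal (norm (?f \<xi>)) \<partial>lborel) \<le> ennreal H * \<epsilon> K"
    using lorentz_pairing_bound[OF p q lor] by (elim exE conjE)
  have f_meas[measurable]: "?f \<in> borel_measurable borel"
    using lor by (simp add: in_lorentz_def)
  define c where "c = (\<integral>y. gauss_kernel (y :: 'a) \<partial>lborel)"
  have c: "0 < c"
    unfolding c_def by (rule integral_gauss_kernel_pos)
  define \<rho> where "\<rho> K = (real DIM('a) + 1) * 2 powr (- real K)" for K
  define V where "V K = {x. infdist x A \<le> \<rho> K}" for K
  define D where "D K = c * (measure M1 (V K - A) + measure M2 (V K - A) + measure M3 (V K - A) + measure M4 (V K - A))" for K
  have main: "ennreal (c * norm (cmeasure_val M1 M2 M3 M4 A)) \<le> ennreal H * \<epsilon> K + ennreal (D K)" for K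
  proof -
    have \<delta>: "(0::real) < 2 powr (- real K)"
      by simp
    obtain \<F> where \<F>: "finite \<F>" "A \<subseteq> \<Union>\<F>"
      "\<forall>B\<in>\<F>. (\<exists>c r. r > 0 \<and> B = ball c r) \<and> diameter B < 2 powr (- real K) \<and> B \<inter> A \<noteq> {}"
      and cost1: "\<beta> = \<infinity> \<longrightarrow> (\<forall>k. (\<Sum>B | B \<in> \<F> \<and> diameter B \<in> dyadic_Delta k. diameter B powr \<alpha>) \<le> H0)"
      and cost2: "\<beta> \<noteq> \<infinity> \<longrightarrow> (\<forall>Ks. finite Ks \<longrightarrow>
        (\<Sum>k\<in>Ks. (\<Sum>B | B \<in> \<F> \<and> diameter B \<in> dyadic_Delta k. diameter B powr \<alpha>) powr real_of_ereal \<beta>) \<le> H0)"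
      unfolding H0_def using NH_cap_finite_subcover[OF A cap[folded \<alpha>_def \<beta>_def] \<delta> \<beta>0] .
    obtain Ks S U where Ks: "finite Ks" "\<forall>k\<in>Ks. int K \<le> k"
      and S: "\<forall>k. finite (S k) \<and> S k \<subseteq> int_lattice"
      and card_le: "\<forall>k. card (S k) * 2 powr (- real_of_int k * \<alpha>) \<le>
        C0 * (\<Sum>B | B \<in> \<F> \<and> diameter B \<in> dyadic_Delta k. diameter B powr \<alpha>)"
      and ind0: "\<forall>x. indicator U x = (\<Sum>k\<in>Ks. indicator (cube_union (2 powr real_of_int k) (S k)) x :: real)"
      and U[measurable]: "U \<in> sets borel" and AU: "A \<subseteq> interior U"
      and UV: "\<forall>x\<in>U. infdist x A \<le> \<rho> K"
      unfolding C0_def \<rho>_def using dyadic_cover[OF \<F>(1,2) \<alpha> \<F>(3)] .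
    note ind = spec[OF ind0]
    have Sk: "finite (S k)" "S k \<subseteq> int_lattice" for k
      using S by auto
    have int: "integrable lborel (\<lambda>y. indicator (cube_union (2 powr real_of_int k) (S k)) y *\<^sub>R cis (2 * pi * (y \<bullet> \<xi>)))" for k \<xi>
      by (rule cube_union_fourier(1)[OF Sk]) simp
    have U_fin: "emeasure lborel U < \<infinity>"
    proof -
      \<comment> \<open>At frequency 0 the Fourier integrand is the indicator itself, so its
        integrability says that the volume is finite.\<close>
      have "integrable lborel (\<lambda>y. indicator (cube_union (2 powr real_of_int k) (S k)) y *\<^sub>R (1 :: complex))" for k
        using int[of k 0] by simp
      then have "integrable lborel (\<lambda>y. Re (indicator (cube_union (2 powr real_of_int k) (S k)) y *\<^sub>R (1 :: complex)))" for k
        by (rule integrable_Re)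
      then have "integrable lborel (indicator (cube_union (2 powr real_of_int k) (S k)) :: 'a \<Rightarrow> real)" for k
        by simp
      then have "integrable lborel (\<lambda>x. indicator U x :: real)"
        unfolding ind by (intro Bochner_Integration.integrable_sum)
      then show ?thesis
        by (simp add: integrable_indicator_iff)
    qed
    have fourier: "set_fourier U \<xi> = (\<Sum>k\<in>Ks. set_fourier (cube_union (2 powr real_of_int k) (S k)) \<xi>)" for \<xi>
      unfolding set_fourier_def ind scaleR_sum_left
      by (intro Bochner_Integration.integral_sum int)
    have "(\<integral>\<^sup>+\<xi>. ennreal (norm (set_fourier U \<xi>)) * ennreal (norm (?f \<xi>)) \<partial>lborel) \<le>
        (\<integral>\<^sup>+\<xi>. (\<Sum>k\<in>Ks. ennreal (norm (set_fourier (cube_union (2 powr real_of_int k) (S k)) \<xi>)) * ennreal (norm (?f \<xi>))) \<partial>lborel)"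
      unfolding sum_distrib_right[symmetric]
      by (intro nn_integral_mono mult_right_mono) (auto simp: fourier sum_ennreal intro!: ennreal_leI norm_sum)
    also have "\<dots> = (\<Sum>k\<in>Ks. \<integral>\<^sup>+\<xi>. ennreal (norm (set_fourier (cube_union (2 powr real_of_int k) (S k)) \<xi>)) * ennreal (norm (?f \<xi>)) \<partial>lborel)"
    proof (rule nn_integral_sum)
      fix k
      have [measurable]: "set_fourier (cube_union (2 powr real_of_int k) (S k)) \<in> borel_measurable borel"
        by (rule set_fourier_cube_union_measurable[OF Sk]) simp
      show "(\<lambda>\<xi>. ennreal (norm (set_fourier (cube_union (2 powr real_of_int k) (S k)) \<xi>)) * ennreal (norm (?f \<xi>))) \<in> borel_measurable lborel"
        by measurable
    qed
    also have "\<dots> \<le> ennreal H * \<epsilon> K"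
    proof (rule pairing[rule_format, OF Ks(1) bspec[OF Ks(2)] spec[OF S] H])
      fix a :: "int \<Rightarrow> real" assume a: "\<And>k. 0 \<le> a k"
      show "(\<Sum>k\<in>Ks. sqrt (card (S k) * 2 powr (- real_of_int k * (2 * real DIM('a) / p))) * a k) \<le>
          H * (\<Sum>k\<in>Ks. a k powr q) powr (1 / q)"
        unfolding H_def \<alpha>_def[symmetric]
      proof (rule sum_mult_le_dual[where s="\<lambda>k. \<Sum>B | B \<in> \<F> \<and> diameter B \<in> dyadic_Delta k. diameter B powr \<alpha>"])
        show "(sqrt (card (S k) * 2 powr (- real_of_int k * \<alpha>)))\<^sup>2 \<le>
            C0 * (\<Sum>B | B \<in> \<F> \<and> diameter B \<in> dyadic_Delta k. diameter B powr \<alpha>)" for k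
          using spec[OF card_le, of k] by simp
        show "(\<Sum>B | B \<in> \<F> \<and> diameter B \<in> dyadic_Delta k. diameter B powr \<alpha>) \<le> H0" if "q = 1" for k
          using cost1 that by (simp add: \<beta>_top)
        show "(\<Sum>k\<in>Ks. (\<Sum>B | B \<in> \<F> \<and> diameter B \<in> dyadic_Delta k. diameter B powr \<alpha>) powr (q / (q - 1) / 2)) \<le> H0" if "q \<noteq> 1"
          using cost2 Ks(1) that \<beta>_real by (simp add: \<beta>_top)
      qed (auto simp: Ks q C0 H0 a intro: sum_nonneg)
    qed auto
    finally have B: "(\<integral>\<^sup>+\<xi>. ennreal (norm (set_fourier U \<xi>)) * ennreal (norm (?f \<xi>)) \<partial>lborel) \<le> ennreal H * \<epsilon> K" .
    have "closed (V K)"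
      unfolding V_def by (intro closed_Collect_le continuous_intros)
    moreover have "U \<subseteq> V K"
      using UV by (auto simp: V_def)
    moreover have "A \<in> sets borel"
      using A by (simp add: borel_compact)
    ultimately have "ennreal (c * norm (cmeasure_val M1 M2 M3 M4 A)) \<le>
        (\<integral>\<^sup>+\<xi>. ennreal (norm (set_fourier U \<xi>)) * ennreal (norm (?f \<xi>)) \<partial>lborel) + ennreal (D K)"
      unfolding D_def by (intro cmeasure_val_le_fourier[OF fin sets _ U U_fin _ AU _ c_def])
    also have "\<dots> \<le> ennreal H * \<epsilon> K + ennreal (D K)"
      using B by (intro add_right_mono)
    finally show ?thesis .
  qed
  have "(\<lambda>K. ennreal H * \<epsilon> K + ennreal (D K)) \<longlonglongrightarrow> ennreal H * 0 + ennreal 0"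
  proof (intro tendsto_add ennreal_tendsto_cmult tendsto_ennrealI \<epsilon>)
    have "(\<lambda>K. (real DIM('a) + 1) * 2 powr (- real K)) \<longlonglongrightarrow> 0"
      by real_asymp
    then have \<rho>0: "\<rho> \<longlonglongrightarrow> 0"
      by (simp add: \<rho>_def[abs_def])
    have dec: "decseq \<rho>"
      unfolding decseq_def \<rho>_def by (intro allI impI mult_left_mono powr_mono) auto
    have lim: "(\<lambda>K. measure M (V K - A)) \<longlonglongrightarrow> 0" if "finite_measure M" "sets M = sets borel" for M :: "'a measure"
      unfolding V_def using A False that \<rho>0 dec by (intro measure_neighbourhood_tendsto_0) (auto simp: compact_imp_closed)
    have "D \<longlonglongrightarrow> c * (0 + 0 + 0 + 0)"
      unfolding D_def[abs_def] using fin sets by (intro tendsto_intros lim)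
    then show "D \<longlonglongrightarrow> 0"
      by simp
  qed simp
  then have "ennreal (c * norm (cmeasure_val M1 M2 M3 M4 A)) \<le> ennreal H * 0 + ennreal 0"
    using main by (intro LIMSEQ_le_const) auto
  then show ?thesis
    using c by (simp add: ennreal_eq_0_iff mult_le_0_iff)
qed

section \<open>Reduction to compact sets\<close>

lemma NH_cap_mono:
  assumes "A \<subseteq> B"
  shows "NH_cap \<alpha> \<beta> A \<le> NH_cap \<alpha> \<beta> B"
  unfolding NH_cap_def NH_cap_delta_def
  using assms by (intro SUP_mono' INF_superset_mono) (auto simp: ball_cover_def subset_eq)

lemma inner_regular_compact:
  fixes M :: "'a::euclidean_space measure"
  assumes M: "finite_measure M" and sets: "sets M = sets borel" and A: "A \<in> sets borel" and e: "0 < e"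
  obtains K where "compact K" "K \<subseteq> A" "measure M A - e < measure M K"
proof -
  interpret finite_measure M by fact
  show thesis
  \<comment> \<open>A negative number becomes 0 in \<open>ennreal\<close>, and 0 need not lie
    strictly below the measure of \<open>A\<close>; in that case the empty set already
    serves.\<close>
  proof (cases "measure M A - e < 0")
    case True
    then show thesis
      by (intro that[of "{}"]) auto
  next
    case False
    have "ennreal (measure M A - e) < emeasure M A"
      using e False by (simp add: emeasure_eq_measure ennreal_less_iff)
    also have "emeasure M A = (SUP K\<in>{K. K \<subseteq> A \<and> compact K}. emeasure M K)"
      using sets A by (intro inner_regular) auto
    finally obtain K where "K \<subseteq> A" "compact K" "ennreal (measure M A - e) < emeasure M K"
      by (auto simp: less_SUP_iff)
    then show thesis
      using False by (intro that[of K]) (auto simp: emeasure_eq_measure ennreal_less_iff)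
  qed
qed

theorem theorem1p8:
  fixes M1 M2 M3 M4 :: "'a::euclidean_space measure"
    and p q :: real and A :: "'a set"
  assumes "2 < p" and "1 \<le> q"
    and "sets M1 = sets borel" "sets M2 = sets borel" "sets M3 = sets borel" "sets M4 = sets borel"
    and "finite_measure M1" "finite_measure M2" "finite_measure M3" "finite_measure M4"
    and "in_lorentz p q (cmeasure_fourier M1 M2 M3 M4)"
    and "A \<in> sets borel"
    and "NH_cap (2 * real DIM('a) / p) (dual_exp q / 2) A < \<infinity>"
  shows "cmeasure_val M1 M2 M3 M4 A = 0"
proof -
  note sets = assms(3-6) and fin = assms(7-10) and A = assms(12)
  have small: "norm (cmeasure_val M1 M2 M3 M4 A) \<le> e" if e: "0 < e" for e
  proof -
    have e4: "0 < e / 4"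
      using e by simp
    obtain K1 where K1: "compact K1" "K1 \<subseteq> A" "measure M1 A - e / 4 < measure M1 K1"
      using inner_regular_compact[OF fin(1) sets(1) A e4] .
    obtain K2 where K2: "compact K2" "K2 \<subseteq> A" "measure M2 A - e / 4 < measure M2 K2"
      using inner_regular_compact[OF fin(2) sets(2) A e4] .
    obtain K3 where K3: "compact K3" "K3 \<subseteq> A" "measure M3 A - e / 4 < measure M3 K3"
      using inner_regular_compact[OF fin(3) sets(3) A e4] .
    obtain K4 where K4: "compact K4" "K4 \<subseteq> A" "measure M4 A - e / 4 < measure M4 K4"
      using inner_regular_compact[OF fin(4) sets(4) A e4] .
    \<comment> \<open>A complex measure is not monotone, so one compact set must approximate
      \<open>A\<close> for all four positive measures at once. The union does, since it stays inside
      \<open>A\<close>; each measure contributes at most e/4.\<close>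
    define K where "K = K1 \<union> K2 \<union> K3 \<union> K4"
    have K: "compact K" "K \<subseteq> A"
      using K1 K2 K3 K4 by (auto simp: K_def intro: compact_Un)
    have "NH_cap (2 * real DIM('a) / p) (dual_exp q / 2) K < \<infinity>"
      using NH_cap_mono[OF K(2)] assms(13) by (rule le_less_trans)
    then have "cmeasure_val M1 M2 M3 M4 K = 0"
      using cmeasure_val_compact_eq_0[OF assms(1,2) sets fin assms(11) K(1)] by simp
    then have "norm (cmeasure_val M1 M2 M3 M4 A) = norm (cmeasure_val M1 M2 M3 M4 A - cmeasure_val M1 M2 M3 M4 K)"
      by simp
    also have "cmeasure_val M1 M2 M3 M4 A - cmeasure_val M1 M2 M3 M4 K =
        complex_of_real ((measure M1 A - measure M1 K) - (measure M2 A - measure M2 K)) +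
        \<i> * complex_of_real ((measure M3 A - measure M3 K) - (measure M4 A - measure M4 K))"
      by (simp add: cmeasure_val_def algebra_simps)
    also have "norm \<dots> \<le> \<bar>(measure M1 A - measure M1 K) - (measure M2 A - measure M2 K)\<bar> +
        \<bar>(measure M3 A - measure M3 K) - (measure M4 A - measure M4 K)\<bar>"
      by (rule order_trans[OF norm_triangle_ineq]) (simp only: norm_mult norm_of_real norm_ii mult_1_left real_norm_def order_refl)
    also have "\<dots> \<le> e"
    proof -
      have near: "0 \<le> measure M A - measure M K" "measure M A - measure M K \<le> e / 4"
        if M: "finite_measure M" "sets M = sets borel" and Ki: "measure M A - e / 4 < measure M Ki" "Ki \<subseteq> K" for M Ki
      proof -
        interpret finite_measure M by fact
        have "K \<in> sets M" "A \<in> sets M"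
          using K A M by (auto simp: borel_compact)
        then have "measure M Ki \<le> measure M K" "measure M K \<le> measure M A"
          using Ki K by (auto intro: finite_measure_mono)
        then show "0 \<le> measure M A - measure M K" "measure M A - measure M K \<le> e / 4"
          using Ki by linarith+
      qed
      have sub: "K1 \<subseteq> K" "K2 \<subseteq> K" "K3 \<subseteq> K" "K4 \<subseteq> K"
        by (auto simp: K_def)
      show ?thesis
        using near[OF fin(1) sets(1) K1(3) sub(1)] near[OF fin(2) sets(2) K2(3) sub(2)]
          near[OF fin(3) sets(3) K3(3) sub(3)] near[OF fin(4) sets(4) K4(3) sub(4)] by linarith
    qed
    finally show ?thesis .
  qed
  have "norm (cmeasure_val M1 M2 M3 M4 A) \<le> 0"
    by (rule field_le_epsilon) (simp add: small)
  then show ?thesis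
    by simp
qed

end
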